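(* Let $R$ be an $F$-finite Noetherian ring with $p$-generating set $x=x_1,\dots,x_n$ and induced surjection $\pi_\infty^R:S:=G(R;x)\to R$. Let $J\subseteq R$ be an ideal with preimage $J'\subseteq G(R;x)$. Then there is an isomorphism $\widehat{S}^{J'}\xrightarrow{\sim}G(\widehat{R}^J;x)$ making the following diagram commute: $$\begin{array}{ccccc}G(R;x)=S&\longrightarrow&\widehat{S}^{J'}&\xrightarrow{\ \sim\ }&G(\widehat{R}^J;x)\\ {\scriptstyle\pi_\infty^R}\downarrow&&&&\downarrow{\scriptstyle\pi_\infty^{\widehat{R}^J}}\\ R&&\longrightarrow&&\widehat{R}^J\end{array}$$ where the top left map is $J'$-adic completion and the bottom map is $J$-adic completion. In particular, $\widehat{G(R;x)}^{J'}\cong G(\widehat{R}^J;x)$.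
   Context: Fix a prime $p$; rings are commutative of characteristic $p$. $R^p\subseteq R$ is the image of Frobenius; $R$ is $F$-finite if Frobenius is finite. A finite tuple $x$ in $R$ is a $p$-generating set if $R=R^p[x_1,\dots,x_n]$. In $G(\widehat{R}^J;x)$, $x$ denotes the image of $x$ in $\widehat{R}^J$, which is a $p$-generating set. Gabber's construction: given an $F$-finite Noetherian ring $R$ with $p$-generating set $x$, put $R_0=R$, $x^{(0)}=x$, and inductively $R_{i}=R_{i-1}[X_1,\dots,X_n]/(X_j^p-x_j^{(i-1)})_{j}$ with $x_j^{(i)}$ the class of $X_j$, and $\phi:R_i\to R_{i-1}$ the surjection with $r\mapsto r^p$ for $r\in R_{i-1}$ and $X_j\mapsto x_j^{(i-1)}$. Then $G(R;x):=\varprojlim_\phi R_i$, and $\pi_\infty^R:G(R;x)\to R_0=R$ is the projection, which is surjective. *)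

theory Defs
  imports
    "HOL-Computational_Algebra.Primes"
    "HOL-Algebra.Ring_Divisibility"
    "HOL-Algebra.Generated_Rings"
    "HOL-Algebra.Ideal_Product"
    "HOL-Algebra.QuotRing"
    "HOL-Algebra.Weak_Morphisms"
    "HOL-Algebra.Indexed_Polynomials"
begin

section \<open>Finiteness conditions on Frobenius\<close>

text \<open>Finiteness of the Frobenius map, i.e. \<open>R\<close> is generated by a finite set \<open>B\<close> as a module
  over \<open>R\<^sup>p\<close>.\<close>

definition F_finite :: "nat \<Rightarrow> ('a, 'b) ring_scheme \<Rightarrow> bool" where
  "F_finite p R \<longleftrightarrow>
    (\<exists>B. finite B \<and> B \<subseteq> carrier R \<and>
      (\<forall>r\<in>carrier R. \<exists>c. c \<in> B \<rightarrow> carrier R \<and>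
        r = (\<Oplus>\<^bsub>R\<^esub>b\<in>B. (c b [^]\<^bsub>R\<^esub> p) \<otimes>\<^bsub>R\<^esub> b)))"

definition p_generating :: "nat \<Rightarrow> ('a, 'b) ring_scheme \<Rightarrow> 'a list \<Rightarrow> bool" where
  "p_generating p R x \<longleftrightarrow>
    set x \<subseteq> carrier R \<and>
    generate_ring R ((\<lambda>r. r [^]\<^bsub>R\<^esub> p) ` carrier R \<union> set x) = carrier R"

section \<open>Inverse limits and adic completion\<close>

definition inverse_limit ::
    "(nat \<Rightarrow> ('a, 'b) ring_scheme) \<Rightarrow> (nat \<Rightarrow> 'a \<Rightarrow> 'a) \<Rightarrow> (nat \<Rightarrow> 'a) ring" where
  "inverse_limit A f =
    \<lparr> carrier = {s. \<forall>i. s i \<in> carrier (A i) \<and> f i (s (Suc i)) = s i},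
      mult = (\<lambda>s t i. s i \<otimes>\<^bsub>A i\<^esub> t i),
      one = (\<lambda>i. \<one>\<^bsub>A i\<^esub>),
      zero = (\<lambda>i. \<zero>\<^bsub>A i\<^esub>),
      add = (\<lambda>s t i. s i \<oplus>\<^bsub>A i\<^esub> t i) \<rparr>"

definition ideal_pow :: "('a, 'b) ring_scheme \<Rightarrow> 'a set \<Rightarrow> nat \<Rightarrow> 'a set" where
  "ideal_pow R J n = J [^]\<^bsub>ideals_set R\<^esub> n"

text \<open>The transition map \<open>R/J\<^sup>n\<^sup>+\<^sup>1 \<rightarrow> R/J\<^sup>n\<close> sends a coset \<open>C = J\<^sup>n\<^sup>+\<^sup>1 + a\<close> to
  \<open>J\<^sup>n + C = J\<^sup>n + a\<close>.\<close>

definition adic_completion :: "('a, 'b) ring_scheme \<Rightarrow> 'a set \<Rightarrow> (nat \<Rightarrow> 'a set) ring" where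
  "adic_completion R J =
    inverse_limit (\<lambda>n. R Quot ideal_pow R J n) (\<lambda>n C. ideal_pow R J n <+>\<^bsub>R\<^esub> C)"

definition to_completion :: "('a, 'b) ring_scheme \<Rightarrow> 'a set \<Rightarrow> 'a \<Rightarrow> (nat \<Rightarrow> 'a set)" where
  "to_completion R J r = (\<lambda>n. ideal_pow R J n +>\<^bsub>R\<^esub> r)"

section \<open>Polynomial rings and adjunction of \<open>p\<close>-th roots\<close>

text \<open>The library's indexed polynomials, a monomial being the multiset of its indeterminates, do
  not come with a ring structure; the product is the usual convolution.\<close>

definition mpoly_ring :: "('a, 'b) ring_scheme \<Rightarrow> 'v set \<Rightarrow> ('v multiset \<Rightarrow> 'a) ring" where
  "mpoly_ring A V =
    \<lparr> carrier = ring.indexed_pset A V (carrier A),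
      mult = (\<lambda>f g m. \<Oplus>\<^bsub>A\<^esub>k\<in>{k. k \<subseteq># m}. f k \<otimes>\<^bsub>A\<^esub> g (m - k)),
      one = ring.indexed_const A \<one>\<^bsub>A\<^esub>,
      zero = ring.indexed_const A \<zero>\<^bsub>A\<^esub>,
      add = ring.indexed_padd A \<rparr>"

text \<open>For \<open>y = y\<^sub>1, \<dots>, y\<^sub>n\<close> the ring \<open>A[X\<^sub>1, \<dots>, X\<^sub>n]/(X\<^sub>j\<^sup>p - y\<^sub>j)\<^sub>j\<close>.  Indices run from \<open>0\<close> to \<open>n - 1\<close>.\<close>

abbreviation mpoly_on :: "('a, 'b) ring_scheme \<Rightarrow> 'a list \<Rightarrow> (nat multiset \<Rightarrow> 'a) ring" where
  "mpoly_on A y \<equiv> mpoly_ring A {..<length y}"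

definition root_ideal :: "nat \<Rightarrow> ('a, 'b) ring_scheme \<Rightarrow> 'a list \<Rightarrow> (nat multiset \<Rightarrow> 'a) set" where
  "root_ideal p A y =
    genideal (mpoly_on A y)
      {(ring.indexed_var A j [^]\<^bsub>mpoly_on A y\<^esub> p)
         \<ominus>\<^bsub>mpoly_on A y\<^esub> ring.indexed_const A (y ! j) | j. j < length y}"

definition root_ring :: "nat \<Rightarrow> ('a, 'b) ring_scheme \<Rightarrow> 'a list \<Rightarrow> (nat multiset \<Rightarrow> 'a) set ring" where
  "root_ring p A y = mpoly_on A y Quot root_ideal p A y"

definition root_class ::
    "nat \<Rightarrow> ('a, 'b) ring_scheme \<Rightarrow> 'a list \<Rightarrow> (nat multiset \<Rightarrow> 'a) \<Rightarrow> (nat multiset \<Rightarrow> 'a) set" where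
  "root_class p A y f = root_ideal p A y +>\<^bsub>mpoly_on A y\<^esub> f"

section \<open>Gabber's construction\<close>

text \<open>Iterating \<^const>\<open>root_ring\<close> changes the type of the elements at every step.  To have all
  stages of the tower in one type, the elements are renamed after each step along an injection
  into the following type: \<open>Base\<close> at stage \<open>0\<close>, and afterwards \<open>coset_code\<close>, which names a coset
  by a chosen representative.  The ring structure is carried along by \<^const>\<open>image_ring\<close>.\<close>

datatype 'a tower_elem = Base (base_elem: 'a) | Poly "nat multiset \<Rightarrow> 'a tower_elem"

definition coset_code :: "(nat multiset \<Rightarrow> 'a tower_elem) set \<Rightarrow> 'a tower_elem" where
  "coset_code C = Poly (SOME f. f \<in> C)"

text \<open>The pair \<open>(R\<^sub>i, x\<^sup>(\<^sup>i\<^sup>))\<close>.\<close>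

primrec tower ::
    "nat \<Rightarrow> ('a, 'b) ring_scheme \<Rightarrow> 'a list \<Rightarrow> nat \<Rightarrow> 'a tower_elem ring \<times> 'a tower_elem list" where
  "tower p R x 0 = (image_ring Base R, map Base x)"
| "tower p R x (Suc i) =
    (let A = fst (tower p R x i); y = snd (tower p R x i) in
      (image_ring coset_code (root_ring p A y),
       map (\<lambda>j. coset_code (root_class p A y (ring.indexed_var A j))) [0..<length y]))"

abbreviation tower_ring :: "nat \<Rightarrow> ('a, 'b) ring_scheme \<Rightarrow> 'a list \<Rightarrow> nat \<Rightarrow> 'a tower_elem ring" where
  "tower_ring p R x i \<equiv> fst (tower p R x i)"

abbreviation tower_gens :: "nat \<Rightarrow> ('a, 'b) ring_scheme \<Rightarrow> 'a list \<Rightarrow> nat \<Rightarrow> 'a tower_elem list" where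
  "tower_gens p R x i \<equiv> snd (tower p R x i)"

text \<open>The structure map \<open>R\<^sub>i \<rightarrow> R\<^sub>i\<^sub>+\<^sub>1\<close>.\<close>

definition tower_incl ::
    "nat \<Rightarrow> ('a, 'b) ring_scheme \<Rightarrow> 'a list \<Rightarrow> nat \<Rightarrow> 'a tower_elem \<Rightarrow> 'a tower_elem" where
  "tower_incl p R x i r =
    coset_code (root_class p (tower_ring p R x i) (tower_gens p R x i)
      (ring.indexed_const (tower_ring p R x i) r))"

text \<open>The map \<open>\<phi> : R\<^sub>i\<^sub>+\<^sub>1 \<rightarrow> R\<^sub>i\<close>.  The conditions determine it on the carrier of \<open>R\<^sub>i\<^sub>+\<^sub>1\<close>, the only
  place where it is used; it exists for \<open>R\<close> commutative of prime characteristic \<open>p\<close>.\<close>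

definition tower_phi ::
    "nat \<Rightarrow> ('a, 'b) ring_scheme \<Rightarrow> 'a list \<Rightarrow> nat \<Rightarrow> 'a tower_elem \<Rightarrow> 'a tower_elem" where
  "tower_phi p R x i =
    (SOME h. h \<in> ring_hom (tower_ring p R x (Suc i)) (tower_ring p R x i) \<and>
      (\<forall>r\<in>carrier (tower_ring p R x i).
        h (tower_incl p R x i r) = r [^]\<^bsub>tower_ring p R x i\<^esub> p) \<and>
      (\<forall>j<length x. h (tower_gens p R x (Suc i) ! j) = tower_gens p R x i ! j))"

definition gabber :: "nat \<Rightarrow> ('a, 'b) ring_scheme \<Rightarrow> 'a list \<Rightarrow> (nat \<Rightarrow> 'a tower_elem) ring" where
  "gabber p R x = inverse_limit (tower_ring p R x) (tower_phi p R x)"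

definition gabber_proj :: "(nat \<Rightarrow> 'a tower_elem) \<Rightarrow> 'a" where
  "gabber_proj s = base_elem (s 0)"

end

theory Submission
  imports Defs
begin

text \<open>Each \<open>R\<^sub>i\<^sub>+\<^sub>1\<close> is free over \<open>R\<^sub>i\<close> on the monomials \<open>x\<^sup>a\<close>, \<open>0 \<le> a\<^sub>j < p\<close>, and \<open>\<phi>\<close> composed
  with the inclusion is the Frobenius in either order.  Completing coefficientwise,
  the \<open>i\<close>-th ring of the tower of the \<open>J\<close>-adic completion of \<open>R\<close> is the \<open>J R\<^sub>i\<close>-adic completion of
  \<open>R\<^sub>i\<close>.  Hence \<open>G(R\<^sup>\<and>; x)\<close> is the completion of \<open>S = G(R; x)\<close> for the ideals
  \<open>L\<^sub>n = {s. s\<^sub>n \<in> J\<^sup>n R\<^sub>n}\<close>, density being due to the surjectivity of \<open>\<phi>\<close>, and it remains to compare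
  \<open>L\<^sub>n\<close> with the powers of \<open>J'\<close>.  Expanding all components of \<open>s \<in> S\<close> in the basis gives
  \<open>s = \<Sum> c\<^sub>a\<^sup>p x\<^sup>a\<close> with \<open>c\<^sub>a \<in> S\<close>, where \<open>s\<^sub>i\<^sub>+\<^sub>1 \<in> J\<^sup>n R\<^sub>i\<^sub>+\<^sub>1\<close> iff all \<open>(c\<^sub>a)\<^sub>i \<in> J\<^sup>n R\<^sub>i\<close>; by induction
  \<open>s\<^sub>i \<in> J\<^sup>n R\<^sub>i\<close> implies \<open>s \<in> J'\<^sup>k\<close> for \<open>k = min n (i + 1)\<close>, so that \<open>L\<^sub>n \<subseteq> J'\<^sup>n\<close>.  Conversely, an element of
  the image of \<open>J'\<close> in \<open>R\<^sub>n\<close> has its \<open>p\<^sup>n\<close>-th power in \<open>J R\<^sub>n\<close>, and \<open>R\<^sub>n\<close> is Noetherian, so some power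
  of \<open>J'\<close> lies in \<open>L\<^sub>n\<close>.\<close>

section \<open>Frobenius in characteristic \<open>p\<close>\<close>

text \<open>The completion of a stage is never computed as a ring of coset sequences. The locale
  \<open>filtered_completion\<close> records what makes a map a completion: the source filtration is
  pulled back from the target, the image is dense, and the target is separated and complete at a
  fixed rate. This notion passes to finite free extensions, to inverse limits and along
  isomorphisms. Coset sequences occur only for R itself and in the final comparison
  \<open>adic_completion_iso\<close>. In the limit the filtration has to be diagonal: no single
  stage need separate the elements of S, so index n must also control stage n. Such a filtration
  does not consist of powers of one ideal, whence the comparison with the powers of J'. One
  inclusion keeps the index, because every stage climbed gains a factor of J'. The other one needs
  an exponent depending on n: J' only bounds the component at stage 0, every stage climbed costs a
  p-th power, and a bound on powers of single elements has to be turned into a bound on powers of an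
  ideal.\<close>

lemma (in cring) binomial_expansion:
  assumes a: "a \<in> carrier R" and b: "b \<in> carrier R"
  shows "(a \<oplus> b) [^] (n::nat) = (\<Oplus>k\<in>{..n}. [(n choose k)] \<cdot> (a [^] k \<otimes> b [^] (n - k)))"
proof (induction n)
  case 0
  then show ?case using a b by simp
next
  case (Suc n)
  define f where "f m k = [(m choose k)] \<cdot> (a [^] k \<otimes> b [^] (m - k))" for m k
  define g where "g k = [(n choose k)] \<cdot> (a [^] k \<otimes> b [^] (Suc n - k))" for k
  have fc [simp]: "f m k \<in> carrier R" for m k using a b by (simp add: f_def)
  have gc [simp]: "g k \<in> carrier R" for k using a b by (simp add: g_def)
  \<comment> \<open>Pascal's rule: the two summands carry the coefficients \<open>n choose k\<close>
    and \<open>n choose Suc k\<close> of the same monomial.\<close>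
  have af: "a \<otimes> f n k \<oplus> g (Suc k) = f (Suc n) (Suc k)" for k
    using a b by (simp add: f_def g_def add_pow_rdistr add.nat_pow_mult [symmetric] nat_pow_Suc2 m_assoc m_lcomm)
  have bf: "f n k \<otimes> b = g k" if "k \<le> n" for k
    using a b that by (simp add: f_def g_def add_pow_ldistr m_assoc Suc_diff_le)
  have "(a \<oplus> b) [^] Suc n = (\<Oplus>k\<in>{..n}. f n k) \<otimes> a \<oplus> (\<Oplus>k\<in>{..n}. f n k) \<otimes> b"
    using a b Suc by (simp add: f_def r_distr)
  also have "(\<Oplus>k\<in>{..n}. f n k) \<otimes> a = (\<Oplus>k\<in>{..n}. a \<otimes> f n k)"
    using a by (subst m_comm) (simp_all add: finsum_rdistr)
  also have "(\<Oplus>k\<in>{..n}. f n k) \<otimes> b = (\<Oplus>k\<in>{..n}. g k)"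
    using b by (simp add: finsum_ldistr bf cong: finsum_cong)
  \<comment> \<open>The added term vanishes because \<open>n choose Suc n\<close> is 0.\<close>
  also have "\<dots> = (\<Oplus>k\<in>{..Suc n}. g k)"
    by (simp add: g_def a b binomial_eq_0)
  also have "\<dots> = (\<Oplus>k\<in>{..n}. g (Suc k)) \<oplus> g 0"
    by (rule finsum_Suc2) simp
  also have "(\<Oplus>k\<in>{..n}. a \<otimes> f n k) \<oplus> ((\<Oplus>k\<in>{..n}. g (Suc k)) \<oplus> g 0)
      = (\<Oplus>k\<in>{..n}. a \<otimes> f n k \<oplus> g (Suc k)) \<oplus> g 0"
    using a by (subst finsum_addf) (auto simp: a_assoc)
  also have "\<dots> = (\<Oplus>k\<in>{..n}. f (Suc n) (Suc k)) \<oplus> f (Suc n) 0"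
    by (simp only: af) (simp add: g_def f_def)
  also have "\<dots> = (\<Oplus>k\<in>{..Suc n}. f (Suc n) k)"
    by (rule finsum_Suc2 [symmetric]) simp
  finally show ?case by (simp add: f_def)
qed

text \<open>By primality p divides every inner binomial coefficient, and multiples of p annihilate
  the ring because p times one is zero.\<close>

lemma (in cring) frobenius_add:
  assumes p: "Factorial_Ring.prime p" and char: "[p] \<cdot> \<one> = \<zero>"
    and a: "a \<in> carrier R" and b: "b \<in> carrier R"
  shows "(a \<oplus> b) [^] (p::nat) = a [^] p \<oplus> b [^] p"
proof -
  define f where "f k = [(p choose k)] \<cdot> (a [^] k \<otimes> b [^] (p - k))" for k
  have fc [simp]: "f k \<in> carrier R" for k using a b by (simp add: f_def)
  have pz: "[p] \<cdot> t = \<zero>" if "t \<in> carrier R" for t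
    using add_pow_ldistr [of \<one> t p] char that by simp
  have f0: "f k = \<zero>" if "k \<noteq> 0" "k \<noteq> p" "k \<le> p" for k
  proof -
    have "p dvd (p choose k)" using p that by (intro dvd_choose_prime) auto
    then obtain m where "p choose k = p * m" by blast
    then show ?thesis
      using a b by (simp add: f_def add.nat_pow_pow [symmetric] pz)
  qed
  have p0: "p \<noteq> 0" using p by auto
  have "(a \<oplus> b) [^] p = (\<Oplus>k\<in>{..p}. f k)" using binomial_expansion [OF a b] by (simp add: f_def)
  also have "\<dots> = (\<Oplus>k\<in>{0,p}. f k)"
    by (rule add.finprod_mono_neutral_cong_right) (auto intro: f0)
  also have "\<dots> = f 0 \<oplus> f p" using p0 by simp
  also have "\<dots> = a [^] p \<oplus> b [^] p" using a b by (simp add: f_def a_comm)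
  finally show ?thesis .
qed

lemma (in cring) frobenius_finsum:
  assumes p: "Factorial_Ring.prime p" and char: "[p] \<cdot> \<one> = \<zero>"
    and "finite A" "f \<in> A \<rightarrow> carrier R"
  shows "(\<Oplus>i\<in>A. f i) [^] (p::nat) = (\<Oplus>i\<in>A. f i [^] p)"
  using assms(3,4)
proof (induction A)
  case empty
  then show ?case using p by (simp add: prime_gt_0_nat nat_pow_zero)
next
  case (insert x A)
  then have "f x \<in> carrier R" "f \<in> A \<rightarrow> carrier R" by auto
  with insert show ?case by (simp add: frobenius_add [OF p char] Pi_def)
qed

lemma (in comm_monoid) finprod_nat_pow:
  assumes "f \<in> A \<rightarrow> carrier G"
  shows "(\<Otimes>i\<in>A. f i) [^] (n::nat) = (\<Otimes>i\<in>A. f i [^] n)"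
  using assms by (induction A rule: infinite_finite_induct) (auto simp: nat_pow_distrib Pi_def)

lemma ring_hom_add_pow:
  assumes "ring R" "ring S" "h \<in> ring_hom R S" "a \<in> carrier R"
  shows "h ([(n::nat)] \<cdot>\<^bsub>R\<^esub> a) = [n] \<cdot>\<^bsub>S\<^esub> h a"
proof -
  interpret ring_hom_ring R S h using assms by (simp add: ring_hom_ringI2)
  show ?thesis using assms(4) by (induction n) simp_all
qed

section \<open>Polynomial rings\<close>

text \<open>Makes the convolution sums finite; \<open>finsum\<close> over an infinite set would only
  return its default value.\<close>

lemma finite_submultisets: "finite {k. k \<subseteq># (m :: 'v multiset)}"
proof (induction m)
  case empty
  then show ?case by simp
next
  case (add x m)
  have "{k. k \<subseteq># add_mset x m} \<subseteq> {k. k \<subseteq># m} \<union> add_mset x ` {k. k \<subseteq># m}"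
  proof
    fix k assume "k \<in> {k. k \<subseteq># add_mset x m}"
    then have k: "k \<subseteq># add_mset x m" by simp
    show "k \<in> {k. k \<subseteq># m} \<union> add_mset x ` {k. k \<subseteq># m}"
    proof (cases "x \<in># k")
      case True
      then obtain l where "k = add_mset x l" by (metis mset_add)
      then show ?thesis using k by auto
    next
      case False
      then have "k \<subseteq># m"
        using k by (metis add_mset_remove_trivial diff_single_trivial insert_subset_eq_iff
            subset_eq_diff_conv union_single_eq_diff add_mset_add_single)
      then show ?thesis by simp
    qed
  qed
  then show ?case using add finite_subset by blast
qed

context cring
begin

text \<open>The product of \<open>mpoly_ring\<close> freed from the index set V, so that its laws
  can be stated for arbitrary coefficient functions wherever they hold for them.\<close>

definition mpoly_conv :: "('v multiset \<Rightarrow> 'a) \<Rightarrow> ('v multiset \<Rightarrow> 'a) \<Rightarrow> 'v multiset \<Rightarrow> 'a" where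
  "mpoly_conv f g m = (\<Oplus>k\<in>{k. k \<subseteq># m}. f k \<otimes> g (m - k))"

lemma mpoly_ring_simps:
  "carrier (mpoly_ring R V) = indexed_pset V (carrier R)"
  "f \<otimes>\<^bsub>mpoly_ring R V\<^esub> g = mpoly_conv f g"
  "\<one>\<^bsub>mpoly_ring R V\<^esub> = indexed_const \<one>"
  "\<zero>\<^bsub>mpoly_ring R V\<^esub> = indexed_const \<zero>"
  "f \<oplus>\<^bsub>mpoly_ring R V\<^esub> g = indexed_padd f g"
  by (auto simp: mpoly_ring_def mpoly_conv_def fun_eq_iff)

lemma carrier_coeff_conv:
  "carrier_coeff f \<Longrightarrow> carrier_coeff g \<Longrightarrow> carrier_coeff (mpoly_conv f g)"
  by (auto simp: carrier_coeff_def mpoly_conv_def intro!: finsum_closed)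

lemma mpoly_conv_const:
  assumes "c \<in> carrier R" "carrier_coeff g"
  shows "mpoly_conv (indexed_const c) g = (\<lambda>m. c \<otimes> g m)"
proof
  fix m
  have "mpoly_conv (indexed_const c) g m
      = (\<Oplus>k\<in>{k. k \<subseteq># m}. if {#} = k then c \<otimes> g (m - k) else \<zero>)"
    unfolding mpoly_conv_def
    by (rule finsum_cong') (use assms in \<open>auto simp: indexed_const_def carrier_coeff_def\<close>)
  also have "\<dots> = c \<otimes> g (m - {#})"
    by (rule finsum_singleton) (use assms in \<open>auto simp: carrier_coeff_def finite_submultisets\<close>)
  finally show "mpoly_conv (indexed_const c) g m = c \<otimes> g m" by simp
qed

text \<open>The complement map sending k to \<open>m - k\<close> is an involution on the
  submultisets of m and exchanges the two factors.\<close>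

lemma mpoly_conv_comm:
  assumes "carrier_coeff f" "carrier_coeff g"
  shows "mpoly_conv f g = mpoly_conv g f"
proof
  fix m
  have fg: "f k \<in> carrier R" "g k \<in> carrier R" for k using assms by (auto simp: carrier_coeff_def)
  have "mpoly_conv g f m = (\<Oplus>k\<in>(\<lambda>k. m - k) ` {k. k \<subseteq># m}. g k \<otimes> f (m - k))"
    unfolding mpoly_conv_def
  proof (rule arg_cong [where f = "finsum R _"])
    show "{k. k \<subseteq># m} = (-) m ` {k. k \<subseteq># m}"
      by (auto simp: image_iff) (metis diff_subset_eq_self multiset_diff_union_assoc subset_mset.diff_diff_right
          subset_mset.add_diff_inverse add_diff_cancel_left')
  qed
  also have "\<dots> = (\<Oplus>k\<in>{k. k \<subseteq># m}. g (m - k) \<otimes> f (m - (m - k)))"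
  proof (rule finsum_reindex)
    show "inj_on ((-) m) {k. k \<subseteq># m}"
      by (rule inj_onI) (metis mem_Collect_eq subset_mset.diff_diff_right add_diff_cancel_left' subset_mset.add_diff_inverse)
  qed (use fg in auto)
  also have "\<dots> = mpoly_conv f g m"
    unfolding mpoly_conv_def
    by (rule finsum_cong') (use fg in \<open>auto simp: m_comm subset_mset.diff_diff_right\<close>)
  finally show "mpoly_conv f g m = mpoly_conv g f m" ..
qed

lemma mpoly_conv_padd:
  assumes "carrier_coeff f" "carrier_coeff g" "carrier_coeff h"
  shows "mpoly_conv (indexed_padd f g) h = indexed_padd (mpoly_conv f h) (mpoly_conv g h)"
proof
  fix m
  have "f k \<in> carrier R" "g k \<in> carrier R" "h k \<in> carrier R" for k
    using assms by (auto simp: carrier_coeff_def)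
  then show "mpoly_conv (indexed_padd f g) h m = indexed_padd (mpoly_conv f h) (mpoly_conv g h) m"
    by (simp add: mpoly_conv_def indexed_padd_def l_distr finsum_addf)
qed

text \<open>Only submultisets containing j contribute, and those of \<open>add_mset j m'\<close>
  correspond to the submultisets of m' by removing one j. This is the inductive step of every later
  induction on the first factor.\<close>

lemma mpoly_conv_pmult:
  assumes "carrier_coeff f" "carrier_coeff g"
  shows "mpoly_conv (indexed_pmult f j) g = indexed_pmult (mpoly_conv f g) j"
proof
  fix m
  have fg: "f k \<in> carrier R" "g k \<in> carrier R" for k using assms by (auto simp: carrier_coeff_def)
  show "mpoly_conv (indexed_pmult f j) g m = indexed_pmult (mpoly_conv f g) j m"
  proof (cases "j \<in># m")
    case False
    then have "indexed_pmult f j k \<otimes> g (m - k) = \<zero>" if "k \<subseteq># m" for k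
      using that fg by (auto simp: indexed_pmult_def dest: mset_subset_eqD)
    then have "mpoly_conv (indexed_pmult f j) g m = \<zero>"
      unfolding mpoly_conv_def by (intro add.finprod_one_eqI) simp
    then show ?thesis using False by (simp add: indexed_pmult_def)
  next
    case True
    then obtain m' where m: "m = add_mset j m'" by (metis mset_add)
    have "mpoly_conv (indexed_pmult f j) g m
        = (\<Oplus>k\<in>add_mset j ` {k. k \<subseteq># m'}. indexed_pmult f j k \<otimes> g (m - k))"
      unfolding mpoly_conv_def
    proof (rule add.finprod_mono_neutral_cong_right)
      show "add_mset j ` {k. k \<subseteq># m'} \<subseteq> {k. k \<subseteq># m}" using m by auto
      fix k assume k: "k \<in> {k. k \<subseteq># m} - add_mset j ` {k. k \<subseteq># m'}"
      have "j \<notin># k"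
      proof
        assume "j \<in># k"
        then obtain l where "k = add_mset j l" by (metis mset_add)
        then show False using k m by auto
      qed
      then show "indexed_pmult f j k \<otimes> g (m - k) = \<zero>" using fg by (simp add: indexed_pmult_def)
    qed (use fg in \<open>auto simp: finite_submultisets indexed_pmult_def\<close>)
    also have "\<dots> = (\<Oplus>k\<in>{k. k \<subseteq># m'}. indexed_pmult f j (add_mset j k) \<otimes> g (m - add_mset j k))"
      by (rule finsum_reindex) (use fg in \<open>auto simp: indexed_pmult_def inj_on_def\<close>)
    also have "\<dots> = indexed_pmult (mpoly_conv f g) j m"
      by (simp add: m indexed_pmult_def mpoly_conv_def)
    finally show ?thesis .
  qed
qed

lemma pset_coeff: "f \<in> indexed_pset V (carrier R) \<Longrightarrow> carrier_coeff f"
  using indexed_pset_in_carrier by blast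

text \<open>\<open>indexed_pset\<close> has rules only for constants, sums and multiplication by a
  variable. Scaling supplies the negatives and, through \<open>mpoly_conv_const\<close>, the base
  case of closure under products.\<close>

lemma smult_in_pset:
  assumes "c \<in> carrier R" "f \<in> indexed_pset V (carrier R)"
  shows "(\<lambda>m. c \<otimes> f m) \<in> indexed_pset V (carrier R)"
  using assms(2)
proof induction
  case (indexed_const k)
  have "(\<lambda>m. c \<otimes> indexed_const k m) = indexed_const (c \<otimes> k)"
    using assms(1) by (auto simp: indexed_const_def)
  then show ?case using assms(1) indexed_const by (metis indexed_pset.indexed_const m_closed)
next
  case (indexed_padd f g)
  have "(\<lambda>m. c \<otimes> indexed_padd f g m) = indexed_padd (\<lambda>m. c \<otimes> f m) (\<lambda>m. c \<otimes> g m)"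
    using assms(1) indexed_padd.hyps [THEN pset_coeff]
    by (auto simp: indexed_padd_def carrier_coeff_def r_distr)
  then show ?case using indexed_padd.IH by (simp add: indexed_pset.indexed_padd)
next
  case (indexed_pmult f i)
  have "(\<lambda>m. c \<otimes> indexed_pmult f i m) = indexed_pmult (\<lambda>m. c \<otimes> f m) i"
    using assms(1) by (auto simp: indexed_pmult_def)
  then show ?case using indexed_pmult by (simp add: indexed_pset.indexed_pmult)
qed

lemma mpoly_conv_in_pset:
  assumes "f \<in> indexed_pset V (carrier R)" "g \<in> indexed_pset V (carrier R)"
  shows "mpoly_conv f g \<in> indexed_pset V (carrier R)"
  using assms(1)
proof induction
  case (indexed_const k)
  then show ?case using assms(2) by (simp add: mpoly_conv_const pset_coeff smult_in_pset)
next
  case (indexed_padd f g)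
  then show ?case using assms(2) by (simp add: mpoly_conv_padd pset_coeff indexed_pset.indexed_padd)
next
  case (indexed_pmult f i)
  then show ?case using assms(2) by (simp add: mpoly_conv_pmult pset_coeff indexed_pset.indexed_pmult)
qed

text \<open>Induction on the construction of f replaces the usual rearrangement of a double sum over
  decompositions of a monomial into three parts.\<close>

lemma mpoly_conv_assoc:
  assumes "f \<in> indexed_pset V (carrier R)" "carrier_coeff g" "carrier_coeff h"
  shows "mpoly_conv (mpoly_conv f g) h = mpoly_conv f (mpoly_conv g h)"
  using assms(1)
proof induction
  case (indexed_const k)
  have "mpoly_conv (\<lambda>m. k \<otimes> g m) h m = k \<otimes> mpoly_conv g h m" for m
    using indexed_const assms(2,3)
    by (auto simp: mpoly_conv_def carrier_coeff_def m_assoc Pi_def finsum_rdistr finite_submultisets)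
  then show ?case using assms indexed_const by (auto simp: mpoly_conv_const carrier_coeff_conv)
next
  case (indexed_padd f g')
  then show ?case using assms(2,3) by (simp add: mpoly_conv_padd pset_coeff carrier_coeff_conv)
next
  case (indexed_pmult f i)
  then show ?case using assms(2,3) by (simp add: mpoly_conv_pmult pset_coeff carrier_coeff_conv)
qed

lemma mpoly_ring_cring: "cring (mpoly_ring R V)"
proof (rule cringI)
  show "abelian_group (mpoly_ring R V)"
  proof (rule abelian_groupI)
    fix f assume "f \<in> carrier (mpoly_ring R V)"
    then have f: "f \<in> indexed_pset V (carrier R)" by (simp add: mpoly_ring_simps)
    have "(\<lambda>m. \<ominus> \<one> \<otimes> f m) \<in> carrier (mpoly_ring R V)"
      using f by (simp add: mpoly_ring_simps smult_in_pset)
    moreover have "(\<lambda>m. \<ominus> \<one> \<otimes> f m) \<oplus>\<^bsub>mpoly_ring R V\<^esub> f = \<zero>\<^bsub>mpoly_ring R V\<^esub>"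
      using pset_coeff [OF f]
      by (auto simp: mpoly_ring_simps indexed_padd_def indexed_const_def carrier_coeff_def l_minus l_neg)
    ultimately show "\<exists>g\<in>carrier (mpoly_ring R V). g \<oplus>\<^bsub>mpoly_ring R V\<^esub> f = \<zero>\<^bsub>mpoly_ring R V\<^esub>" by blast
  qed (auto simp: mpoly_ring_simps indexed_pset.indexed_padd indexed_pset.indexed_const indexed_padd_zero
      pset_coeff, auto simp: indexed_padd_def carrier_coeff_def a_assoc a_comm a_lcomm dest!: pset_coeff)
next
  show "Group.comm_monoid (mpoly_ring R V)"
  proof (rule comm_monoidI)
    fix f g assume "f \<in> carrier (mpoly_ring R V)" "g \<in> carrier (mpoly_ring R V)"
    then show "f \<otimes>\<^bsub>mpoly_ring R V\<^esub> g = g \<otimes>\<^bsub>mpoly_ring R V\<^esub> f"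
      by (simp add: mpoly_ring_simps mpoly_conv_comm pset_coeff)
  qed (auto simp: mpoly_ring_simps indexed_pset.indexed_const mpoly_conv_in_pset mpoly_conv_assoc
      pset_coeff mpoly_conv_const, auto simp: carrier_coeff_def dest!: pset_coeff)
qed (auto simp: mpoly_ring_simps mpoly_conv_padd pset_coeff)

end

section \<open>Powers of ideals\<close>

context cring
begin

lemma ideal_pow_simps:
  "ideal_pow R J 0 = carrier R"
  "ideal_pow R J (Suc n) = ideal_pow R J n \<cdot> J"
  by (simp_all add: ideal_pow_def ideals_set_def nat_pow_def)

lemma ideal_ideal_pow: "ideal J R \<Longrightarrow> ideal (ideal_pow R J n) R"
  by (induction n) (simp_all add: ideal_pow_simps oneideal ideal_prod_is_ideal)

lemma ideal_pow_decseq: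
  assumes "ideal J R"
  shows "ideal_pow R J (Suc n) \<subseteq> ideal_pow R J n"
  using ideal_prod_inter [OF ideal_ideal_pow [OF assms] assms] by (auto simp: ideal_pow_simps)

lemma ideal_pow_antimono:
  assumes "ideal J R" "m \<le> n"
  shows "ideal_pow R J n \<subseteq> ideal_pow R J m"
  using lift_Suc_antimono_le [of "ideal_pow R J"] ideal_pow_decseq [OF assms(1)] assms(2) by blast

lemma ideal_pow_1: "ideal J R \<Longrightarrow> ideal_pow R J (Suc 0) = J"
  by (metis ideal_pow_simps ideal_prod_commute ideal_prod_one oneideal)

lemma ideal_prod_mono: "I \<subseteq> I' \<Longrightarrow> J \<subseteq> J' \<Longrightarrow> I \<cdot> J \<subseteq> I' \<cdot> J'"
proof
  fix s assume "I \<subseteq> I'" "J \<subseteq> J'" "s \<in> I \<cdot> J"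
  from this(3) this(1,2) show "s \<in> I' \<cdot> J'"
    by induction (auto intro: ideal_prod.intros)
qed

lemma ideal_pow_mono: "I \<subseteq> J \<Longrightarrow> ideal_pow R I n \<subseteq> ideal_pow R J n"
  by (induction n) (auto simp: ideal_pow_simps dest: ideal_prod_mono)

lemma nat_pow_in_ideal_pow: "J \<subseteq> carrier R \<Longrightarrow> r \<in> J \<Longrightarrow> r [^] k \<in> ideal_pow R J k"
  by (induction k) (auto simp: ideal_pow_simps ideal_prod.prod)

lemma PIdl_pow:
  assumes g: "g \<in> carrier R"
  shows "ideal_pow R (PIdl g) n \<subseteq> PIdl (g [^] n)"
proof (induction n)
  case 0
  have "carrier R \<subseteq> PIdl \<one>" by (force simp: cgenideal_def)
  then show ?case by (simp add: ideal_pow_simps)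
next
  case (Suc n)
  interpret gn: ideal "PIdl (g [^] Suc n)" R using g by (intro cgenideal_ideal) simp
  show ?case
  proof
    fix s assume "s \<in> ideal_pow R (PIdl g) (Suc n)"
    then have "s \<in> (PIdl (g [^] n)) \<cdot> (PIdl g)"
      using ideal_prod_mono [OF Suc order_refl] ideal_pow_simps(2) by blast
    then show "s \<in> PIdl (g [^] Suc n)"
    proof induction
      case (prod i j)
      then obtain a b where ab: "a \<in> carrier R" "b \<in> carrier R" "i = a \<otimes> g [^] n" "j = b \<otimes> g"
        unfolding cgenideal_def by blast
      have "(a \<otimes> u) \<otimes> (b \<otimes> g) = (a \<otimes> b) \<otimes> (u \<otimes> g)" if "u \<in> carrier R" for u
        using ab(1,2) g that by (simp add: m_assoc m_lcomm)
      then have "i \<otimes> j = (a \<otimes> b) \<otimes> g [^] Suc n"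
        unfolding ab(3,4) nat_pow_Suc using g by blast
      moreover have "a \<otimes> b \<in> carrier R" using ab by simp
      ultimately show ?case unfolding cgenideal_def by blast
    next
      case (sum s1 s2)
      then show ?case by (intro gn.a_closed)
    qed
  qed
qed

text \<open>The binomial expansion of a power of P + Q: each term of degree a + b contains at least
  a factors P or at least b factors Q.\<close>

lemma ideal_pow_add_subset:
  assumes P: "ideal P R" and Q: "ideal Q R" and F: "ideal F R"
    and Pa: "ideal_pow R P a \<subseteq> F" and Qb: "ideal_pow R Q b \<subseteq> F"
  shows "ideal_pow R (P <+>\<^bsub>R\<^esub> Q) (a + b) \<subseteq> F"
proof -
  interpret F: ideal F R by fact
  let ?S = "P <+>\<^bsub>R\<^esub> Q"
  have S: "ideal ?S R" using P Q by (rule add_ideals)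
  note ip = ideal_ideal_pow
  \<comment> \<open>Generalised to partly expanded products, so that the induction on k can
    distribute one factor P + Q at a time.\<close>
  have "(ideal_pow R P i \<cdot> ideal_pow R Q j) \<cdot> ideal_pow R ?S k \<subseteq> F" if "a + b \<le> i + j + k" for i j k
    using that
  proof (induction k arbitrary: i j)
    case 0
    have "ideal_pow R P i \<cdot> ideal_pow R Q j \<subseteq> ideal_pow R P i \<inter> ideal_pow R Q j"
      using P Q by (intro ideal_prod_inter ip)
    moreover have "a \<le> i \<or> b \<le> j" using 0 by auto
    ultimately have "ideal_pow R P i \<cdot> ideal_pow R Q j \<subseteq> F"
      using ideal_pow_antimono [OF P] ideal_pow_antimono [OF Q] Pa Qb by blast
    then show ?case
      using P Q by (simp add: ideal_pow_simps ideal_prod_one ideal_prod_is_ideal ip)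
  next
    case (Suc k)
    let ?X = "ideal_pow R P i \<cdot> ideal_pow R Q j"
    let ?Sk = "ideal_pow R ?S k"
    have X: "ideal ?X R" and Sk: "ideal ?Sk R" using P Q S by (simp_all add: ideal_prod_is_ideal ip)
    have "?X \<cdot> ideal_pow R ?S (Suc k) = ?X \<cdot> (?S \<cdot> ?Sk)"
      using S Sk by (simp add: ideal_pow_simps ideal_prod_commute)
    also have "\<dots> = (?X \<cdot> ?S) \<cdot> ?Sk"
      using X S Sk by (simp add: ideal_prod_assoc)
    also have "?X \<cdot> ?S = (?X \<cdot> P) <+>\<^bsub>R\<^esub> (?X \<cdot> Q)"
      using X P Q by (simp add: ideal_prod_distr)
    also have "?X \<cdot> Q = ideal_pow R P i \<cdot> ideal_pow R Q (Suc j)"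
      using P Q by (simp add: ideal_pow_simps ideal_prod_assoc ip)
    also have "?X \<cdot> P = P \<cdot> ?X" using X P by (simp add: ideal_prod_commute)
    also have "\<dots> = (P \<cdot> ideal_pow R P i) \<cdot> ideal_pow R Q j"
      using P Q by (simp add: ideal_prod_assoc ip)
    also have "P \<cdot> ideal_pow R P i = ideal_pow R P (Suc i)"
      using P by (simp add: ideal_pow_simps ideal_prod_commute ip)
    also have "(ideal_pow R P (Suc i) \<cdot> ideal_pow R Q j <+>\<^bsub>R\<^esub> ideal_pow R P i \<cdot> ideal_pow R Q (Suc j)) \<cdot> ?Sk
        = ideal_pow R P (Suc i) \<cdot> ideal_pow R Q j \<cdot> ?Sk <+>\<^bsub>R\<^esub> ideal_pow R P i \<cdot> ideal_pow R Q (Suc j) \<cdot> ?Sk"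
      by (rule ideal_prod_distr(2)) (use P Q S in \<open>simp_all add: ideal_prod_is_ideal ip\<close>)
    also have "\<dots> \<subseteq> F"
    proof -
      have "ideal_pow R P (Suc i) \<cdot> ideal_pow R Q j \<cdot> ?Sk \<subseteq> F"
        "ideal_pow R P i \<cdot> ideal_pow R Q (Suc j) \<cdot> ?Sk \<subseteq> F"
        using Suc.IH [of "Suc i" j] Suc.IH [of i "Suc j"] Suc.prems by auto
      then show ?thesis by (force simp: set_add_def' F.a_closed)
    qed
    finally show ?case .
  qed
  moreover have "carrier R \<cdot> ideal_pow R ?S (a + b) = ideal_pow R ?S (a + b)"
    using S by (simp add: ideal_prod_commute [OF oneideal] ideal_prod_one ip)
  ultimately show ?thesis
    by (metis add_0 ideal_pow_simps(1) ideal_prod_one le_refl oneideal)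
qed

text \<open>Generators are added one at a time; the exponents of the principal ideal and of the rest
  add up by \<open>ideal_pow_add_subset\<close>.\<close>

lemma ideal_pow_genideal_subset:
  assumes F: "ideal F R" and "finite G" "G \<subseteq> carrier R"
    and "\<And>g. g \<in> G \<Longrightarrow> \<exists>n::nat. g [^] n \<in> F"
  shows "\<exists>N. ideal_pow R (Idl G) N \<subseteq> F"
  using assms(2-)
proof (induction G)
  case empty
  have "ideal_pow R (Idl {}) (Suc 0) \<subseteq> F"
    using genideal_minimal [OF F, of "{}"] by (simp add: ideal_pow_1 genideal_ideal)
  then show ?case ..
next
  case (insert g G)
  obtain a where a: "ideal_pow R (Idl G) a \<subseteq> F" using insert by auto
  obtain n :: nat where n: "g [^] n \<in> F" using insert.prems by auto
  have g: "g \<in> carrier R" and G: "G \<subseteq> carrier R" using insert.prems by auto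
  have "ideal_pow R (PIdl g) n \<subseteq> F"
    using PIdl_pow [OF g, of n] cgenideal_minimal [OF F n] by blast
  note ideal_pow_add_subset [OF cgenideal_ideal [OF g] genideal_ideal [OF G] F this a]
  moreover have "Idl (insert g G) \<subseteq> PIdl g <+>\<^bsub>R\<^esub> Idl G"
  proof (rule genideal_minimal)
    have 1: "\<zero> \<in> Idl G" "\<zero> \<in> PIdl g"
      using genideal_ideal [OF G] cgenideal_ideal [OF g]
      by (simp_all add: additive_subgroup.zero_closed ideal.axioms(1))
    have "g \<oplus> \<zero> \<in> PIdl g <+>\<^bsub>R\<^esub> Idl G"
      using cgenideal_self [OF g] 1 by (auto simp: set_add_def')
    moreover have "\<zero> \<oplus> h \<in> PIdl g <+>\<^bsub>R\<^esub> Idl G" if "h \<in> G" for h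
      using genideal_self [OF G] that 1 by (auto simp: set_add_def')
    ultimately show "insert g G \<subseteq> PIdl g <+>\<^bsub>R\<^esub> Idl G" using g G by fastforce
  qed (intro add_ideals cgenideal_ideal genideal_ideal g G)
  ultimately have "ideal_pow R (Idl (insert g G)) (n + a) \<subseteq> F"
    using ideal_pow_mono by blast
  then show ?case ..
qed

end

text \<open>The exponent n may vary with r. Finitely many generators turn these exponents into one
  that serves the whole ideal.\<close>

lemma ideal_pow_subset_of_radical:
  assumes "cring R" "noetherian_ring R" "ideal I R" "ideal F R"
    and "\<And>r. r \<in> I \<Longrightarrow> \<exists>n::nat. r [^]\<^bsub>R\<^esub> n \<in> F"
  shows "\<exists>N. ideal_pow R I N \<subseteq> F"
proof -
  interpret cring R by fact
  obtain G where "G \<subseteq> carrier R" "finite G" "I = Idl\<^bsub>R\<^esub> G"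
    using noetherian_ring.finetely_gen [OF assms(2,3)] by blast
  then show ?thesis
    using ideal_pow_genideal_subset [OF assms(4), of G] assms(5) genideal_self [of G] by blast
qed

lemma ring_hom_ideal_pow:
  assumes "cring R" "cring S" "h \<in> ring_hom R S" "ideal I R" "h ` I \<subseteq> I'"
  shows "h ` ideal_pow R I n \<subseteq> ideal_pow S I' n"
proof (induction n)
  case 0
  then show ?case
    using ring_hom_closed [OF assms(3)] by (auto simp: cring.ideal_pow_simps assms)
next
  case (Suc n)
  interpret R: cring R by fact
  interpret S: cring S by fact
  note IR = R.ideal_ideal_pow [OF assms(4)]
  have "h s \<in> ideal_prod S (ideal_pow S I' n) I'" if "s \<in> ideal_prod R (ideal_pow R I n) I" for s
    using that
  proof induction
    case (prod i j)
    then have "h (i \<otimes>\<^bsub>R\<^esub> j) = h i \<otimes>\<^bsub>S\<^esub> h j"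
      using ideal.Icarr [OF IR] ideal.Icarr [OF assms(4)] by (intro ring_hom_mult [OF assms(3)])
    then show ?case using prod Suc assms(5) by (auto intro!: ideal_prod.prod)
  next
    case (sum s t)
    then have "h (s \<oplus>\<^bsub>R\<^esub> t) = h s \<oplus>\<^bsub>S\<^esub> h t"
      using R.ideal_prod_in_carrier [OF IR assms(4)] by (intro ring_hom_add [OF assms(3)]) auto
    then show ?case using sum by (simp add: ideal_prod.sum)
  qed
  then show ?case by (auto simp: R.ideal_pow_simps S.ideal_pow_simps)
qed

section \<open>Finite free extensions\<close>

lemma (in ideal) a_minus_closed: "x \<in> I \<Longrightarrow> y \<in> I \<Longrightarrow> x \<ominus> y \<in> I"
  by (simp add: a_minus_def a_inv_closed)

lemma (in ideal) finsum_in_ideal: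
  assumes "f \<in> A \<rightarrow> I"
  shows "(\<Oplus>a\<in>A. f a) \<in> I"
  using assms by (induction A rule: infinite_finite_induct) (auto simp: Pi_def)

lemma (in cring) cring_idealI:
  assumes sub: "I \<subseteq> carrier R" and zero: "\<zero> \<in> I"
    and add: "\<And>x y. x \<in> I \<Longrightarrow> y \<in> I \<Longrightarrow> x \<oplus> y \<in> I"
    and mult: "\<And>r x. r \<in> carrier R \<Longrightarrow> x \<in> I \<Longrightarrow> r \<otimes> x \<in> I"
  shows "ideal I R"
proof -
  have "subgroup I (add_monoid R)"
  proof (rule add.subgroupI)
    fix b assume b: "b \<in> I"
    then have "\<ominus> b = \<ominus> \<one> \<otimes> b" using sub by (auto simp: l_minus)
    then show "\<ominus> b \<in> I" using mult [OF _ b, of "\<ominus> \<one>"] by simp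
  qed (use sub zero add in auto)
  moreover have "b \<otimes> x \<in> I" if "b \<in> I" "x \<in> carrier R" for b x
    using mult [OF that(2,1)] that sub by (simp add: m_comm subset_iff)
  ultimately show ?thesis using mult by (intro idealI ring_axioms) auto
qed

lemma ring_hom_a_minus:
  assumes "h \<in> ring_hom R S" "ring R" "ring S" "a \<in> carrier R" "b \<in> carrier R"
  shows "h (a \<ominus>\<^bsub>R\<^esub> b) = h a \<ominus>\<^bsub>S\<^esub> h b"
proof -
  interpret ring_hom_ring R S h using assms by (simp add: ring_hom_ringI2)
  show ?thesis using assms(4,5) by (simp add: a_minus_def)
qed

lemma ring_hom_nat_pow:
  assumes "h \<in> ring_hom R S" "ring R" "ring S" "a \<in> carrier R"
  shows "h (a [^]\<^bsub>R\<^esub> (n::nat)) = h a [^]\<^bsub>S\<^esub> n"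
proof -
  interpret ring_hom_ring R S h using assms by (simp add: ring_hom_ringI2)
  show ?thesis using assms(4) by (simp add: hom_nat_pow)
qed

text \<open>The basis is a family rather than a set: for J = R the completion is the zero ring, over
  which all basis elements coincide.\<close>

locale free_ext = ring_hom_cring A B \<iota> for A (structure) and B (structure) and \<iota> +
  fixes E :: "'e set" and e :: "'e \<Rightarrow> _"
  assumes finite_E: "finite E"
    and e_closed: "e \<in> E \<rightarrow> carrier B"
    and spanning: "b \<in> carrier B \<Longrightarrow> \<exists>c. c \<in> E \<rightarrow> carrier A \<and> b = (\<Oplus>\<^bsub>B\<^esub>a\<in>E. \<iota> (c a) \<otimes>\<^bsub>B\<^esub> e a)"
    and independent: "\<lbrakk>c \<in> E \<rightarrow> carrier A; (\<Oplus>\<^bsub>B\<^esub>a\<in>E. \<iota> (c a) \<otimes>\<^bsub>B\<^esub> e a) = \<zero>\<^bsub>B\<^esub>; a \<in> E\<rbrakk> \<Longrightarrow> c a = \<zero>\<^bsub>A\<^esub>"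
begin

definition lincomb where "lincomb c = (\<Oplus>\<^bsub>B\<^esub>a\<in>E. \<iota> (c a) \<otimes>\<^bsub>B\<^esub> e a)"

text \<open>Unique on E only, since \<open>lincomb\<close> ignores the other arguments; hence the
  premise \<open>a \<in> E\<close> in the laws below.\<close>

definition coord where "coord b = (SOME c. c \<in> E \<rightarrow> carrier A \<and> b = lincomb c)"

lemma e_in: "a \<in> E \<Longrightarrow> e a \<in> carrier B"
  using e_closed by auto

lemma lincomb_closed: "c \<in> E \<rightarrow> carrier A \<Longrightarrow> lincomb c \<in> carrier B"
  unfolding lincomb_def by (rule S.finsum_closed) (auto simp: e_in Pi_def)

lemma lincomb_cong: "c' \<in> E \<rightarrow> carrier A \<Longrightarrow> (\<And>a. a \<in> E \<Longrightarrow> c a = c' a) \<Longrightarrow> lincomb c = lincomb c'"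
  unfolding lincomb_def by (rule S.finsum_cong') (auto simp: e_in Pi_def)

lemma lincomb_add:
  assumes "c \<in> E \<rightarrow> carrier A" "d \<in> E \<rightarrow> carrier A"
  shows "lincomb (\<lambda>a. c a \<oplus>\<^bsub>A\<^esub> d a) = lincomb c \<oplus>\<^bsub>B\<^esub> lincomb d"
proof -
  have "lincomb (\<lambda>a. c a \<oplus>\<^bsub>A\<^esub> d a) = (\<Oplus>\<^bsub>B\<^esub>a\<in>E. \<iota> (c a) \<otimes>\<^bsub>B\<^esub> e a \<oplus>\<^bsub>B\<^esub> \<iota> (d a) \<otimes>\<^bsub>B\<^esub> e a)"
    unfolding lincomb_def
    by (rule S.finsum_cong') (use assms in \<open>auto simp: e_in S.l_distr Pi_def\<close>)
  also have "\<dots> = lincomb c \<oplus>\<^bsub>B\<^esub> lincomb d"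
    unfolding lincomb_def by (rule S.finsum_addf) (use assms in \<open>auto simp: e_in Pi_def\<close>)
  finally show ?thesis .
qed

lemma lincomb_smult:
  assumes "r \<in> carrier A" "c \<in> E \<rightarrow> carrier A"
  shows "lincomb (\<lambda>a. r \<otimes>\<^bsub>A\<^esub> c a) = \<iota> r \<otimes>\<^bsub>B\<^esub> lincomb c"
proof -
  have "\<iota> r \<otimes>\<^bsub>B\<^esub> lincomb c = (\<Oplus>\<^bsub>B\<^esub>a\<in>E. \<iota> r \<otimes>\<^bsub>B\<^esub> (\<iota> (c a) \<otimes>\<^bsub>B\<^esub> e a))"
    unfolding lincomb_def by (rule S.finsum_rdistr) (use assms finite_E in \<open>auto simp: e_in Pi_def\<close>)
  also have "\<dots> = lincomb (\<lambda>a. r \<otimes>\<^bsub>A\<^esub> c a)"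
    unfolding lincomb_def
    by (rule S.finsum_cong') (use assms in \<open>auto simp: e_in S.m_assoc Pi_def\<close>)
  finally show ?thesis ..
qed

lemma lincomb_inj:
  assumes c: "c \<in> E \<rightarrow> carrier A" and d: "d \<in> E \<rightarrow> carrier A" and eq: "lincomb c = lincomb d" and a: "a \<in> E"
  shows "c a = d a"
proof -
  have m: "\<ominus>\<^bsub>A\<^esub> \<one>\<^bsub>A\<^esub> \<in> carrier A" by simp
  let ?d = "\<lambda>a. \<ominus>\<^bsub>A\<^esub> \<one>\<^bsub>A\<^esub> \<otimes>\<^bsub>A\<^esub> d a"
  have d': "?d \<in> E \<rightarrow> carrier A" using d by auto
  have "lincomb (\<lambda>a. c a \<oplus>\<^bsub>A\<^esub> ?d a) = lincomb d \<oplus>\<^bsub>B\<^esub> \<iota> (\<ominus>\<^bsub>A\<^esub> \<one>\<^bsub>A\<^esub>) \<otimes>\<^bsub>B\<^esub> lincomb d"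
    by (simp only: lincomb_add [OF c d'] lincomb_smult [OF m d] eq)
  also have "\<dots> = \<zero>\<^bsub>B\<^esub>" using lincomb_closed [OF d] by (simp add: S.l_minus S.r_neg)
  finally have "c a \<oplus>\<^bsub>A\<^esub> ?d a = \<zero>\<^bsub>A\<^esub>"
    using independent [of "\<lambda>a. c a \<oplus>\<^bsub>A\<^esub> ?d a", OF _ _ a] c d by (simp add: lincomb_def Pi_def)
  moreover have "c a \<in> carrier A" "d a \<in> carrier A" using c d a by auto
  ultimately show ?thesis
    by (metis R.add.inv_closed R.add.inv_inv R.l_minus R.l_one R.minus_equality R.one_closed R.a_comm)
qed

lemma coord_spec:
  assumes "b \<in> carrier B"
  shows "coord b \<in> E \<rightarrow> carrier A \<and> b = lincomb (coord b)"
  unfolding coord_def using someI_ex [OF spanning [OF assms]] by (simp add: lincomb_def)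

lemma coord_funcset: "b \<in> carrier B \<Longrightarrow> coord b \<in> E \<rightarrow> carrier A"
  using coord_spec by blast

lemma coord_closed: "b \<in> carrier B \<Longrightarrow> a \<in> E \<Longrightarrow> coord b a \<in> carrier A"
  using coord_spec by blast

lemma lincomb_coord: "b \<in> carrier B \<Longrightarrow> lincomb (coord b) = b"
  using coord_spec by metis

lemma coord_lincomb: "c \<in> E \<rightarrow> carrier A \<Longrightarrow> a \<in> E \<Longrightarrow> coord (lincomb c) a = c a"
  using lincomb_inj coord_spec lincomb_closed by metis

lemma coord_add:
  assumes "b \<in> carrier B" "b' \<in> carrier B" "a \<in> E"
  shows "coord (b \<oplus>\<^bsub>B\<^esub> b') a = coord b a \<oplus>\<^bsub>A\<^esub> coord b' a"
proof -
  have "b \<oplus>\<^bsub>B\<^esub> b' = lincomb (\<lambda>a. coord b a \<oplus>\<^bsub>A\<^esub> coord b' a)"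
    using assms by (simp add: lincomb_add coord_funcset lincomb_coord)
  then show ?thesis
    using assms by (simp add: coord_lincomb Pi_def coord_closed)
qed

lemma coord_smult:
  assumes "r \<in> carrier A" "b \<in> carrier B" "a \<in> E"
  shows "coord (\<iota> r \<otimes>\<^bsub>B\<^esub> b) a = r \<otimes>\<^bsub>A\<^esub> coord b a"
proof -
  have "\<iota> r \<otimes>\<^bsub>B\<^esub> b = lincomb (\<lambda>a. r \<otimes>\<^bsub>A\<^esub> coord b a)"
    using assms by (simp add: lincomb_smult coord_funcset lincomb_coord)
  then show ?thesis
    using assms by (simp add: coord_lincomb Pi_def coord_closed)
qed

lemma coord_zero: "a \<in> E \<Longrightarrow> coord \<zero>\<^bsub>B\<^esub> a = \<zero>\<^bsub>A\<^esub>"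
  using coord_smult [of "\<zero>\<^bsub>A\<^esub>" "\<zero>\<^bsub>B\<^esub>" a] coord_closed by simp

lemma coord_minus:
  assumes "b \<in> carrier B" "b' \<in> carrier B" "a \<in> E"
  shows "coord (b \<ominus>\<^bsub>B\<^esub> b') a = coord b a \<ominus>\<^bsub>A\<^esub> coord b' a"
proof -
  have "coord (b \<ominus>\<^bsub>B\<^esub> b') a \<oplus>\<^bsub>A\<^esub> coord b' a = coord b a"
    using assms by (subst coord_add [symmetric]) (simp_all add: S.minus_eq S.a_assoc S.l_neg)
  then show ?thesis
    using assms by (metis R.add.inv_solve_right R.minus_eq coord_closed S.minus_closed)
qed

lemma coord_eqI:
  assumes "b \<in> carrier B" "b' \<in> carrier B" "\<And>a. a \<in> E \<Longrightarrow> coord b a = coord b' a"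
  shows "b = b'"
  using assms lincomb_cong [of "coord b'" "coord b"] by (metis coord_funcset lincomb_coord)

text \<open>For an ideal F this is the extended ideal F B, described by coordinates so that
  membership can be tested coefficientwise.\<close>

definition ext_ideal :: "_ set \<Rightarrow> _ set" where
  "ext_ideal F = {b \<in> carrier B. \<forall>a\<in>E. coord b a \<in> F}"

text \<open>To multiply b by x, x is moved onto the basis elements. The coefficients of b lie in F
  and scale all coordinates of the products of x with the basis elements, so the multiplication
  table of the basis never enters.\<close>

lemma ideal_ext_ideal:
  assumes "ideal F A"
  shows "ideal (ext_ideal F) B"
proof -
  interpret F: ideal F A by fact
  let ?F = "ext_ideal F"
  have add: "b \<oplus>\<^bsub>B\<^esub> b' \<in> ?F" if "b \<in> ?F" "b' \<in> ?F" for b b'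
    using that by (auto simp: ext_ideal_def coord_add F.a_closed)
  have sc: "\<iota> r \<otimes>\<^bsub>B\<^esub> b \<in> ?F" if "r \<in> F" "b \<in> carrier B" for r b
    using that by (auto simp: ext_ideal_def coord_smult coord_closed F.I_r_closed)
  have zero: "\<zero>\<^bsub>B\<^esub> \<in> ?F" by (auto simp: ext_ideal_def coord_zero)
  have sum: "finsum B f W \<in> ?F" if "f \<in> W \<rightarrow> ?F" "W \<subseteq> E" for f W
    using finite_subset [OF that(2) finite_E] that(1)
  proof (induction W)
    case empty
    then show ?case by (simp add: zero)
  next
    case (insert x W)
    have "?F \<subseteq> carrier B" by (auto simp: ext_ideal_def)
    with insert have "f x \<in> carrier B" "f \<in> W \<rightarrow> carrier B" by auto
    with insert show ?case by (simp add: add)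
  qed
  have mult: "x \<otimes>\<^bsub>B\<^esub> b \<in> ?F" if "x \<in> carrier B" "b \<in> ?F" for x b
  proof -
    have b: "b \<in> carrier B" "coord b \<in> E \<rightarrow> F" using that by (auto simp: ext_ideal_def)
    then have c: "coord b \<in> E \<rightarrow> carrier A" by (simp add: coord_funcset)
    have "x \<otimes>\<^bsub>B\<^esub> b = x \<otimes>\<^bsub>B\<^esub> (\<Oplus>\<^bsub>B\<^esub>a\<in>E. \<iota> (coord b a) \<otimes>\<^bsub>B\<^esub> e a)"
      using lincomb_coord [OF b(1)] by (simp add: lincomb_def)
    also have "\<dots> = (\<Oplus>\<^bsub>B\<^esub>a\<in>E. x \<otimes>\<^bsub>B\<^esub> (\<iota> (coord b a) \<otimes>\<^bsub>B\<^esub> e a))"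
      by (rule S.finsum_rdistr) (use that c finite_E in \<open>auto simp: e_in Pi_def\<close>)
    also have "\<dots> = (\<Oplus>\<^bsub>B\<^esub>a\<in>E. \<iota> (coord b a) \<otimes>\<^bsub>B\<^esub> (x \<otimes>\<^bsub>B\<^esub> e a))"
      by (rule S.finsum_cong') (use that c in \<open>auto simp: e_in Pi_def S.m_lcomm\<close>)
    also have "\<dots> \<in> ?F"
      by (rule sum) (use that b in \<open>auto simp: e_in intro!: sc\<close>)
    finally show ?thesis .
  qed
  show ?thesis
    by (rule S.cring_idealI) (use zero add mult in \<open>auto simp: ext_ideal_def\<close>)
qed

lemma ext_ideal_mono: "F \<subseteq> G \<Longrightarrow> ext_ideal F \<subseteq> ext_ideal G"
  by (auto simp: ext_ideal_def)

text \<open>The unit of B is not assumed to be a basis element, so r is spread over the coordinates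
  of the unit.\<close>

lemma hom_in_ext_ideal:
  assumes F: "ideal F A" and r: "r \<in> F"
  shows "\<iota> r \<in> ext_ideal F"
proof -
  interpret F: ideal F A by fact
  have "r \<in> carrier A" using r by simp
  then have "coord (\<iota> r) a = r \<otimes>\<^bsub>A\<^esub> coord \<one>\<^bsub>B\<^esub> a" if "a \<in> E" for a
    using coord_smult [of r "\<one>\<^bsub>B\<^esub>" a] that by simp
  then show ?thesis
    using r \<open>r \<in> carrier A\<close> F.I_r_closed by (auto simp: ext_ideal_def coord_closed)
qed

text \<open>A-submodules of B. Ideals of B would not suffice below, since the vanishing of one
  coordinate is not preserved by multiplication in B.\<close>

definition submod :: "_ set \<Rightarrow> bool" where
  "submod M \<longleftrightarrow> M \<subseteq> carrier B \<and> \<zero>\<^bsub>B\<^esub> \<in> M \<and> (\<forall>x\<in>M. \<forall>y\<in>M. x \<oplus>\<^bsub>B\<^esub> y \<in> M)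
     \<and> (\<forall>r\<in>carrier A. \<forall>x\<in>M. \<iota> r \<otimes>\<^bsub>B\<^esub> x \<in> M)"

lemma submod_minus: "submod M \<Longrightarrow> x \<in> M \<Longrightarrow> y \<in> M \<Longrightarrow> x \<ominus>\<^bsub>B\<^esub> y \<in> M"
proof -
  assume M: "submod M" "x \<in> M" "y \<in> M"
  then have "y \<in> carrier B" by (auto simp: submod_def)
  then have "\<ominus>\<^bsub>B\<^esub> y = \<iota> (\<ominus>\<^bsub>A\<^esub> \<one>\<^bsub>A\<^esub>) \<otimes>\<^bsub>B\<^esub> y" by (simp add: S.l_minus)
  moreover have "\<iota> (\<ominus>\<^bsub>A\<^esub> \<one>\<^bsub>A\<^esub>) \<otimes>\<^bsub>B\<^esub> y \<in> M" using M unfolding submod_def by blast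
  ultimately show ?thesis using M unfolding submod_def S.minus_eq by metis
qed

lemma submod_inter: "submod M \<Longrightarrow> submod N \<Longrightarrow> submod (M \<inter> N)"
  by (auto simp: submod_def)

text \<open>Each coordinate is an A-linear functional. These ideals are where the Noetherian
  hypothesis on A gets applied.\<close>

lemma ideal_coord_image:
  assumes M: "submod M" and a: "a \<in> E"
  shows "ideal ((\<lambda>b. coord b a) ` M) A"
proof (rule R.cring_idealI)
  let ?L = "(\<lambda>b. coord b a) ` M"
  have Mc: "M \<subseteq> carrier B" using M by (simp add: submod_def)
  show "?L \<subseteq> carrier A" using Mc a coord_closed by auto
  show "\<zero>\<^bsub>A\<^esub> \<in> ?L" using M coord_zero [OF a] by (force simp: submod_def)
  show "x \<otimes>\<^bsub>A\<^esub> b \<in> ?L" if xb: "x \<in> carrier A" "b \<in> ?L" for x b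
  proof -
    obtain m where m: "m \<in> M" "b = coord m a" using xb by blast
    then have "x \<otimes>\<^bsub>A\<^esub> b = coord (\<iota> x \<otimes>\<^bsub>B\<^esub> m) a" using xb Mc a by (auto simp: coord_smult)
    then show ?thesis using M m xb by (auto simp: submod_def)
  qed
  show "x \<oplus>\<^bsub>A\<^esub> y \<in> ?L" if xy: "x \<in> ?L" "y \<in> ?L" for x y
  proof -
    obtain m n where mn: "m \<in> M" "x = coord m a" "n \<in> M" "y = coord n a" using xy by blast
    then have "x \<oplus>\<^bsub>A\<^esub> y = coord (m \<oplus>\<^bsub>B\<^esub> n) a" using Mc a by (auto simp: coord_add subset_iff)
    then show ?thesis using M mn by (auto simp: submod_def)
  qed
qed

text \<open>Finite generation of \<open>M\<close> is expressed by a finite \<open>G\<close> such that \<open>M\<close> lies in every submodule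
  containing \<open>G\<close>; the induction is on the set of basis elements that occur in \<open>M\<close>.\<close>

lemma submod_finitely_generated:
  assumes noeth: "noetherian_ring A" and "finite W" "W \<subseteq> E" "submod M"
    and "\<And>b a. b \<in> M \<Longrightarrow> a \<in> E - W \<Longrightarrow> coord b a = \<zero>\<^bsub>A\<^esub>"
  shows "\<exists>G. finite G \<and> G \<subseteq> M \<and> (\<forall>N. submod N \<longrightarrow> G \<subseteq> N \<longrightarrow> M \<subseteq> N)"
  using assms(2-)
proof (induction W arbitrary: M)
  case empty
  have "b = \<zero>\<^bsub>B\<^esub>" if "b \<in> M" for b
    using empty that by (intro coord_eqI) (auto simp: submod_def coord_zero)
  then show ?case by (intro exI [of _ "{}"]) (auto simp: submod_def)
next
  case (insert a W)
  have a: "a \<in> E" using insert by auto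
  have Mc: "M \<subseteq> carrier B" using insert.prems by (simp add: submod_def)
  \<comment> \<open>The ideal of all a-coordinates occurring in M is finitely generated, and its
    generators lift to the finite set \<open>G1\<close> in M.\<close>
  let ?L = "(\<lambda>b. coord b a) ` M"
  obtain H where H: "H \<subseteq> carrier A" "finite H" "?L = genideal A H"
    using noetherian_ring.finetely_gen [OF noeth ideal_coord_image [OF insert.prems(2) a]] by blast
  have "H \<subseteq> ?L" using R.genideal_self [OF H(1)] H(3) by blast
  then obtain G1 where G1: "finite G1" "G1 \<subseteq> M" "H = (\<lambda>b. coord b a) ` G1"
    using H(2) finite_subset_image by metis
  \<comment> \<open>The elements of M without a-coordinate form a submodule supported on W, to which
    the induction hypothesis applies.\<close>
  define M' where "M' = {b \<in> M. coord b a = \<zero>\<^bsub>A\<^esub>}"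
  have M': "submod M'"
    using insert.prems(2) a
    by (auto simp: submod_def M'_def coord_zero coord_add coord_smult subset_iff)
  obtain G2 where G2: "finite G2" "G2 \<subseteq> M'" "\<And>N. submod N \<Longrightarrow> G2 \<subseteq> N \<Longrightarrow> M' \<subseteq> N"
    using insert.IH [OF _ M'] insert.prems by (auto simp: M'_def) 
  have "M \<subseteq> N" if N: "submod N" "G1 \<union> G2 \<subseteq> N" for N
  proof
    fix b assume b: "b \<in> M"
    \<comment> \<open>The a-coordinates realised inside N contain the generators H, hence exhaust
      \<open>?L\<close>. So b agrees in coordinate a with some s in both M and N, and the difference
      falls into \<open>M'\<close>.\<close>
    let ?K = "(\<lambda>b. coord b a) ` (M \<inter> N)"
    have "ideal ?K A" using submod_inter insert.prems(2) N(1) a ideal_coord_image by blast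
    moreover have "H \<subseteq> ?K" using G1 N by auto
    ultimately have "?L \<subseteq> ?K" using R.genideal_minimal H(3) by blast
    then obtain s where s: "s \<in> M" "s \<in> N" "coord b a = coord s a" using b by auto
    have "b \<ominus>\<^bsub>B\<^esub> s \<in> M'"
      using b s a Mc submod_minus [OF insert.prems(2)] coord_closed
      by (auto simp: M'_def coord_minus subset_iff R.r_neg R.minus_eq)
    then have "b \<ominus>\<^bsub>B\<^esub> s \<in> N" using G2(3) [OF N(1)] N(2) by auto
    then have "(b \<ominus>\<^bsub>B\<^esub> s) \<oplus>\<^bsub>B\<^esub> s \<in> N" using s N(1) by (auto simp: submod_def)
    moreover have "(b \<ominus>\<^bsub>B\<^esub> s) \<oplus>\<^bsub>B\<^esub> s = b"
      using b s Mc by (simp add: S.minus_eq S.a_assoc S.l_neg subset_iff)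
    ultimately show "b \<in> N" by simp
  qed
  moreover have "finite (G1 \<union> G2)" "G1 \<union> G2 \<subseteq> M" using G1 G2 by (auto simp: M'_def)
  ultimately show ?case by blast
qed

lemma submod_ideal: "ideal I B \<Longrightarrow> submod I"
  by (auto simp: submod_def additive_subgroup.a_subset ideal.axioms(1) additive_subgroup.zero_closed
      additive_subgroup.a_closed ideal.I_l_closed)

text \<open>An ideal of B is in particular an A-submodule, and finitely many module generators also
  generate it as an ideal.\<close>

lemma noetherian_ext:
  assumes "noetherian_ring A"
  shows "noetherian_ring B"
proof (rule S.noetherian_ringI)
  fix I assume I: "ideal I B"
  obtain G where G: "finite G" "G \<subseteq> I" "\<And>N. submod N \<Longrightarrow> G \<subseteq> N \<Longrightarrow> I \<subseteq> N"
    using submod_finitely_generated [OF assms finite_E order_refl submod_ideal [OF I]] by auto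
  have Gc: "G \<subseteq> carrier B" using G(2) submod_ideal [OF I] by (auto simp: submod_def)
  have "I = genideal B G"
    using G S.genideal_minimal [OF I G(2)] submod_ideal [OF S.genideal_ideal [OF Gc]]
      S.genideal_self [OF Gc] by blast
  then show "\<exists>G\<subseteq>carrier B. finite G \<and> I = genideal B G" using G Gc by blast
qed

end

section \<open>Evaluation of polynomials\<close>

text \<open>The exponents form an arbitrary function, so that besides \<open>count m\<close> also
  the quotients \<open>count m j div p\<close> can be used.\<close>

definition mon_val :: "('a, 'b) ring_scheme \<Rightarrow> nat \<Rightarrow> (nat \<Rightarrow> 'a) \<Rightarrow> (nat \<Rightarrow> nat) \<Rightarrow> 'a" where
  "mon_val R n z d = (\<Otimes>\<^bsub>R\<^esub>j\<in>{..<n}. z j [^]\<^bsub>R\<^esub> d j)"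

definition red_mon :: "nat \<Rightarrow> nat \<Rightarrow> nat multiset set" where
  "red_mon p n = {a. set_mset a \<subseteq> {..<n} \<and> (\<forall>j. count a j < p)}"

lemma finite_red_mon: "finite (red_mon p n)"
proof (rule finite_subset)
  show "red_mon p n \<subseteq> {a. a \<subseteq># (\<Sum>j<n. replicate_mset p j)}"
  proof
    fix a assume a: "a \<in> red_mon p n"
    have "count a j \<le> count (\<Sum>i<n. replicate_mset p i) j" for j
    proof (cases "j \<in># a")
      case True
      then have "j < n" "count a j < p" using a by (auto simp: red_mon_def)
      then show ?thesis by (simp add: count_sum sum.delta)
    qed (simp add: not_in_iff)
    then show "a \<in> {a. a \<subseteq># (\<Sum>j<n. replicate_mset p j)}" by (simp add: subseteq_mset_def)
  qed
qed (rule finite_submultisets)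

context cring
begin

lemma mon_val_closed: "z \<in> {..<n} \<rightarrow> carrier R \<Longrightarrow> mon_val R n z d \<in> carrier R"
  unfolding mon_val_def by (rule finprod_closed) auto

lemma mon_val_0: "z \<in> {..<n} \<rightarrow> carrier R \<Longrightarrow> mon_val R n z (\<lambda>_. 0) = \<one>"
  unfolding mon_val_def by (simp add: finprod_one_eqI)

lemma mon_val_add:
  assumes "z \<in> {..<n} \<rightarrow> carrier R"
  shows "mon_val R n z (\<lambda>j. d j + d' j) = mon_val R n z d \<otimes> mon_val R n z d'"
proof -
  have "mon_val R n z (\<lambda>j. d j + d' j) = (\<Otimes>j\<in>{..<n}. z j [^] d j \<otimes> z j [^] d' j)"
    unfolding mon_val_def by (rule finprod_cong') (use assms in \<open>auto simp: nat_pow_mult Pi_def\<close>)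
  also have "\<dots> = mon_val R n z d \<otimes> mon_val R n z d'"
    unfolding mon_val_def by (rule finprod_multf) (use assms in auto)
  finally show ?thesis .
qed

lemma mon_val_single:
  assumes "z \<in> {..<n} \<rightarrow> carrier R" "i < n"
  shows "mon_val R n z (\<lambda>j. if j = i then k else 0) = z i [^] k"
proof -
  have "mon_val R n z (\<lambda>j. if j = i then k else 0) = (\<Otimes>j\<in>{..<n}. if i = j then z j [^] k else \<one>)"
    unfolding mon_val_def by (rule finprod_cong') (use assms in \<open>auto simp: Pi_def\<close>)
  also have "\<dots> = z i [^] k" by (rule finprod_singleton) (use assms in \<open>auto simp: Pi_def\<close>)
  finally show ?thesis .
qed

lemma mon_val_add_mset:
  assumes "z \<in> {..<n} \<rightarrow> carrier R" "i < n"
  shows "mon_val R n z (count (add_mset i m)) = mon_val R n z (count m) \<otimes> z i"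
proof -
  have "count (add_mset i m) = (\<lambda>j. count m j + (if j = i then 1 else 0))" by auto
  moreover have "z i \<in> carrier R" using assms by auto
  ultimately show ?thesis using assms by (simp add: mon_val_add mon_val_single)
qed

lemma mon_val_pow:
  "z \<in> {..<n} \<rightarrow> carrier R \<Longrightarrow> mon_val R n z d [^] (k::nat) = mon_val R n (\<lambda>j. z j [^] k) d"
  unfolding mon_val_def
  by (subst finprod_nat_pow) (auto simp: Pi_def nat_pow_pow mult.commute intro!: finprod_cong')

end

lemma mon_val_cong: "cring R \<Longrightarrow> z' \<in> {..<n} \<rightarrow> carrier R \<Longrightarrow> (\<And>j. j < n \<Longrightarrow> z j = z' j) \<Longrightarrow> mon_val R n z d = mon_val R n z' d"
  unfolding mon_val_def
  by (rule comm_monoid.finprod_cong') (auto simp: cring.axioms Pi_def intro!: monoid.nat_pow_closed cring.axioms(1) ring.is_monoid)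

lemma (in ring_hom_cring) hom_mon_val:
  assumes "z \<in> {..<n} \<rightarrow> carrier R"
  shows "h (mon_val R n z d) = mon_val S n (\<lambda>j. h (z j)) d"
proof -
  have "h (mon_val R n z d) = (\<Otimes>\<^bsub>S\<^esub>j\<in>{..<n}. (h \<circ> (\<lambda>j. z j [^] d j)) j)"
    unfolding mon_val_def by (rule hom_finprod) (use assms in auto)
  also have "\<dots> = mon_val S n (\<lambda>j. h (z j)) d"
    unfolding mon_val_def
    by (rule S.finprod_cong') (use assms in \<open>auto simp: ring.hom_nat_pow Pi_def\<close>)
  finally show ?thesis .
qed

text \<open>Turns the inductive description of polynomials into finiteness of the support, over
  which \<open>wsum\<close> sums.\<close>

lemma (in ring) pset_support:
  assumes "f \<in> indexed_pset V (carrier R)"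
  shows "finite {m. f m \<noteq> \<zero>} \<and> (\<forall>m. f m \<noteq> \<zero> \<longrightarrow> set_mset m \<subseteq> V)"
  using assms
proof induction
  case (indexed_const k)
  have "{m. indexed_const k m \<noteq> \<zero>} \<subseteq> {{#}}" by (auto simp: indexed_const_def)
  then show ?case by (auto simp: finite_subset)
next
  case (indexed_padd f g)
  have "{m. indexed_padd f g m \<noteq> \<zero>} \<subseteq> {m. f m \<noteq> \<zero>} \<union> {m. g m \<noteq> \<zero>}" by (auto simp: indexed_padd_def)
  then show ?case using indexed_padd finite_subset by blast
next
  case (indexed_pmult f i)
  have "{m. indexed_pmult f i m \<noteq> \<zero>} \<subseteq> add_mset i ` {m. f m \<noteq> \<zero>}"
    by (auto simp: indexed_pmult_def image_iff split: if_splits) (metis insert_DiffM)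
  moreover have "set_mset m \<subseteq> V" if m: "indexed_pmult f i m \<noteq> \<zero>" for m
  proof -
    obtain x where "m = add_mset i x" "f x \<noteq> \<zero>" using calculation m by blast
    moreover from this have "set_mset x \<subseteq> V" using indexed_pmult.IH by blast
    ultimately show ?thesis using indexed_pmult.hyps by simp
  qed
  ultimately show ?case using indexed_pmult finite_subset by blast
qed

context ring_hom_cring
begin

text \<open>The additive functional taking prescribed values on monomials and treating coefficients
  through h. It serves twice: with multiplicative weights it is evaluation of polynomials, and with
  the weights \<open>red_weight\<close> it extracts coefficients modulo the root ideal.\<close>

definition wsum :: "('v multiset \<Rightarrow> 'c) \<Rightarrow> ('v multiset \<Rightarrow> 'a) \<Rightarrow> 'c" where
  "wsum w f = (\<Oplus>\<^bsub>S\<^esub>m\<in>{m. f m \<noteq> \<zero>}. h (f m) \<otimes>\<^bsub>S\<^esub> w m)"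

lemma wsum_superset:
  assumes w: "range w \<subseteq> carrier S" and f: "R.carrier_coeff f" and "finite M" "{m. f m \<noteq> \<zero>} \<subseteq> M"
  shows "wsum w f = (\<Oplus>\<^bsub>S\<^esub>m\<in>M. h (f m) \<otimes>\<^bsub>S\<^esub> w m)"
proof -
  have "w m \<in> carrier S" "f m \<in> carrier R" for m using w f R.carrier_coeffE by blast+
  then show ?thesis
    unfolding wsum_def by (intro S.add.finprod_mono_neutral_cong_left) (use assms(3,4) in auto)
qed

lemma wsum_closed:
  assumes w: "range w \<subseteq> carrier S" and f: "R.carrier_coeff f"
  shows "wsum w f \<in> carrier S"
proof -
  have "w m \<in> carrier S" "f m \<in> carrier R" for m using w f R.carrier_coeffE by blast+
  then show ?thesis unfolding wsum_def by (intro S.finsum_closed) auto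
qed

lemma wsum_add:
  assumes w: "range w \<subseteq> carrier S" and f: "f \<in> R.indexed_pset V (carrier R)" and g: "g \<in> R.indexed_pset V (carrier R)"
  shows "wsum w (R.indexed_padd f g) = wsum w f \<oplus>\<^bsub>S\<^esub> wsum w g"
proof -
  let ?M = "{m. f m \<noteq> \<zero>} \<union> {m. g m \<noteq> \<zero>}"
  have M: "finite ?M" using R.pset_support f g by auto
  have fg: "f m \<in> carrier R" "g m \<in> carrier R" "w m \<in> carrier S" for m
    using f g w R.pset_coeff R.carrier_coeffE by blast+
  have "wsum w (R.indexed_padd f g) = (\<Oplus>\<^bsub>S\<^esub>m\<in>?M. h (R.indexed_padd f g m) \<otimes>\<^bsub>S\<^esub> w m)"
    by (rule wsum_superset) (use w M fg in \<open>auto simp: R.carrier_coeff_def R.indexed_padd_def\<close>)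
  also have "\<dots> = (\<Oplus>\<^bsub>S\<^esub>m\<in>?M. h (f m) \<otimes>\<^bsub>S\<^esub> w m \<oplus>\<^bsub>S\<^esub> h (g m) \<otimes>\<^bsub>S\<^esub> w m)"
    by (rule S.finsum_cong') (use fg in \<open>auto simp: R.indexed_padd_def S.l_distr\<close>)
  also have "\<dots> = (\<Oplus>\<^bsub>S\<^esub>m\<in>?M. h (f m) \<otimes>\<^bsub>S\<^esub> w m) \<oplus>\<^bsub>S\<^esub> (\<Oplus>\<^bsub>S\<^esub>m\<in>?M. h (g m) \<otimes>\<^bsub>S\<^esub> w m)"
    by (rule S.finsum_addf) (use fg in auto)
  also have "(\<Oplus>\<^bsub>S\<^esub>m\<in>?M. h (f m) \<otimes>\<^bsub>S\<^esub> w m) = wsum w f"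
    by (rule wsum_superset [symmetric]) (use w M fg in \<open>auto simp: R.carrier_coeff_def\<close>)
  also have "(\<Oplus>\<^bsub>S\<^esub>m\<in>?M. h (g m) \<otimes>\<^bsub>S\<^esub> w m) = wsum w g"
    by (rule wsum_superset [symmetric]) (use w M fg in \<open>auto simp: R.carrier_coeff_def\<close>)
  finally show ?thesis .
qed

lemma wsum_pmult:
  assumes w: "range w \<subseteq> carrier S" and f: "f \<in> R.indexed_pset V (carrier R)"
  shows "wsum w (R.indexed_pmult f j) = wsum (\<lambda>m. w (add_mset j m)) f"
proof -
  have fw: "f m \<in> carrier R" "w m \<in> carrier S" for m
    using f w R.pset_coeff R.carrier_coeffE by blast+
  have eq: "{m. R.indexed_pmult f j m \<noteq> \<zero>} = add_mset j ` {m. f m \<noteq> \<zero>}"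
    by (auto simp: R.indexed_pmult_def image_iff split: if_splits) (metis insert_DiffM)
  have "wsum w (R.indexed_pmult f j)
      = (\<Oplus>\<^bsub>S\<^esub>m\<in>{m. f m \<noteq> \<zero>}. h (R.indexed_pmult f j (add_mset j m)) \<otimes>\<^bsub>S\<^esub> w (add_mset j m))"
    unfolding wsum_def eq
    by (rule S.finsum_reindex) (use fw in \<open>auto simp: R.indexed_pmult_def inj_on_def\<close>)
  also have "\<dots> = wsum (\<lambda>m. w (add_mset j m)) f"
    by (simp add: wsum_def R.indexed_pmult_def)
  finally show ?thesis .
qed

lemma wsum_const:
  assumes w: "range w \<subseteq> carrier S" and c: "c \<in> carrier R"
  shows "wsum w (R.indexed_const c) = h c \<otimes>\<^bsub>S\<^esub> w {#}"
proof -
  have "wsum w (R.indexed_const c) = (\<Oplus>\<^bsub>S\<^esub>m\<in>{{#}}. h (R.indexed_const c m) \<otimes>\<^bsub>S\<^esub> w m)"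
    by (rule wsum_superset) (use w c in \<open>auto simp: R.carrier_coeff_def R.indexed_const_def\<close>)
  also have "\<dots> = h c \<otimes>\<^bsub>S\<^esub> w {#}"
  proof -
    have "w {#} \<in> carrier S" using w by blast
    then show ?thesis using c by (simp add: R.indexed_const_def)
  qed
  finally show ?thesis .
qed

lemma wsum_smult:
  assumes w: "range w \<subseteq> carrier S" and c: "c \<in> carrier R" and f: "f \<in> R.indexed_pset V (carrier R)"
  shows "wsum w (R.mpoly_conv (R.indexed_const c) f) = h c \<otimes>\<^bsub>S\<^esub> wsum w f"
proof -
  have fw: "f m \<in> carrier R" "w m \<in> carrier S" for m
    using f w R.pset_coeff R.carrier_coeffE by blast+
  have fin: "finite {m. f m \<noteq> \<zero>}" using R.pset_support [OF f] by blast
  have "R.mpoly_conv (R.indexed_const c) f = (\<lambda>m. c \<otimes> f m)"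
    using c R.pset_coeff [OF f] by (rule R.mpoly_conv_const)
  then have "wsum w (R.mpoly_conv (R.indexed_const c) f) = wsum w (\<lambda>m. c \<otimes> f m)" by simp
  also have "\<dots> = (\<Oplus>\<^bsub>S\<^esub>m\<in>{m. f m \<noteq> \<zero>}. h (c \<otimes> f m) \<otimes>\<^bsub>S\<^esub> w m)"
    by (rule wsum_superset) (use w c fin fw in \<open>auto simp: R.carrier_coeff_def\<close>)
  also have "\<dots> = (\<Oplus>\<^bsub>S\<^esub>m\<in>{m. f m \<noteq> \<zero>}. h c \<otimes>\<^bsub>S\<^esub> (h (f m) \<otimes>\<^bsub>S\<^esub> w m))"
    by (rule S.finsum_cong') (use c fw in \<open>auto simp: S.m_assoc\<close>)
  also have "\<dots> = h c \<otimes>\<^bsub>S\<^esub> wsum w f"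
    unfolding wsum_def by (rule S.finsum_rdistr [symmetric]) (use c fw fin in auto)
  finally show ?thesis .
qed

lemma wsum_weight_smult:
  assumes w: "range w \<subseteq> carrier S" and c: "c \<in> carrier S" and f: "f \<in> R.indexed_pset V (carrier R)"
  shows "wsum (\<lambda>m. c \<otimes>\<^bsub>S\<^esub> w m) f = c \<otimes>\<^bsub>S\<^esub> wsum w f"
proof -
  have fw: "f m \<in> carrier R" "w m \<in> carrier S" for m
    using f w R.pset_coeff R.carrier_coeffE by blast+
  have fin: "finite {m. f m \<noteq> \<zero>}" using R.pset_support [OF f] by blast
  have "wsum (\<lambda>m. c \<otimes>\<^bsub>S\<^esub> w m) f = (\<Oplus>\<^bsub>S\<^esub>m\<in>{m. f m \<noteq> \<zero>}. c \<otimes>\<^bsub>S\<^esub> (h (f m) \<otimes>\<^bsub>S\<^esub> w m))"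
    unfolding wsum_def by (rule S.finsum_cong') (use c fw in \<open>auto simp: S.m_lcomm\<close>)
  also have "\<dots> = c \<otimes>\<^bsub>S\<^esub> wsum w f"
    unfolding wsum_def by (rule S.finsum_rdistr [symmetric]) (use c fw fin in auto)
  finally show ?thesis .
qed

lemma mpoly_eval:
  fixes n :: nat
  assumes z: "z \<in> {..<n} \<rightarrow> carrier S"
  shows "\<exists>ev \<in> ring_hom (mpoly_ring R {..<n}) S.
    (\<forall>c\<in>carrier R. ev (R.indexed_const c) = h c) \<and> (\<forall>j<n. ev (R.indexed_var j) = z j)"
proof
  let ?V = "{..<n}"
  define w where "w m = mon_val S n z (count m)" for m
  have w: "range w \<subseteq> carrier S" using z by (auto simp: w_def S.mon_val_closed)
  have w0: "w {#} = \<one>\<^bsub>S\<^esub>" using S.mon_val_0 [OF z] by (simp add: w_def zero_multiset.rep_eq)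
  have const: "wsum w (R.indexed_const c) = h c" if "c \<in> carrier R" for c
    using that by (simp add: wsum_const [OF w] w0)
  have zc: "z j \<in> carrier S" if "j < n" for j using z that by auto
  have pmult: "wsum w (R.indexed_pmult f j) = z j \<otimes>\<^bsub>S\<^esub> wsum w f"
    if "f \<in> R.indexed_pset ?V (carrier R)" "j < n" for f j
  proof -
    have "w (add_mset j m) = z j \<otimes>\<^bsub>S\<^esub> w m" for m
      using that z zc by (simp add: w_def S.mon_val_add_mset S.mon_val_closed S.m_comm)
    then show ?thesis using that by (simp add: wsum_pmult [OF w] wsum_weight_smult [OF w zc])
  qed
  show "(\<forall>c\<in>carrier R. wsum w (R.indexed_const c) = h c) \<and> (\<forall>j<n. wsum w (R.indexed_var j) = z j)"
    using zc by (simp add: const R.indexed_var_def pmult R.indexed_pset.indexed_const)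
  show "wsum w \<in> ring_hom (mpoly_ring R ?V) S"
  proof (rule ring_hom_memI)
    fix f g assume fg: "f \<in> carrier (mpoly_ring R ?V)" "g \<in> carrier (mpoly_ring R ?V)"
    then have f: "f \<in> R.indexed_pset ?V (carrier R)" and g: "g \<in> R.indexed_pset ?V (carrier R)"
      by (simp_all add: R.mpoly_ring_simps)
    have gc: "wsum w g \<in> carrier S" using g w by (simp add: wsum_closed R.pset_coeff)
    show "wsum w (f \<oplus>\<^bsub>mpoly_ring R ?V\<^esub> g) = wsum w f \<oplus>\<^bsub>S\<^esub> wsum w g"
      by (simp add: R.mpoly_ring_simps wsum_add [OF w f g])
    \<comment> \<open>Multiplicativity by induction on f: multiplying by a variable shifts the
      weight, which multiplies it by z j.\<close>
    have "wsum w (R.mpoly_conv f g) = wsum w f \<otimes>\<^bsub>S\<^esub> wsum w g"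
      using f
    proof induction
      case (indexed_const k)
      then show ?case by (simp add: wsum_smult [OF w _ g] const)
    next
      case (indexed_padd f f')
      then show ?case
        using g w gc
        by (simp add: R.mpoly_conv_padd R.pset_coeff wsum_add [where V = ?V] R.mpoly_conv_in_pset wsum_closed S.l_distr)
    next
      case (indexed_pmult f j)
      then show ?case
        using g w gc zc
        by (simp add: R.mpoly_conv_pmult R.pset_coeff pmult R.mpoly_conv_in_pset wsum_closed S.m_assoc)
    qed
    then show "wsum w (f \<otimes>\<^bsub>mpoly_ring R ?V\<^esub> g) = wsum w f \<otimes>\<^bsub>S\<^esub> wsum w g"
      by (simp add: R.mpoly_ring_simps)
  qed (use w const in \<open>auto simp: R.mpoly_ring_simps wsum_closed R.pset_coeff\<close>)
qed

end

section \<open>Maps out of quotient rings and transport along isomorphisms\<close>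

lemma quotient_hom_lift:
  assumes I: "ideal I R" and S: "ring S" and h: "h \<in> ring_hom R S" and zero: "h ` I \<subseteq> {\<zero>\<^bsub>S\<^esub>}"
  shows "\<exists>h' \<in> ring_hom (R Quot I) S. \<forall>r\<in>carrier R. h' (I +>\<^bsub>R\<^esub> r) = h r"
proof
  interpret I: ideal I R by fact
  interpret S: ring S by fact
  interpret H: ring_hom_ring R S h using h by (simp add: ring_hom_ringI2 I.ring_axioms S)
  \<comment> \<open>The element chosen in the coset is immaterial, since h is constant on cosets of
    I.\<close>
  define h' where "h' C = h (SOME r. r \<in> C)" for C
  have eq: "h' (I +>\<^bsub>R\<^esub> r) = h r" if r: "r \<in> carrier R" for r
  proof -
    have "r \<in> I +>\<^bsub>R\<^esub> r" using r by (rule I.a_rcos_self)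
    then have "(SOME s. s \<in> I +>\<^bsub>R\<^esub> r) \<in> I +>\<^bsub>R\<^esub> r" by (rule someI)
    then obtain i where i: "i \<in> I" "(SOME s. s \<in> I +>\<^bsub>R\<^esub> r) = i \<oplus>\<^bsub>R\<^esub> r"
      by (auto simp: a_r_coset_def r_coset_def)
    then have "h i = \<zero>\<^bsub>S\<^esub>" "i \<in> carrier R" using zero by auto
    with i r show ?thesis by (simp add: h'_def)
  qed
  then show "\<forall>r\<in>carrier R. h' (I +>\<^bsub>R\<^esub> r) = h r" by blast
  have cosets: "\<exists>r\<in>carrier R. C = I +>\<^bsub>R\<^esub> r" if "C \<in> carrier (R Quot I)" for C
    using that by (auto simp: FactRing_def A_RCOSETS_def')
  have hom: "(+>\<^bsub>R\<^esub>) I \<in> ring_hom R (R Quot I)" by (rule I.rcos_ring_hom)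
  show "h' \<in> ring_hom (R Quot I) S"
  proof (rule ring_hom_memI)
    fix C D assume "C \<in> carrier (R Quot I)" "D \<in> carrier (R Quot I)"
    then obtain r s where rs: "r \<in> carrier R" "C = I +>\<^bsub>R\<^esub> r" "s \<in> carrier R" "D = I +>\<^bsub>R\<^esub> s"
      using cosets by blast
    then show "h' (C \<otimes>\<^bsub>R Quot I\<^esub> D) = h' C \<otimes>\<^bsub>S\<^esub> h' D" "h' (C \<oplus>\<^bsub>R Quot I\<^esub> D) = h' C \<oplus>\<^bsub>S\<^esub> h' D"
      using ring_hom_mult [OF hom, of r s] ring_hom_add [OF hom, of r s] by (simp_all add: eq)
         (metis H.hom_mult I.m_closed eq, metis H.hom_add I.a_closed I.add.m_closed eq)
  next
    show "h' \<one>\<^bsub>R Quot I\<^esub> = \<one>\<^bsub>S\<^esub>"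
      using eq [of "\<one>\<^bsub>R\<^esub>"] ring_hom_one [OF hom] by simp
  next
    fix C assume "C \<in> carrier (R Quot I)"
    then show "h' C \<in> carrier S" using cosets eq by force
  qed
qed

text \<open>Membership in \<open>ring_iso\<close> does not constrain the \<open>zero\<close> field
  of a target not yet known to be a ring, whence the extra premise.\<close>

lemma ring_iso_cring:
  assumes "cring R" "k \<in> ring_iso R S" "\<zero>\<^bsub>S\<^esub> = k \<zero>\<^bsub>R\<^esub>"
  shows "cring S"
proof -
  have "cring (S\<lparr>zero := k \<zero>\<^bsub>R\<^esub>\<rparr>)" using assms by (simp add: cring.ring_iso_imp_img_cring)
  moreover have "S\<lparr>zero := k \<zero>\<^bsub>R\<^esub>\<rparr> = S" using assms(3) by (cases S) simp
  ultimately show ?thesis by simp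
qed

text \<open>Needed because the stages of the tower are renamed copies of root rings.\<close>

lemma free_ext_iso:
  assumes "free_ext A B \<iota> E e" "k \<in> ring_iso B C" "cring C"
  shows "free_ext A C (\<lambda>r. k (\<iota> r)) E (\<lambda>a. k (e a))"
proof -
  interpret free_ext A B \<iota> E e by fact
  interpret C: cring C by fact
  have k: "k \<in> ring_hom B C" and bij: "bij_betw k (carrier B) (carrier C)"
    using assms(2) by (auto simp: ring_iso_def)
  interpret K: ring_hom_cring B C k using k S.is_cring assms(3)
    by (simp add: ring_hom_cring_def ring_hom_cring_axioms_def)
  have lc: "k (lincomb c) = (\<Oplus>\<^bsub>C\<^esub>a\<in>E. k (\<iota> (c a)) \<otimes>\<^bsub>C\<^esub> k (e a))" if "c \<in> E \<rightarrow> carrier A" for c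
  proof -
    have "k (lincomb c) = (\<Oplus>\<^bsub>C\<^esub>a\<in>E. (k \<circ> (\<lambda>a. \<iota> (c a) \<otimes>\<^bsub>B\<^esub> e a)) a)"
      unfolding lincomb_def by (rule K.hom_finsum) (use that in \<open>auto simp: e_in Pi_def\<close>)
    also have "\<dots> = (\<Oplus>\<^bsub>C\<^esub>a\<in>E. k (\<iota> (c a)) \<otimes>\<^bsub>C\<^esub> k (e a))"
      by (rule C.finsum_cong') (use that in \<open>auto simp: e_in Pi_def\<close>)
    finally show ?thesis .
  qed
  show ?thesis
  proof (unfold_locales)
    show "(\<lambda>r. k (\<iota> r)) \<in> ring_hom A C"
      using ring_hom_trans [OF homh k] by (simp add: comp_def)
    show "finite E" by (rule finite_E)
    show "(\<lambda>a. k (e a)) \<in> E \<rightarrow> carrier C" using e_in by auto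
    fix b assume "b \<in> carrier C"
    then obtain b' where b': "b' \<in> carrier B" "b = k b'" using bij by (auto simp: bij_betw_def)
    then show "\<exists>c. c \<in> E \<rightarrow> carrier A \<and> b = (\<Oplus>\<^bsub>C\<^esub>a\<in>E. k (\<iota> (c a)) \<otimes>\<^bsub>C\<^esub> k (e a))"
      using lc coord_funcset lincomb_coord by metis
  next
    fix c a assume c: "c \<in> E \<rightarrow> carrier A" "(\<Oplus>\<^bsub>C\<^esub>a\<in>E. k (\<iota> (c a)) \<otimes>\<^bsub>C\<^esub> k (e a)) = \<zero>\<^bsub>C\<^esub>" and a: "a \<in> E"
    then have "k (lincomb c) = k \<zero>\<^bsub>B\<^esub>" by (simp add: lc)
    then have "lincomb c = \<zero>\<^bsub>B\<^esub>"
      using bij lincomb_closed [OF c(1)] by (auto simp: bij_betw_def inj_on_def)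
    then show "c a = \<zero>\<^bsub>A\<^esub>" using independent [OF c(1) _ a] by (simp add: lincomb_def)
  qed
qed

section \<open>Adjunction of roots\<close>

locale root_adjunction = cring A for A :: "('a, 'b) ring_scheme" (structure) +
  fixes p :: nat and y :: "'a list"
  assumes p_pos: "0 < p" and y_closed: "set y \<subseteq> carrier A"
begin

abbreviation "n \<equiv> length y"
abbreviation "MP \<equiv> mpoly_on A y"
abbreviation "RI \<equiv> root_ideal p A y"
abbreviation "RR \<equiv> root_ring p A y"
abbreviation "cls \<equiv> root_class p A y"

sublocale MP: cring MP by (rule mpoly_ring_cring)

lemma y_nth: "j < n \<Longrightarrow> y ! j \<in> carrier A"
  using y_closed by auto

lemma const_closed: "c \<in> carrier A \<Longrightarrow> indexed_const c \<in> carrier MP"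
  by (simp add: mpoly_ring_simps indexed_pset.indexed_const)

lemma var_closed: "j < n \<Longrightarrow> indexed_var j \<in> carrier MP"
  by (simp add: mpoly_ring_simps indexed_var_def indexed_pset.indexed_const indexed_pset.indexed_pmult)

lemma mult_var:
  assumes "f \<in> carrier MP"
  shows "f \<otimes>\<^bsub>MP\<^esub> indexed_var j = indexed_pmult f j"
proof -
  have f: "f \<in> indexed_pset {..<n} (carrier A)" using assms by (simp add: mpoly_ring_simps)
  have one: "carrier_coeff (indexed_const \<one> :: nat multiset \<Rightarrow> 'a)" by (auto simp: carrier_coeff_def indexed_const_def)
  have fe: "mpoly_conv (indexed_const \<one>) f = f"
    using pset_coeff [OF f] by (auto simp: mpoly_conv_const carrier_coeff_def)
  have "f \<otimes>\<^bsub>MP\<^esub> indexed_var j = mpoly_conv (indexed_var j) f"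
    unfolding mpoly_ring_simps indexed_var_def
    by (rule mpoly_conv_comm [OF pset_coeff [OF f] indexed_pmult_in_carrier [OF one]])
  then show ?thesis
    using pset_coeff [OF f] one by (simp add: indexed_var_def mpoly_conv_pmult fe)
qed

lemma root_ideal_gens:
  "{indexed_var j [^]\<^bsub>MP\<^esub> p \<ominus>\<^bsub>MP\<^esub> indexed_const (y ! j) | j. j < n} \<subseteq> carrier MP"
  by (auto intro!: MP.minus_closed MP.nat_pow_closed var_closed const_closed y_nth)

sublocale RI: ideal RI MP
  unfolding root_ideal_def by (rule MP.genideal_ideal [OF root_ideal_gens])

lemma RR_cring: "cring RR"
  unfolding root_ring_def by (rule RI.quotient_is_cring) (rule MP.is_cring)

sublocale RR: cring RR by (rule RR_cring)

lemma cls_hom: "cls \<in> ring_hom MP RR"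
  using RI.rcos_ring_hom by (simp add: root_ring_def root_class_def [abs_def])

sublocale cls: ring_hom_cring MP RR cls
  by unfold_locales (rule cls_hom)

lemma cls_surj: "b \<in> carrier RR \<Longrightarrow> \<exists>f\<in>carrier MP. b = cls f"
  by (auto simp: root_ring_def root_class_def FactRing_def A_RCOSETS_def')

lemma cls_eq_zero_iff: "f \<in> carrier MP \<Longrightarrow> cls f = \<zero>\<^bsub>RR\<^esub> \<longleftrightarrow> f \<in> RI"
  using RI.a_rcos_self RI.a_rcos_const
  by (fastforce simp: root_ring_def root_class_def FactRing_def)

lemma const_hom: "indexed_const \<in> ring_hom A MP"
proof (rule ring_hom_memI)
  fix c d assume cd: "c \<in> carrier A" "d \<in> carrier A"
  have "carrier_coeff (indexed_const d :: nat multiset \<Rightarrow> 'a)" using cd by (auto simp: carrier_coeff_def indexed_const_def)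
  then show "indexed_const (c \<otimes> d) = indexed_const c \<otimes>\<^bsub>MP\<^esub> indexed_const d"
    using cd by (auto simp: mpoly_ring_simps mpoly_conv_const) (auto simp: indexed_const_def)
qed (auto simp: mpoly_ring_simps indexed_padd_const indexed_pset.indexed_const)

definition "incl r = cls (indexed_const r)"
definition "adj_root j = cls (indexed_var j)"

lemma incl_hom: "incl \<in> ring_hom A RR"
  using ring_hom_trans [OF const_hom cls_hom] by (simp add: incl_def [abs_def] comp_def)

sublocale incl: ring_hom_cring A RR incl
  by unfold_locales (rule incl_hom)

lemma root_closed: "j < n \<Longrightarrow> adj_root j \<in> carrier RR"
  by (simp add: adj_root_def var_closed)

lemma root_pow:
  assumes j: "j < n"
  shows "adj_root j [^]\<^bsub>RR\<^esub> p = incl (y ! j)"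
proof -
  let ?v = "indexed_var j [^]\<^bsub>MP\<^esub> p"
  have v: "?v \<in> carrier MP" using j by (simp add: var_closed)
  have c: "indexed_const (y ! j) \<in> carrier MP" using j by (simp add: const_closed y_nth)
  have "?v \<ominus>\<^bsub>MP\<^esub> indexed_const (y ! j) \<in> RI"
    unfolding root_ideal_def using MP.genideal_self [OF root_ideal_gens] j by blast
  then have "cls (?v \<ominus>\<^bsub>MP\<^esub> indexed_const (y ! j)) = \<zero>\<^bsub>RR\<^esub>"
    using cls_eq_zero_iff [OF MP.minus_closed [OF v c]] by blast
  then have "cls ?v \<ominus>\<^bsub>RR\<^esub> incl (y ! j) = \<zero>\<^bsub>RR\<^esub>"
    by (simp only: ring_hom_a_minus [OF cls_hom MP.ring_axioms RR.ring_axioms v c] incl_def)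
  moreover have "cls ?v \<in> carrier RR" "incl (y ! j) \<in> carrier RR" using v j by (simp_all add: y_nth)
  ultimately have "cls ?v = incl (y ! j)" by (simp only: RR.r_right_minus_eq)
  then show ?thesis
    using j by (simp add: adj_root_def ring_hom_nat_pow [OF cls_hom MP.ring_axioms RR.ring_axioms var_closed])
qed

lemma root_ring_universal:
  assumes D: "cring D" and \<sigma>: "\<sigma> \<in> ring_hom A D" and z: "\<And>j. j < n \<Longrightarrow> z j \<in> carrier D"
    and zp: "\<And>j. j < n \<Longrightarrow> z j [^]\<^bsub>D\<^esub> p = \<sigma> (y ! j)"
  shows "\<exists>h\<in>ring_hom RR D. (\<forall>r\<in>carrier A. h (incl r) = \<sigma> r) \<and> (\<forall>j<n. h (adj_root j) = z j)"
proof -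
  interpret D: cring D by fact
  interpret \<sigma>: ring_hom_cring A D \<sigma> by unfold_locales (rule \<sigma>)
  obtain ev where ev: "ev \<in> ring_hom MP D" "\<And>c. c \<in> carrier A \<Longrightarrow> ev (indexed_const c) = \<sigma> c"
    "\<And>j. j < n \<Longrightarrow> ev (indexed_var j) = z j"
    using \<sigma>.mpoly_eval [of z n] z by (auto simp: Pi_def)
  interpret ev: ring_hom_ring MP D ev
    by (rule ring_hom_ringI2) (use ev MP.ring_axioms D.ring_axioms in auto)
  have "RI \<subseteq> a_kernel MP D ev"
    unfolding root_ideal_def
  proof (rule MP.genideal_minimal [OF ev.kernel_is_ideal])
    show "{indexed_var j [^]\<^bsub>MP\<^esub> p \<ominus>\<^bsub>MP\<^esub> indexed_const (y ! j) | j. j < n} \<subseteq> a_kernel MP D ev"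
    proof clarify
      fix j assume j: "j < n"
      have "ev (indexed_var j [^]\<^bsub>MP\<^esub> p \<ominus>\<^bsub>MP\<^esub> indexed_const (y ! j)) = \<zero>\<^bsub>D\<^esub>"
        using j z by (simp add: ring_hom_a_minus [OF ev(1) MP.ring_axioms D.ring_axioms] var_closed
            const_closed y_nth ev ring_hom_nat_pow [OF ev(1) MP.ring_axioms D.ring_axioms] zp)
      moreover have "indexed_var j [^]\<^bsub>MP\<^esub> p \<ominus>\<^bsub>MP\<^esub> indexed_const (y ! j) \<in> carrier MP"
        using j by (intro MP.minus_closed MP.nat_pow_closed var_closed const_closed y_nth)
      ultimately show "indexed_var j [^]\<^bsub>MP\<^esub> p \<ominus>\<^bsub>MP\<^esub> indexed_const (y ! j) \<in> a_kernel MP D ev"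
        unfolding a_kernel_def' by blast
    qed
  qed
  then have "ev ` RI \<subseteq> {\<zero>\<^bsub>D\<^esub>}" unfolding a_kernel_def' by blast
  then obtain h where h: "h \<in> ring_hom RR D" "\<And>f. f \<in> carrier MP \<Longrightarrow> h (cls f) = ev f"
    using quotient_hom_lift [OF RI.is_ideal D.ring_axioms ev(1)]
    unfolding root_ring_def root_class_def by blast
  then show ?thesis
    using ev by (intro bexI [of _ h]) (auto simp: incl_def adj_root_def const_closed var_closed)
qed

section \<open>Reduced monomials span the root ring\<close>

definition "rmon a = mon_val RR n adj_root (count a)"

lemma rmon_closed: "rmon a \<in> carrier RR"
  unfolding rmon_def by (rule RR.mon_val_closed) (auto simp: root_closed)

lemma root_mult_rmon:
  assumes a: "a \<in> red_mon p n" and j: "j < n"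
  shows "\<exists>c\<in>carrier A. \<exists>a'\<in>red_mon p n. rmon a \<otimes>\<^bsub>RR\<^esub> adj_root j = incl c \<otimes>\<^bsub>RR\<^esub> rmon a'"
proof (cases "Suc (count a j) < p")
  case True
  then have "add_mset j a \<in> red_mon p n" using a j by (auto simp: red_mon_def)
  moreover have "rmon a \<otimes>\<^bsub>RR\<^esub> adj_root j = incl \<one> \<otimes>\<^bsub>RR\<^esub> rmon (add_mset j a)"
    using j rmon_closed [of "add_mset j a"]
    by (simp add: rmon_def RR.mon_val_add_mset Pi_def root_closed)
  ultimately show ?thesis by blast
next
  case False
  \<comment> \<open>The exponent of j reaches p: the full power is replaced by the scalar
    \<open>y ! j\<close>, and j disappears from the monomial.\<close>
  then have cj: "Suc (count a j) = p" using a by (metis (mono_tags) Suc_lessI red_mon_def mem_Collect_eq)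
  define a' where "a' = a - replicate_mset (count a j) j"
  have a': "a' \<in> red_mon p n"
    using a p_pos by (auto simp: red_mon_def a'_def dest: in_diffD intro: le_less_trans [OF diff_le_self])
  have R: "adj_root \<in> {..<n} \<rightarrow> carrier RR" by (auto simp: root_closed)
  have "count (add_mset j a) = (\<lambda>i. count a' i + (if i = j then p else 0))"
    using cj by (auto simp: a'_def fun_eq_iff)
  then have "mon_val RR n adj_root (count (add_mset j a)) = rmon a' \<otimes>\<^bsub>RR\<^esub> adj_root j [^]\<^bsub>RR\<^esub> p"
    using RR.mon_val_add [OF R] RR.mon_val_single [OF R j] by (simp add: rmon_def)
  then have "rmon a \<otimes>\<^bsub>RR\<^esub> adj_root j = incl (y ! j) \<otimes>\<^bsub>RR\<^esub> rmon a'"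
    using rmon_closed y_nth [OF j] by (simp add: root_pow [OF j] rmon_def RR.mon_val_add_mset [OF R j] RR.m_comm)
  then show ?thesis using a' y_nth [OF j] by blast
qed

definition "rcomb c = (\<Oplus>\<^bsub>RR\<^esub>a\<in>red_mon p n. incl (c a) \<otimes>\<^bsub>RR\<^esub> rmon a)"

definition "rspan = rcomb ` (red_mon p n \<rightarrow> carrier A)"

lemma rspan_zero: "\<zero>\<^bsub>RR\<^esub> \<in> rspan"
proof -
  have "rcomb (\<lambda>_. \<zero>) = \<zero>\<^bsub>RR\<^esub>"
    unfolding rcomb_def by (rule RR.add.finprod_one_eqI) (simp add: rmon_closed)
  then show ?thesis unfolding rspan_def by (metis (no_types, lifting) Pi_I image_eqI zero_closed)
qed

lemma rspan_add:
  assumes "b \<in> rspan" "b' \<in> rspan"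
  shows "b \<oplus>\<^bsub>RR\<^esub> b' \<in> rspan"
proof -
  obtain c d where cd: "c \<in> red_mon p n \<rightarrow> carrier A" "b = rcomb c" "d \<in> red_mon p n \<rightarrow> carrier A" "b' = rcomb d"
    using assms by (auto simp: rspan_def)
  have "rcomb (\<lambda>a. c a \<oplus> d a)
      = (\<Oplus>\<^bsub>RR\<^esub>a\<in>red_mon p n. incl (c a) \<otimes>\<^bsub>RR\<^esub> rmon a \<oplus>\<^bsub>RR\<^esub> incl (d a) \<otimes>\<^bsub>RR\<^esub> rmon a)"
    unfolding rcomb_def
    by (rule RR.finsum_cong') (use cd in \<open>auto simp: rmon_closed RR.l_distr Pi_def\<close>)
  also have "\<dots> = b \<oplus>\<^bsub>RR\<^esub> b'"
    unfolding cd rcomb_def by (rule RR.finsum_addf) (use cd in \<open>auto simp: rmon_closed Pi_def\<close>)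
  finally have "b \<oplus>\<^bsub>RR\<^esub> b' = rcomb (\<lambda>a. c a \<oplus> d a)" ..
  moreover have "(\<lambda>a. c a \<oplus> d a) \<in> red_mon p n \<rightarrow> carrier A" using cd by auto
  ultimately show ?thesis unfolding rspan_def by blast
qed

lemma rspan_term:
  assumes "c \<in> carrier A" "a \<in> red_mon p n"
  shows "incl c \<otimes>\<^bsub>RR\<^esub> rmon a \<in> rspan"
proof -
  have "rcomb (\<lambda>a'. if a = a' then c else \<zero>)
      = (\<Oplus>\<^bsub>RR\<^esub>a'\<in>red_mon p n. if a = a' then incl c \<otimes>\<^bsub>RR\<^esub> rmon a' else \<zero>\<^bsub>RR\<^esub>)"
    unfolding rcomb_def by (rule RR.finsum_cong') (use assms in \<open>auto simp: rmon_closed\<close>)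
  also have "\<dots> = incl c \<otimes>\<^bsub>RR\<^esub> rmon a"
    by (rule RR.finsum_singleton) (use assms in \<open>auto simp: rmon_closed finite_red_mon\<close>)
  finally show ?thesis unfolding rspan_def using assms by (intro image_eqI) auto
qed

lemma rspan_mult_root:
  assumes b: "b \<in> rspan" and j: "j < n"
  shows "b \<otimes>\<^bsub>RR\<^esub> adj_root j \<in> rspan"
proof -
  obtain c where c: "c \<in> red_mon p n \<rightarrow> carrier A" "b = rcomb c" using b by (auto simp: rspan_def)
  have t: "(incl (c a) \<otimes>\<^bsub>RR\<^esub> rmon a) \<otimes>\<^bsub>RR\<^esub> adj_root j \<in> rspan" if a: "a \<in> red_mon p n" for a
  proof -
    obtain d a' where d: "d \<in> carrier A" "a' \<in> red_mon p n" "rmon a \<otimes>\<^bsub>RR\<^esub> adj_root j = incl d \<otimes>\<^bsub>RR\<^esub> rmon a'"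
      using root_mult_rmon [OF a j] by blast
    have ca: "c a \<in> carrier A" using c a by auto
    have "(incl (c a) \<otimes>\<^bsub>RR\<^esub> rmon a) \<otimes>\<^bsub>RR\<^esub> adj_root j = incl (c a \<otimes> d) \<otimes>\<^bsub>RR\<^esub> rmon a'"
      using ca d j by (simp add: RR.m_assoc rmon_closed root_closed)
    then show ?thesis using rspan_term [of "c a \<otimes> d" a'] ca d by simp
  qed
  have "b \<otimes>\<^bsub>RR\<^esub> adj_root j = (\<Oplus>\<^bsub>RR\<^esub>a\<in>red_mon p n. (incl (c a) \<otimes>\<^bsub>RR\<^esub> rmon a) \<otimes>\<^bsub>RR\<^esub> adj_root j)"
    unfolding c rcomb_def
    by (rule RR.finsum_ldistr) (use c j in \<open>auto simp: finite_red_mon rmon_closed root_closed Pi_def\<close>)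
  also have "\<dots> \<in> rspan"
  proof -
    have "(\<Oplus>\<^bsub>RR\<^esub>a\<in>M. (incl (c a) \<otimes>\<^bsub>RR\<^esub> rmon a) \<otimes>\<^bsub>RR\<^esub> adj_root j) \<in> rspan" if "finite M" "M \<subseteq> red_mon p n" for M
      using that
    proof (induction M)
      case (insert a M)
      have "(\<lambda>a. (incl (c a) \<otimes>\<^bsub>RR\<^esub> rmon a) \<otimes>\<^bsub>RR\<^esub> adj_root j) \<in> insert a M \<rightarrow> carrier RR"
        using c insert.prems j by (auto simp: rmon_closed root_closed Pi_def)
      then show ?case using insert t by (simp add: rspan_add Pi_def)
    qed (simp add: rspan_zero)
    then show ?thesis by (simp add: finite_red_mon)
  qed
  finally show ?thesis .
qed

lemma empty_red_mon: "{#} \<in> red_mon p n"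
  using p_pos by (simp add: red_mon_def)

lemma rmon_empty: "rmon {#} = \<one>\<^bsub>RR\<^esub>"
  using RR.mon_val_0 [of adj_root n] by (simp add: rmon_def zero_multiset.rep_eq Pi_def root_closed)

text \<open>Polynomials are generated from constants by sums and multiplication by a variable, and
  the span of the reduced monomials is closed under all three.\<close>

lemma cls_in_rspan:
  assumes "f \<in> carrier MP"
  shows "cls f \<in> rspan"
proof -
  have "f \<in> indexed_pset {..<n} (carrier A)" using assms by (simp add: mpoly_ring_simps)
  then show ?thesis
  proof induction
    case (indexed_const k)
    then show ?case
      using rspan_term [OF indexed_const empty_red_mon]
      by (simp add: rmon_empty incl_def [symmetric])
  next
    case (indexed_padd f g)
    then have "cls (indexed_padd f g) = cls f \<oplus>\<^bsub>RR\<^esub> cls g"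
      using cls.hom_add [of f g] by (simp add: mpoly_ring_simps)
    then show ?case using indexed_padd by (simp add: rspan_add)
  next
    case (indexed_pmult f j)
    then have f: "f \<in> carrier MP" and j: "j < n" by (simp_all add: mpoly_ring_simps)
    then have "cls (indexed_pmult f j) = cls f \<otimes>\<^bsub>RR\<^esub> adj_root j"
      using cls.hom_mult [OF f var_closed [OF j]] mult_var [OF f, of j] by (simp only: adj_root_def)
    then show ?case using indexed_pmult j by (simp add: rspan_mult_root)
  qed
qed

text \<open>The functional extracting the coefficient of the reduced monomial \<open>a\<close> after every factor
  \<open>X\<^sub>j\<^sup>p\<close> has been replaced by \<open>y\<^sub>j\<close>; it kills the ideal, which gives linear independence.\<close>

definition "red_weight a m =
  (if \<forall>j<n. count m j mod p = count a j then mon_val A n (\<lambda>j. y ! j) (\<lambda>j. count m j div p) else \<zero>)"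

text \<open>With the identity as coefficient map, \<open>wsum\<close> becomes the A-linear
  functional on polynomials with value \<open>w m\<close> on the monomial m.\<close>

definition "lfun w f = ring_hom_cring.wsum A A id w f"

lemma id_hom: "ring_hom_cring A A id"
  by unfold_locales simp

lemmas lfun_pmult = ring_hom_cring.wsum_pmult [OF id_hom, folded lfun_def]
lemmas lfun_const = ring_hom_cring.wsum_const [OF id_hom, folded lfun_def, unfolded id_apply]
lemmas lfun_weight_smult = ring_hom_cring.wsum_weight_smult [OF id_hom, folded lfun_def]

lemma lfun_add: "range w \<subseteq> carrier A \<Longrightarrow> f \<in> carrier MP \<Longrightarrow> g \<in> carrier MP \<Longrightarrow>
  lfun w (f \<oplus>\<^bsub>MP\<^esub> g) = lfun w f \<oplus> lfun w g"
  using ring_hom_cring.wsum_add [OF id_hom, folded lfun_def, of w f "{..<n}" g]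
  by (simp only: mpoly_ring_simps)

lemma lfun_smult: "range w \<subseteq> carrier A \<Longrightarrow> c \<in> carrier A \<Longrightarrow> f \<in> carrier MP \<Longrightarrow>
  lfun w (indexed_const c \<otimes>\<^bsub>MP\<^esub> f) = c \<otimes> lfun w f"
  using ring_hom_cring.wsum_smult [OF id_hom, folded lfun_def, of w c f "{..<n}"]
  by (simp only: mpoly_ring_simps id_apply)

lemma lfun_closed: "range w \<subseteq> carrier A \<Longrightarrow> f \<in> carrier MP \<Longrightarrow> lfun w f \<in> carrier A"
  using ring_hom_cring.wsum_closed [OF id_hom, folded lfun_def, of w f] pset_coeff
  by (auto simp: mpoly_ring_simps)

lemma red_weight_closed: "range (red_weight a) \<subseteq> carrier A"
  by (auto simp: red_weight_def intro!: mon_val_closed y_nth)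

text \<open>Raising an exponent by p keeps its residue and increases its quotient by one. This is
  exactly what makes the functional vanish on multiples of the defining relations.\<close>

lemma red_weight_shift:
  assumes j: "j < n"
  shows "red_weight a (m + replicate_mset p j) = y ! j \<otimes> red_weight a m"
proof (cases "\<forall>i<n. count m i mod p = count a i")
  case True
  have Y: "(\<lambda>j. y ! j) \<in> {..<n} \<rightarrow> carrier A" by (auto simp: y_nth)
  have "(\<lambda>i. count (m + replicate_mset p j) i div p) = (\<lambda>i. count m i div p + (if i = j then 1 else 0))"
    using p_pos by auto
  then show ?thesis
    using True j p_pos mon_val_add [OF Y] mon_val_single [OF Y j] mon_val_closed [OF Y]
    by (auto simp: red_weight_def y_nth m_comm)
next
  case False
  then obtain i where "i < n" "count m i mod p \<noteq> count a i" by blast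
  moreover from this have "count (m + replicate_mset p j) i mod p \<noteq> count a i" by auto
  ultimately have "red_weight a (m + replicate_mset p j) = \<zero>" "red_weight a m = \<zero>"
    unfolding red_weight_def by meson+
  then show ?thesis using y_nth [OF j] by simp
qed

text \<open>Duality with the reduced monomials: their exponents are below p, so residues equal
  exponents and all quotients are 0.\<close>

lemma red_weight_red_mon:
  assumes "a \<in> red_mon p n" "a' \<in> red_mon p n"
  shows "red_weight a a' = (if a' = a then \<one> else \<zero>)"
proof -
  have small: "count a' j < p" for j using assms by (simp add: red_mon_def)
  have iff: "(\<forall>j<n. count a' j mod p = count a j) \<longleftrightarrow> a' = a"
  proof
    assume h: "\<forall>j<n. count a' j mod p = count a j"
    have "count a' j = count a j" for j
    proof (cases "j < n")
      case False
      then have "j \<notin># a" "j \<notin># a'" using assms by (auto simp: red_mon_def)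
      then show ?thesis by (simp add: not_in_iff)
    qed (use h small in auto)
    then show "a' = a" by (rule multiset_eqI)
  qed (use small in auto)
  have "mon_val A n (\<lambda>j. y ! j) (\<lambda>j. count a' j div p) = \<one>"
    using small by (simp add: mon_val_0 Pi_def y_nth)
  then show ?thesis unfolding red_weight_def iff by (cases "a' = a") simp_all
qed

lemma lfun_mult_var_pow:
  assumes "range w \<subseteq> carrier A" "g \<in> carrier MP" "j < n"
  shows "lfun w (g \<otimes>\<^bsub>MP\<^esub> indexed_var j [^]\<^bsub>MP\<^esub> (k::nat)) = lfun (\<lambda>m. w (m + replicate_mset k j)) g"
  using assms(1)
proof (induction k arbitrary: w)
  case 0
  then show ?case using assms by simp
next
  case (Suc k)
  let ?g = "g \<otimes>\<^bsub>MP\<^esub> indexed_var j [^]\<^bsub>MP\<^esub> k"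
  have g: "?g \<in> carrier MP" using assms by (simp add: var_closed)
  have "g \<otimes>\<^bsub>MP\<^esub> indexed_var j [^]\<^bsub>MP\<^esub> Suc k = indexed_pmult ?g j"
    using assms mult_var [OF g, of j] by (simp add: MP.m_assoc var_closed)
  then have "lfun w (g \<otimes>\<^bsub>MP\<^esub> indexed_var j [^]\<^bsub>MP\<^esub> Suc k) = lfun (\<lambda>m. w (add_mset j m)) ?g"
    using lfun_pmult [OF Suc.prems] g by (simp add: mpoly_ring_simps)
  also have "\<dots> = lfun (\<lambda>m. w (m + replicate_mset (Suc k) j)) g"
    using Suc.prems by (subst Suc.IH) auto
  finally show ?case .
qed

lemma red_functional_root_ideal:
  assumes f: "f \<in> RI"
  shows "lfun (red_weight a) f = \<zero>"
proof -
  let ?w = "red_weight a"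
  note w = red_weight_closed [of a]
  \<comment> \<open>The kernel of a linear functional need not be an ideal. K is the largest ideal
    inside it, so only the generators of \<open>RI\<close> have to be tested.\<close>
  define K where "K = {f \<in> carrier MP. \<forall>g\<in>carrier MP. lfun ?w (g \<otimes>\<^bsub>MP\<^esub> f) = \<zero>}"
  have K: "ideal K MP"
  proof (rule MP.cring_idealI)
    have "lfun ?w \<zero>\<^bsub>MP\<^esub> = \<zero>"
      using lfun_smult [OF w zero_closed MP.zero_closed] lfun_closed [OF w MP.zero_closed]
      by (simp add: const_closed)
    then show "\<zero>\<^bsub>MP\<^esub> \<in> K" by (simp add: K_def)
    show "f \<oplus>\<^bsub>MP\<^esub> g \<in> K" if "f \<in> K" "g \<in> K" for f g
      using that by (auto simp: K_def MP.r_distr lfun_add [OF w])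
    show "h \<otimes>\<^bsub>MP\<^esub> f \<in> K" if "h \<in> carrier MP" "f \<in> K" for h f
      using that by (auto simp: K_def MP.m_assoc [symmetric])
  qed (auto simp: K_def)
  have "RI \<subseteq> K"
    unfolding root_ideal_def
  proof (rule MP.genideal_minimal [OF K], clarify)
    fix j assume j: "j < n"
    let ?v = "indexed_var j [^]\<^bsub>MP\<^esub> p" and ?c = "indexed_const (y ! j)"
    have v: "?v \<in> carrier MP" and c: "?c \<in> carrier MP" using j by (simp_all add: var_closed const_closed y_nth)
    have "lfun ?w (g \<otimes>\<^bsub>MP\<^esub> (?v \<ominus>\<^bsub>MP\<^esub> ?c)) = \<zero>" if g: "g \<in> carrier MP" for g
    proof -
      have 1: "lfun ?w (g \<otimes>\<^bsub>MP\<^esub> ?v) = y ! j \<otimes> lfun ?w g"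
        using g lfun_weight_smult [OF w y_nth [OF j], of g "{..<n}"]
        by (simp add: lfun_mult_var_pow [OF w g j] red_weight_shift [OF j] mpoly_ring_simps(1))
      have 2: "lfun ?w (?c \<otimes>\<^bsub>MP\<^esub> g) = y ! j \<otimes> lfun ?w g"
        using g j by (simp add: lfun_smult [OF w] y_nth)
      have "lfun ?w (g \<otimes>\<^bsub>MP\<^esub> (?v \<ominus>\<^bsub>MP\<^esub> ?c)) \<oplus> lfun ?w (?c \<otimes>\<^bsub>MP\<^esub> g)
          = lfun ?w (g \<otimes>\<^bsub>MP\<^esub> (?v \<ominus>\<^bsub>MP\<^esub> ?c) \<oplus>\<^bsub>MP\<^esub> ?c \<otimes>\<^bsub>MP\<^esub> g)"
        using g v c by (simp add: lfun_add [OF w])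
      also have "g \<otimes>\<^bsub>MP\<^esub> (?v \<ominus>\<^bsub>MP\<^esub> ?c) \<oplus>\<^bsub>MP\<^esub> ?c \<otimes>\<^bsub>MP\<^esub> g = g \<otimes>\<^bsub>MP\<^esub> ?v"
        using g v c by algebra
      finally show ?thesis
        using 1 2 lfun_closed [OF w] g v c y_nth [OF j]
        by (metis MP.m_closed MP.minus_closed m_closed add.l_cancel_one' a_comm zero_closed l_zero add.r_cancel_one)
    qed
    then show "?v \<ominus>\<^bsub>MP\<^esub> ?c \<in> K" using v c by (simp add: K_def)
  qed
  then have "f \<in> K" using f by blast
  then have "lfun ?w (\<one>\<^bsub>MP\<^esub> \<otimes>\<^bsub>MP\<^esub> f) = \<zero>" unfolding K_def by blast
  then show ?thesis using f by simp
qed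

lemma lfun_mon:
  assumes w: "range w \<subseteq> carrier A" and "set_mset a \<subseteq> {..<n}"
  shows "lfun w (mon_val MP n indexed_var (count a)) = w a"
  using assms
proof (induction a arbitrary: w)
  case empty
  have "w {#} \<in> carrier A" using empty by blast
  moreover have "mon_val MP n indexed_var (count {#}) = \<one>\<^bsub>MP\<^esub>"
    by (simp add: zero_multiset.rep_eq MP.mon_val_0 Pi_def var_closed)
  then have eq: "mon_val MP n indexed_var (count {#}) = indexed_const \<one>" by (simp only: mpoly_ring_simps)
  ultimately show ?case unfolding eq using empty by (simp add: lfun_const)
next
  case (add j a)
  have V: "indexed_var \<in> {..<n} \<rightarrow> carrier MP" by (auto simp: var_closed)
  let ?f = "mon_val MP n indexed_var (count a)"
  have j: "j < n" and a: "set_mset a \<subseteq> {..<n}" using add.prems by auto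
  have f: "?f \<in> carrier MP" by (rule MP.mon_val_closed [OF V])
  have "mon_val MP n indexed_var (count (add_mset j a)) = indexed_pmult ?f j"
    by (simp only: MP.mon_val_add_mset [OF V j] mult_var [OF f])
  moreover have "lfun w (indexed_pmult ?f j) = lfun (\<lambda>m. w (add_mset j m)) ?f"
    using lfun_pmult [OF add.prems(1)] f by (simp add: mpoly_ring_simps)
  moreover have "lfun (\<lambda>m. w (add_mset j m)) ?f = w (add_mset j a)"
    using add.prems(1) by (intro add.IH a) auto
  ultimately show ?case by (simp only:)
qed

text \<open>A relation between reduced monomials lifts to a polynomial in \<open>RI\<close>; the
  functional dual to a annihilates that polynomial, and its value there is also
  \<open>c a\<close>.\<close>

lemma rcomb_independent:
  assumes c: "c \<in> red_mon p n \<rightarrow> carrier A" and z: "rcomb c = \<zero>\<^bsub>RR\<^esub>" and a: "a \<in> red_mon p n"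
  shows "c a = \<zero>"
proof -
  have V: "indexed_var \<in> {..<n} \<rightarrow> carrier MP" by (auto simp: var_closed)
  let ?E = "red_mon p n"
  let ?mon = "\<lambda>a. mon_val MP n indexed_var (count a)"
  let ?t = "\<lambda>a. indexed_const (c a) \<otimes>\<^bsub>MP\<^esub> ?mon a"
  note w = red_weight_closed [of a]
  have mon: "?mon a \<in> carrier MP" for a by (rule MP.mon_val_closed [OF V])
  have rm: "rmon a = cls (?mon a)" for a
    by (simp add: rmon_def cls.hom_mon_val [OF V] adj_root_def [abs_def])
  have t: "?t \<in> ?E \<rightarrow> carrier MP" using c by (auto simp: mon const_closed Pi_def)
  have "rcomb c = (\<Oplus>\<^bsub>RR\<^esub>a\<in>?E. (cls \<circ> ?t) a)"
    unfolding rcomb_def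
    by (rule RR.finsum_cong')
      (use c in \<open>auto simp: mon const_closed Pi_def rm incl_def\<close>)
  also have "\<dots> = cls (finsum MP ?t ?E)" by (rule cls.hom_finsum [symmetric]) (rule t)
  finally have "cls (finsum MP ?t ?E) = \<zero>\<^bsub>RR\<^esub>" using z by (simp only:)
  then have "finsum MP ?t ?E \<in> RI"
    using cls_eq_zero_iff [OF MP.finsum_closed [OF t]] by blast
  then have "lfun (red_weight a) (finsum MP ?t ?E) = \<zero>" by (rule red_functional_root_ideal)
  moreover have "lfun (red_weight a) (finsum MP ?t M) = (\<Oplus>a'\<in>M. if a = a' then c a' else \<zero>)"
    if "finite M" "M \<subseteq> ?E" for M
    using that
  proof (induction M)
    case empty
    have "lfun (red_weight a) \<zero>\<^bsub>MP\<^esub> = \<zero>"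
      using lfun_smult [OF w zero_closed MP.zero_closed] lfun_closed [OF w MP.zero_closed]
      by (simp add: const_closed)
    then show ?case by simp
  next
    case (insert b M)
    then have b: "b \<in> ?E" "c b \<in> carrier A" using c by auto
    then have sb: "set_mset b \<subseteq> {..<n}" by (simp add: red_mon_def)
    have tM: "?t \<in> M \<rightarrow> carrier MP" "?t b \<in> carrier MP" using t insert.prems by auto
    have cM: "(\<lambda>a'. if a = a' then c a' else \<zero>) \<in> M \<rightarrow> carrier A" using c insert.prems by auto
    have "lfun (red_weight a) (?t b) = (if a = b then c b else \<zero>)"
      using b mon by (simp add: lfun_smult [OF w] lfun_mon [OF w sb] red_weight_red_mon [OF a b(1)])
    then show ?case
      using insert tM cM b by (simp add: lfun_add [OF w] MP.finsum_closed)
  qed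
  ultimately have "(\<Oplus>a'\<in>?E. if a = a' then c a' else \<zero>) = \<zero>" by (simp add: finite_red_mon)
  moreover have "(\<Oplus>a'\<in>?E. if a = a' then c a' else \<zero>) = c a"
    by (rule finsum_singleton) (use a c in \<open>auto simp: finite_red_mon\<close>)
  ultimately show ?thesis by simp
qed

lemma free_ext_root_ring: "free_ext A RR incl (red_mon p n) rmon"
proof unfold_locales
  fix b assume "b \<in> carrier RR"
  then have "b \<in> rspan" using cls_surj cls_in_rspan by blast
  then show "\<exists>c. c \<in> red_mon p n \<rightarrow> carrier A \<and> b = (\<Oplus>\<^bsub>RR\<^esub>a\<in>red_mon p n. incl (c a) \<otimes>\<^bsub>RR\<^esub> rmon a)"
    by (auto simp: rspan_def rcomb_def)
next
  fix c a
  assume "c \<in> red_mon p n \<rightarrow> carrier A" "(\<Oplus>\<^bsub>RR\<^esub>a\<in>red_mon p n. incl (c a) \<otimes>\<^bsub>RR\<^esub> rmon a) = \<zero>\<^bsub>RR\<^esub>"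
    "a \<in> red_mon p n"
  then show "c a = \<zero>" using rcomb_independent unfolding rcomb_def by blast
qed (auto simp: finite_red_mon rmon_closed)

section \<open>Root rings with injectively renamed elements\<close>

context
  fixes k :: "(nat multiset \<Rightarrow> 'a) set \<Rightarrow> 'c"
  assumes inj_k: "inj_on k (carrier RR)"
begin

lemma image_root_ring_iso: "k \<in> ring_iso RR (image_ring k RR)"
  using inj_k by (rule inj_imp_image_ring_iso)

lemma image_root_ring_cring: "cring (image_ring k RR)"
  using ring_iso_cring [OF RR.is_cring image_root_ring_iso] by (simp add: image_ring_zero)

lemma image_root_closed: "j < n \<Longrightarrow> k (adj_root j) \<in> carrier (image_ring k RR)"
  by (simp add: image_ring_carrier root_closed)

lemma image_root_pow:
  "j < n \<Longrightarrow> k (adj_root j) [^]\<^bsub>image_ring k RR\<^esub> p = k (incl (y ! j))"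
  using ring_hom_nat_pow [of k RR "image_ring k RR" "adj_root j" p] image_root_ring_iso
  by (simp add: ring_iso_def RR.ring_axioms cring.axioms image_root_ring_cring root_closed root_pow)

lemma free_ext_image_root_ring:
  "free_ext A (image_ring k RR) (\<lambda>r. k (incl r)) (red_mon p n)
     (\<lambda>a. mon_val (image_ring k RR) n (\<lambda>j. k (adj_root j)) (count a))"
proof -
  interpret C: cring "image_ring k RR" by (rule image_root_ring_cring)
  interpret K: ring_hom_cring RR "image_ring k RR" k
    by unfold_locales (use image_root_ring_iso in \<open>simp add: ring_iso_def\<close>)
  have "k (rmon a) = mon_val (image_ring k RR) n (\<lambda>j. k (adj_root j)) (count a)" for a
    unfolding rmon_def by (rule K.hom_mon_val) (auto simp: root_closed)
  then show ?thesis
    using free_ext_iso [OF free_ext_root_ring image_root_ring_iso image_root_ring_cring] by simp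
qed

lemma image_root_ring_universal:
  assumes "cring D" "\<sigma> \<in> ring_hom A D" "\<And>j. j < n \<Longrightarrow> z j \<in> carrier D"
    "\<And>j. j < n \<Longrightarrow> z j [^]\<^bsub>D\<^esub> p = \<sigma> (y ! j)"
  shows "\<exists>h\<in>ring_hom (image_ring k RR) D.
    (\<forall>r\<in>carrier A. h (k (incl r)) = \<sigma> r) \<and> (\<forall>j<n. h (k (adj_root j)) = z j)"
proof -
  obtain h where h: "h \<in> ring_hom RR D" "\<forall>r\<in>carrier A. h (incl r) = \<sigma> r" "\<forall>j<n. h (adj_root j) = z j"
    using root_ring_universal [OF assms] by blast
  let ?k' = "inv_into (carrier RR) k"
  have "?k' \<in> ring_hom (image_ring k RR) RR"
    using ring_iso_set_sym [OF RR.ring_axioms image_root_ring_iso] by (simp add: ring_iso_def)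
  then have "h \<circ> ?k' \<in> ring_hom (image_ring k RR) D" using h(1) by (rule ring_hom_trans)
  moreover have "?k' (k b) = b" if "b \<in> carrier RR" for b using that inj_k by simp
  ultimately show ?thesis
    using h by (intro bexI [of _ "h \<circ> ?k'"]) (auto simp: root_closed)
qed

end

end

section \<open>Complete filtered rings\<close>

text \<open>A completion given by its characteristic properties. In \<open>complete\<close> the
  limit is approached at the same rate at which the sequence is Cauchy, so limits found
  coordinatewise or stagewise fit together without passing to subsequences. By
  \<open>hom_in_iff\<close> the filtration F is the preimage of G.\<close>

locale filtered_completion = ring_hom_cring A B u for A (structure) and B (structure) and u +
  fixes F :: "nat \<Rightarrow> _ set" and G :: "nat \<Rightarrow> _ set"
  assumes F_ideal: "ideal (F n) A" and G_ideal: "ideal (G n) B"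
    and G_Suc: "G (Suc n) \<subseteq> G n"
    and hom_in_iff: "a \<in> carrier A \<Longrightarrow> u a \<in> G n \<longleftrightarrow> a \<in> F n"
    and dense: "b \<in> carrier B \<Longrightarrow> \<exists>a\<in>carrier A. u a \<ominus>\<^bsub>B\<^esub> b \<in> G n"
    and separated: "b \<in> carrier B \<Longrightarrow> (\<And>n. b \<in> G n) \<Longrightarrow> b = \<zero>\<^bsub>B\<^esub>"
    and complete: "(\<And>k. t k \<in> carrier B) \<Longrightarrow> (\<And>k. t (Suc k) \<ominus>\<^bsub>B\<^esub> t k \<in> G k)
      \<Longrightarrow> \<exists>l\<in>carrier B. \<forall>k. t k \<ominus>\<^bsub>B\<^esub> l \<in> G k"

text \<open>The basis of A' goes to the basis of B' with the same indices, so u' acts on coordinates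
  as u does and each property can be checked in every coordinate.\<close>

lemma filtered_completion_free_ext:
  assumes "filtered_completion A B u F G" "free_ext A A' \<iota> E e" "free_ext B B' \<kappa> E f"
    and u': "u' \<in> ring_hom A' B'" and incl: "\<And>r. r \<in> carrier A \<Longrightarrow> u' (\<iota> r) = \<kappa> (u r)"
    and basis: "\<And>a. a \<in> E \<Longrightarrow> u' (e a) = f a"
  shows "filtered_completion A' B' u' (\<lambda>n. free_ext.ext_ideal A A' \<iota> E e (F n))
    (\<lambda>n. free_ext.ext_ideal B B' \<kappa> E f (G n))"
proof -
  interpret filtered_completion A B u F G by fact
  interpret A': free_ext A A' \<iota> E e by fact
  interpret B': free_ext B B' \<kappa> E f by fact
  interpret u': ring_hom_cring A' B' u' by unfold_locales (rule u')
  have lc: "u' (A'.lincomb c) = B'.lincomb (\<lambda>a. u (c a))" if "c \<in> E \<rightarrow> carrier A" for c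
  proof -
    have "u' (A'.lincomb c) = (\<Oplus>\<^bsub>B'\<^esub>a\<in>E. (u' \<circ> (\<lambda>a. \<iota> (c a) \<otimes>\<^bsub>A'\<^esub> e a)) a)"
      unfolding A'.lincomb_def by (rule u'.hom_finsum) (use that in \<open>auto simp: A'.e_in Pi_def\<close>)
    also have "\<dots> = B'.lincomb (\<lambda>a. u (c a))"
      unfolding B'.lincomb_def
      by (rule B'.S.finsum_cong') (use that in \<open>auto simp: A'.e_in B'.e_in Pi_def incl basis\<close>)
    finally show ?thesis .
  qed
  have coord: "B'.coord (u' b) a = u (A'.coord b a)" if "b \<in> carrier A'" "a \<in> E" for a b
  proof -
    have "u' b = B'.lincomb (\<lambda>a. u (A'.coord b a))"
      using lc [OF A'.coord_funcset [OF that(1)]] that by (simp add: A'.lincomb_coord)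
    then show ?thesis using that by (simp add: B'.coord_lincomb A'.coord_closed Pi_def)
  qed
  show ?thesis
  proof (intro filtered_completion.intro filtered_completion_axioms.intro)
    show "ring_hom_cring A' B' u'" by (rule u'.ring_hom_cring_axioms)
    show "ideal (A'.ext_ideal (F n)) A'" for n by (intro A'.ideal_ext_ideal F_ideal)
    show "ideal (B'.ext_ideal (G n)) B'" for n by (intro B'.ideal_ext_ideal G_ideal)
    show "B'.ext_ideal (G (Suc n)) \<subseteq> B'.ext_ideal (G n)" for n by (intro B'.ext_ideal_mono G_Suc)
    show "u' b \<in> B'.ext_ideal (G n) \<longleftrightarrow> b \<in> A'.ext_ideal (F n)" if "b \<in> carrier A'" for b n
      using that by (auto simp: A'.ext_ideal_def B'.ext_ideal_def coord hom_in_iff A'.coord_closed)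
    show "\<exists>a\<in>carrier A'. u' a \<ominus>\<^bsub>B'\<^esub> b \<in> B'.ext_ideal (G n)" if b: "b \<in> carrier B'" for b n
    proof -
      have "\<forall>a\<in>E. \<exists>r\<in>carrier A. u r \<ominus>\<^bsub>B\<^esub> B'.coord b a \<in> G n"
        using dense b B'.coord_closed by blast
      then obtain c where c: "\<And>a. a \<in> E \<Longrightarrow> c a \<in> carrier A \<and> u (c a) \<ominus>\<^bsub>B\<^esub> B'.coord b a \<in> G n"
        by metis
      then have cf: "c \<in> E \<rightarrow> carrier A" by auto
      then have l: "A'.lincomb c \<in> carrier A'" by (rule A'.lincomb_closed)
      then have "u' (A'.lincomb c) \<ominus>\<^bsub>B'\<^esub> b \<in> B'.ext_ideal (G n)"
        using b c by (auto simp: B'.ext_ideal_def B'.coord_minus coord A'.coord_lincomb [OF cf])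
      then show ?thesis using l by blast
    qed
    show "b = \<zero>\<^bsub>B'\<^esub>" if b: "b \<in> carrier B'" "\<And>n. b \<in> B'.ext_ideal (G n)" for b
    proof (rule B'.coord_eqI)
      show "B'.coord b a = B'.coord \<zero>\<^bsub>B'\<^esub> a" if "a \<in> E" for a
        using b that separated [of "B'.coord b a"]
        by (simp add: B'.coord_zero B'.ext_ideal_def B'.coord_closed)
    qed (use b in auto)
    show "\<exists>l\<in>carrier B'. \<forall>k. t k \<ominus>\<^bsub>B'\<^esub> l \<in> B'.ext_ideal (G k)"
      if t: "\<And>k. t k \<in> carrier B'" "\<And>k. t (Suc k) \<ominus>\<^bsub>B'\<^esub> t k \<in> B'.ext_ideal (G k)" for t
    proof -
      have "\<exists>l\<in>carrier B. \<forall>k. B'.coord (t k) a \<ominus>\<^bsub>B\<^esub> l \<in> G k" if "a \<in> E" for a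
        using t that by (intro complete) (auto simp: B'.ext_ideal_def B'.coord_minus B'.coord_closed)
      then obtain c where c: "\<And>a. a \<in> E \<Longrightarrow> c a \<in> carrier B \<and> (\<forall>k. B'.coord (t k) a \<ominus>\<^bsub>B\<^esub> c a \<in> G k)"
        by metis
      then have cf: "c \<in> E \<rightarrow> carrier B" by auto
      then have l: "B'.lincomb c \<in> carrier B'" by (rule B'.lincomb_closed)
      then have "t k \<ominus>\<^bsub>B'\<^esub> B'.lincomb c \<in> B'.ext_ideal (G k)" for k
        using t c by (auto simp: B'.ext_ideal_def B'.coord_minus B'.coord_lincomb [OF cf])
      then show ?thesis using l by blast
    qed
  qed
qed

section \<open>Inverse limits of rings and of completions\<close>

lemma inverse_limit_simps:
  "carrier (inverse_limit A f) = {s. \<forall>i. s i \<in> carrier (A i) \<and> f i (s (Suc i)) = s i}"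
  "s \<otimes>\<^bsub>inverse_limit A f\<^esub> t = (\<lambda>i. s i \<otimes>\<^bsub>A i\<^esub> t i)"
  "s \<oplus>\<^bsub>inverse_limit A f\<^esub> t = (\<lambda>i. s i \<oplus>\<^bsub>A i\<^esub> t i)"
  "\<one>\<^bsub>inverse_limit A f\<^esub> = (\<lambda>i. \<one>\<^bsub>A i\<^esub>)"
  "\<zero>\<^bsub>inverse_limit A f\<^esub> = (\<lambda>i. \<zero>\<^bsub>A i\<^esub>)"
  by (simp_all add: inverse_limit_def)

locale inverse_system =
  fixes A :: "nat \<Rightarrow> ('a, 'b) ring_scheme" and f :: "nat \<Rightarrow> 'a \<Rightarrow> 'a"
  assumes cring_A: "cring (A i)" and f_hom: "f i \<in> ring_hom (A (Suc i)) (A i)"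
begin

lemma f_hom_cring: "ring_hom_cring (A (Suc i)) (A i) (f i)"
  by (simp add: ring_hom_cring_def ring_hom_cring_axioms_def cring_A f_hom)

lemma cring_inverse_limit: "cring (inverse_limit A f)"
proof -
  note A = cring_A [THEN cring.cring_simprules(1)] cring_A [THEN cring.cring_simprules(2)]
    cring_A [THEN cring.cring_simprules(5)] cring_A [THEN cring.cring_simprules(6)]
  note H = f_hom_cring [THEN ring_hom_cring.hom_zero] ring_hom_add [OF f_hom] ring_hom_mult [OF f_hom] ring_hom_one [OF f_hom]
  show ?thesis
  proof (rule cringI)
    show "abelian_group (inverse_limit A f)"
    proof (rule abelian_groupI)
      fix s assume s: "s \<in> carrier (inverse_limit A f)"
      then have "(\<lambda>i. \<ominus>\<^bsub>A i\<^esub> s i) \<in> carrier (inverse_limit A f)"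
        by (auto simp: inverse_limit_simps cring_A [THEN cring.cring_simprules(3)]
            ring_hom_cring.hom_a_inv [OF f_hom_cring])
      moreover have "(\<lambda>i. \<ominus>\<^bsub>A i\<^esub> s i) \<oplus>\<^bsub>inverse_limit A f\<^esub> s = \<zero>\<^bsub>inverse_limit A f\<^esub>"
        using s by (auto simp: inverse_limit_simps cring_A [THEN cring.cring_simprules(9)])
      ultimately show "\<exists>t\<in>carrier (inverse_limit A f). t \<oplus>\<^bsub>inverse_limit A f\<^esub> s = \<zero>\<^bsub>inverse_limit A f\<^esub>"
        by blast
    qed (auto simp: inverse_limit_simps A H cring_A [THEN cring.cring_simprules(7)]
        cring_A [THEN cring.cring_simprules(8)] intro: cring_A [THEN cring.cring_simprules(10)])
    show "Group.comm_monoid (inverse_limit A f)"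
      by (rule comm_monoidI)
        (auto simp: inverse_limit_simps A H cring_A [THEN cring.cring_simprules(11)]
          cring_A [THEN cring.cring_simprules(12)] intro: cring_A [THEN cring.cring_simprules(14)])
    fix s t r
    assume "s \<in> carrier (inverse_limit A f)" "t \<in> carrier (inverse_limit A f)" "r \<in> carrier (inverse_limit A f)"
    then show "(s \<oplus>\<^bsub>inverse_limit A f\<^esub> t) \<otimes>\<^bsub>inverse_limit A f\<^esub> r
      = s \<otimes>\<^bsub>inverse_limit A f\<^esub> r \<oplus>\<^bsub>inverse_limit A f\<^esub> t \<otimes>\<^bsub>inverse_limit A f\<^esub> r"
      by (auto simp: inverse_limit_simps cring_A [THEN cring.cring_simprules(13)])
  qed
qed

sublocale L: cring "inverse_limit A f" by (rule cring_inverse_limit)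

lemma proj_hom: "(\<lambda>s. s i) \<in> ring_hom (inverse_limit A f) (A i)"
  by (rule ring_hom_memI) (auto simp: inverse_limit_simps)

lemma proj_closed: "s \<in> carrier (inverse_limit A f) \<Longrightarrow> s i \<in> carrier (A i)"
  by (simp add: inverse_limit_simps)

lemma proj_compat: "s \<in> carrier (inverse_limit A f) \<Longrightarrow> f i (s (Suc i)) = s i"
  by (simp add: inverse_limit_simps)

lemma proj_minus:
  "s \<in> carrier (inverse_limit A f) \<Longrightarrow> t \<in> carrier (inverse_limit A f)
    \<Longrightarrow> (s \<ominus>\<^bsub>inverse_limit A f\<^esub> t) i = s i \<ominus>\<^bsub>A i\<^esub> t i"
  using ring_hom_a_minus [OF proj_hom] L.ring_axioms cring.axioms(1) [OF cring_A] by blast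

end

text \<open>From stage 0 preimages are chosen successively upwards. A larger n is reduced to this by
  shifting the system and prepending the forced component at the bottom.\<close>

lemma inverse_limit_lift:
  assumes "\<And>i x. x \<in> carrier (A i) \<Longrightarrow> \<exists>y\<in>carrier (A (Suc i)). f i y = x"
    and "\<And>i y. y \<in> carrier (A (Suc i)) \<Longrightarrow> f i y \<in> carrier (A i)"
    and "a \<in> carrier (A n)"
  shows "\<exists>s\<in>carrier (inverse_limit A f). s n = a"
  using assms
proof (induction n arbitrary: A f)
  case 0
  define s where "s = rec_nat a (\<lambda>i x. SOME y. y \<in> carrier (A (Suc i)) \<and> f i y = x)"
  have step: "s (Suc i) \<in> carrier (A (Suc i)) \<and> f i (s (Suc i)) = s i" if "s i \<in> carrier (A i)" for i
    using someI_ex [of "\<lambda>y. y \<in> carrier (A (Suc i)) \<and> f i y = s i"] 0(1) [OF that]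
    by (auto simp: s_def)
  have "s i \<in> carrier (A i)" for i
    by (induction i) (use step 0 in \<open>auto simp: s_def\<close>)
  then have "s \<in> carrier (inverse_limit A f)" using step by (simp add: inverse_limit_simps)
  moreover have "s 0 = a" by (simp add: s_def)
  ultimately show ?case by blast
next
  case (Suc n)
  obtain s where s: "s \<in> carrier (inverse_limit (\<lambda>i. A (Suc i)) (\<lambda>i. f (Suc i)))" "s n = a"
    using Suc.IH [of "\<lambda>i. A (Suc i)" "\<lambda>i. f (Suc i)"] Suc.prems by blast
  have "case_nat (f 0 (s 0)) s \<in> carrier (inverse_limit A f)"
    using s Suc.prems by (auto simp: inverse_limit_simps split: nat.split)
  then show ?case using s by (intro bexI) auto
qed

text \<open>The transition maps preserve the index of the filtration, so the condition at stage n
  with index n bounds all earlier stages too. Density follows by approximating the single component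
  n and lifting the approximation along the surjective maps f.\<close>

lemma filtered_completion_inverse_limit:
  fixes A :: "nat \<Rightarrow> ('a, 'b) ring_scheme" and B :: "nat \<Rightarrow> ('c, 'd) ring_scheme"
  assumes fc: "\<And>i. filtered_completion (A i) (B i) (u i) (F i) (G i)"
    and f: "\<And>i. f i \<in> ring_hom (A (Suc i)) (A i)" and g: "\<And>i. g i \<in> ring_hom (B (Suc i)) (B i)"
    and comm: "\<And>i a. a \<in> carrier (A (Suc i)) \<Longrightarrow> u i (f i a) = g i (u (Suc i) a)"
    and surj: "\<And>i x. x \<in> carrier (A i) \<Longrightarrow> \<exists>y\<in>carrier (A (Suc i)). f i y = x"
    and gG: "\<And>i n b. b \<in> G (Suc i) n \<Longrightarrow> g i b \<in> G i n"
  shows "filtered_completion (inverse_limit A f) (inverse_limit B g) (\<lambda>s i. u i (s i))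
    (\<lambda>n. {s \<in> carrier (inverse_limit A f). s n \<in> F n n}) (\<lambda>n. {t \<in> carrier (inverse_limit B g). t n \<in> G n n})"
proof -
  let ?S = "inverse_limit A f" and ?T = "inverse_limit B g"
  have homAB: "ring_hom_cring (A i) (B i) (u i)" for i using fc by (simp add: filtered_completion_def)
  have cA: "cring (A i)" and cB: "cring (B i)" and ui: "u i \<in> ring_hom (A i) (B i)" for i
    using homAB [of i] by (auto simp: ring_hom_cring_def ring_hom_cring_axioms_def)
  interpret S: inverse_system A f using cA f by (rule inverse_system.intro)
  interpret T: inverse_system B g using cB g by (rule inverse_system.intro)
  note ringA = cring.axioms(1) [OF cA] and ringB = cring.axioms(1) [OF cB]
  note Fid = filtered_completion.F_ideal [OF fc] and Gid = filtered_completion.G_ideal [OF fc]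
  have uT: "(\<lambda>i. u i (s i)) \<in> carrier ?T" if "s \<in> carrier ?S" for s
    using that ring_hom_closed [OF ui] by (auto simp: inverse_limit_simps comm [symmetric])
  have Gmono: "G i n \<subseteq> G i m" if "m \<le> n" for i m n
    using lift_Suc_antimono_le [of "G i"] filtered_completion.G_Suc [OF fc] that by blast
  have down: "b i \<in> G i n" if "b \<in> carrier ?T" "b (i + k) \<in> G (i + k) n" for b i k n
    using that(2) by (induction k) (use gG T.proj_compat [OF that(1)] in \<open>auto, metis\<close>)
  have down': "b i \<in> G i n" if "b \<in> carrier ?T" "b j \<in> G j n" "i \<le> j" for b i j n
    using down [of b i "j - i" n] that by simp
  have Tm: "t \<ominus>\<^bsub>?T\<^esub> t' \<in> carrier ?T" if "t \<in> carrier ?T" "t' \<in> carrier ?T" for t t'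
    using that by (rule T.L.minus_closed)
  have hom: "(\<lambda>s i. u i (s i)) \<in> ring_hom ?S ?T"
    by (rule ring_hom_memI)
      (auto simp: uT, auto simp: inverse_limit_simps ring_hom_mult [OF ui] ring_hom_add [OF ui] ring_hom_one [OF ui])
  show ?thesis
  proof (intro filtered_completion.intro filtered_completion_axioms.intro)
    show "ring_hom_cring ?S ?T (\<lambda>s i. u i (s i))"
      by (simp add: ring_hom_cring_def ring_hom_cring_axioms_def S.L.is_cring T.L.is_cring hom)
    show "ideal {s \<in> carrier ?S. s n \<in> F n n} ?S" for n
      by (rule ring_hom_ring.ideal_vimage [OF ring_hom_ringI2 [OF S.L.ring_axioms ringA S.proj_hom] Fid])
    show "ideal {t \<in> carrier ?T. t n \<in> G n n} ?T" for n
      by (rule ring_hom_ring.ideal_vimage [OF ring_hom_ringI2 [OF T.L.ring_axioms ringB T.proj_hom] Gid])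
    show "{t \<in> carrier ?T. t (Suc n) \<in> G (Suc n) (Suc n)} \<subseteq> {t \<in> carrier ?T. t n \<in> G n n}" for n
      using down' [of _ "Suc n" "Suc n" n] Gmono [of n "Suc n" n] by auto
    show "(\<lambda>i. u i (s i)) \<in> {t \<in> carrier ?T. t n \<in> G n n} \<longleftrightarrow> s \<in> {s \<in> carrier ?S. s n \<in> F n n}"
      if "s \<in> carrier ?S" for s n
      using that uT filtered_completion.hom_in_iff [OF fc S.proj_closed [OF that]] by auto
    show "\<exists>s\<in>carrier ?S. (\<lambda>i. u i (s i)) \<ominus>\<^bsub>?T\<^esub> t \<in> {t \<in> carrier ?T. t n \<in> G n n}"
      if t: "t \<in> carrier ?T" for t n
    proof -
      obtain a where a: "a \<in> carrier (A n)" "u n a \<ominus>\<^bsub>B n\<^esub> t n \<in> G n n"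
        using filtered_completion.dense [OF fc T.proj_closed [OF t]] by blast
      obtain s where s: "s \<in> carrier ?S" "s n = a"
        using inverse_limit_lift [of A f, OF surj ring_hom_closed [OF f] a(1)] by blast
      then show ?thesis using t a uT Tm by (intro bexI [of _ s]) (auto simp: T.proj_minus)
    qed
    show "t = \<zero>\<^bsub>?T\<^esub>" if t: "t \<in> carrier ?T" "\<And>n. t \<in> {t \<in> carrier ?T. t n \<in> G n n}" for t
    proof
      fix i
      have "t i \<in> G i n" for n
        using down' [OF t(1), of "max i n" "max i n" i] t(2) [of "max i n"] Gmono [of n "max i n" i] by auto
      then have "t i = \<zero>\<^bsub>B i\<^esub>"
        using filtered_completion.separated [OF fc T.proj_closed [OF t(1)]] by blast
      then show "t i = \<zero>\<^bsub>?T\<^esub> i" by (simp add: inverse_limit_simps)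
    qed
    show "\<exists>l\<in>carrier ?T. \<forall>k. t k \<ominus>\<^bsub>?T\<^esub> l \<in> {t \<in> carrier ?T. t k \<in> G k k}"
      if t: "\<And>k. t k \<in> carrier ?T" "\<And>k. t (Suc k) \<ominus>\<^bsub>?T\<^esub> t k \<in> {t \<in> carrier ?T. t k \<in> G k k}" for t
    proof -
      have tc: "t k i \<in> carrier (B i)" for k i using T.proj_closed [OF t(1)] .
      have cauchy: "t (Suc k) i \<ominus>\<^bsub>B i\<^esub> t k i \<in> G i k" if "i \<le> k" for i k
        using down' [OF Tm [OF t(1) t(1)], of "Suc k" k k k i] t(2) [of k] that
        by (simp add: T.proj_minus [OF t(1) t(1)])
      \<comment> \<open>The diagonal filtration bounds component i only from index i on. Replacing k
        by \<open>max k i\<close> holds the sequence constant before that without spoiling the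
        rate.\<close>
      have "\<exists>l\<in>carrier (B i). \<forall>k. t (max k i) i \<ominus>\<^bsub>B i\<^esub> l \<in> G i k" for i
      proof (rule filtered_completion.complete [OF fc])
        show "t (max (Suc k) i) i \<ominus>\<^bsub>B i\<^esub> t (max k i) i \<in> G i k" for k
        proof (cases "i \<le> k")
          case False
          then have "max (Suc k) i = i" "max k i = i" by auto
          then show ?thesis
            using ring.r_right_minus_eq [OF ringB tc tc] Gid
            by (metis additive_subgroup.zero_closed ideal.axioms(1))
        qed (use cauchy in simp)
      qed (rule tc)
      then obtain l where l: "\<And>i. l i \<in> carrier (B i)" "\<And>i k. t (max k i) i \<ominus>\<^bsub>B i\<^esub> l i \<in> G i k"
        by metis
      have l2: "t (max k i) i \<ominus>\<^bsub>B i\<^esub> l i \<in> G i k" for k i by (rule l(2))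
      \<comment> \<open>The limits were chosen independently at each stage. They are compatible
        because the defect lies in every \<open>G i n\<close> and the stage is separated.\<close>
      have gl: "g i (l (Suc i)) = l i" for i
      proof -
        interpret Bi: cring "B i" by (rule cB)
        have glc: "g i (l (Suc i)) \<in> carrier (B i)" using l g ring_hom_closed by metis
        have "l i \<ominus>\<^bsub>B i\<^esub> g i (l (Suc i)) \<in> G i n" for n
        proof -
          interpret G: ideal "G i n" "B i" by (rule Gid)
          let ?k = "max n (Suc i)"
          have that_l: "t (max ?k i) i \<ominus>\<^bsub>B i\<^esub> l i \<in> G i ?k" by (rule l2)
          have 1: "t ?k i \<ominus>\<^bsub>B i\<^esub> l i \<in> G i n"
            using that_l Gmono [of n ?k i] by auto
          have "g i (t ?k (Suc i) \<ominus>\<^bsub>B (Suc i)\<^esub> l (Suc i)) \<in> G i n"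
            by (rule gG) (rule l2)
          then have 2: "t ?k i \<ominus>\<^bsub>B i\<^esub> g i (l (Suc i)) \<in> G i n"
            by (simp add: ring_hom_a_minus [OF g ringB ringB tc l(1)] T.proj_compat [OF t(1)])
          have "l i \<ominus>\<^bsub>B i\<^esub> g i (l (Suc i))
              = (t ?k i \<ominus>\<^bsub>B i\<^esub> g i (l (Suc i))) \<ominus>\<^bsub>B i\<^esub> (t ?k i \<ominus>\<^bsub>B i\<^esub> l i)"
            using l(1) [of i] glc tc [of ?k i] by algebra
          then show ?thesis using G.a_minus_closed [OF 2 1] by simp
        qed
        then have "l i \<ominus>\<^bsub>B i\<^esub> g i (l (Suc i)) = \<zero>\<^bsub>B i\<^esub>"
          using filtered_completion.separated [OF fc] l glc by (meson Bi.minus_closed)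
        then show ?thesis using l glc by simp
      qed
      then have lT: "l \<in> carrier ?T" using l by (simp add: inverse_limit_simps)
      have "t k \<ominus>\<^bsub>?T\<^esub> l \<in> {t \<in> carrier ?T. t k \<in> G k k}" for k
        using l2 [of k k] Tm [OF t(1) lT] by (simp add: T.proj_minus [OF t(1) lT])
      then show ?thesis using lT by blast
    qed
  qed
qed

section \<open>Adic completion\<close>

lemma (in ideal) coset_eq_iff:
  assumes "a \<in> carrier R" "b \<in> carrier R"
  shows "I +> a = I +> b \<longleftrightarrow> a \<ominus> b \<in> I"
  using quotient_eq_iff_same_a_r_cos [OF is_ideal assms] by simp

lemma (in ideal) coset_eq_self_iff: "a \<in> carrier R \<Longrightarrow> I +> a = I \<longleftrightarrow> a \<in> I"
  using a_rcos_const a_rcos_self by blast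

lemma set_add_coset:
  assumes I: "ideal I R" and K: "ideal K R" and "K \<subseteq> I" and a: "a \<in> carrier R"
  shows "I <+>\<^bsub>R\<^esub> (K +>\<^bsub>R\<^esub> a) = I +>\<^bsub>R\<^esub> a"
proof -
  interpret I: ideal I R by fact
  interpret K: ideal K R by fact
  have "i \<oplus>\<^bsub>R\<^esub> (k \<oplus>\<^bsub>R\<^esub> a) \<in> I +>\<^bsub>R\<^esub> a" if "i \<in> I" "k \<in> K" for i k
  proof -
    have "i \<oplus>\<^bsub>R\<^esub> (k \<oplus>\<^bsub>R\<^esub> a) = (i \<oplus>\<^bsub>R\<^esub> k) \<oplus>\<^bsub>R\<^esub> a" using that a by (simp add: I.a_assoc)
    moreover have "i \<oplus>\<^bsub>R\<^esub> k \<in> I" using that \<open>K \<subseteq> I\<close> by (auto intro: I.a_closed)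
    ultimately show ?thesis by (auto simp: a_r_coset_def r_coset_def)
  qed
  moreover have "i \<oplus>\<^bsub>R\<^esub> a \<in> I <+>\<^bsub>R\<^esub> (K +>\<^bsub>R\<^esub> a)" if "i \<in> I" for i
    using that K.a_rcos_self [OF a] by (auto simp: set_add_def')
  ultimately show ?thesis by (auto simp: set_add_def' a_r_coset_def r_coset_def)
qed

lemma quot_carrier: "carrier (R Quot I) = (\<lambda>a. I +>\<^bsub>R\<^esub> a) ` carrier R"
  by (auto simp: FactRing_def A_RCOSETS_def')

locale adic = cring R for R (structure) + fixes J
  assumes J_ideal: "ideal J R"
begin

abbreviation "Jp \<equiv> ideal_pow R J"

lemma Jp_ideal: "ideal (Jp n) R" by (rule ideal_ideal_pow [OF J_ideal])

lemma Jp_antimono: "m \<le> n \<Longrightarrow> Jp n \<subseteq> Jp m" by (rule ideal_pow_antimono [OF J_ideal])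

lemma transition: "a \<in> carrier R \<Longrightarrow> Jp n <+>\<^bsub>R\<^esub> (Jp (Suc n) +> a) = Jp n +> a"
  by (rule set_add_coset [OF Jp_ideal Jp_ideal ideal_pow_decseq [OF J_ideal]])

lemma quot_cring: "cring (R Quot Jp n)"
  by (rule ideal.quotient_is_cring [OF Jp_ideal is_cring])

lemma coset_hom: "(\<lambda>a. Jp n +> a) \<in> ring_hom R (R Quot Jp n)"
  using ideal.rcos_ring_hom [OF Jp_ideal] .

lemma transition_hom: "(\<lambda>C. Jp n <+>\<^bsub>R\<^esub> C) \<in> ring_hom (R Quot Jp (Suc n)) (R Quot Jp n)"
proof (rule ring_hom_memI)
  fix C D assume "C \<in> carrier (R Quot Jp (Suc n))" "D \<in> carrier (R Quot Jp (Suc n))"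
  then obtain a b where ab: "a \<in> carrier R" "C = Jp (Suc n) +> a" "b \<in> carrier R" "D = Jp (Suc n) +> b"
    by (auto simp: quot_carrier)
  note h = ring_hom_mult [OF coset_hom ab(1,3), symmetric] ring_hom_add [OF coset_hom ab(1,3), symmetric]
  show "Jp n <+>\<^bsub>R\<^esub> (C \<otimes>\<^bsub>R Quot Jp (Suc n)\<^esub> D) = (Jp n <+>\<^bsub>R\<^esub> C) \<otimes>\<^bsub>R Quot Jp n\<^esub> (Jp n <+>\<^bsub>R\<^esub> D)"
    "Jp n <+>\<^bsub>R\<^esub> (C \<oplus>\<^bsub>R Quot Jp (Suc n)\<^esub> D) = (Jp n <+>\<^bsub>R\<^esub> C) \<oplus>\<^bsub>R Quot Jp n\<^esub> (Jp n <+>\<^bsub>R\<^esub> D)"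
    using ab by (simp_all add: h transition)
next
  show "Jp n <+>\<^bsub>R\<^esub> \<one>\<^bsub>R Quot Jp (Suc n)\<^esub> = \<one>\<^bsub>R Quot Jp n\<^esub>"
    by (simp add: FactRing_def transition)
qed (auto simp: quot_carrier transition)

lemma system: "inverse_system (\<lambda>n. R Quot Jp n) (\<lambda>n C. Jp n <+>\<^bsub>R\<^esub> C)"
  by (rule inverse_system.intro) (rule quot_cring, rule transition_hom)

sublocale sys: inverse_system "\<lambda>n. R Quot Jp n" "\<lambda>n C. Jp n <+>\<^bsub>R\<^esub> C" by (rule system)

lemma adic_completion_cring: "cring (adic_completion R J)"
  unfolding adic_completion_def by (rule sys.cring_inverse_limit)

lemma to_completion_closed: "a \<in> carrier R \<Longrightarrow> to_completion R J a \<in> carrier (adic_completion R J)"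
  by (simp add: adic_completion_def inverse_limit_simps to_completion_def transition quot_carrier)

lemma to_completion_hom: "to_completion R J \<in> ring_hom R (adic_completion R J)"
proof (rule ring_hom_memI)
  fix a b assume ab: "a \<in> carrier R" "b \<in> carrier R"
  show "to_completion R J (a \<otimes> b) = to_completion R J a \<otimes>\<^bsub>adic_completion R J\<^esub> to_completion R J b"
    "to_completion R J (a \<oplus> b) = to_completion R J a \<oplus>\<^bsub>adic_completion R J\<^esub> to_completion R J b"
    by (simp_all add: adic_completion_def inverse_limit_simps to_completion_def
        ring_hom_mult [OF coset_hom ab] ring_hom_add [OF coset_hom ab])
qed (use to_completion_closed in \<open>auto simp: adic_completion_def inverse_limit_simps to_completion_def FactRing_def\<close>)

text \<open>The zero of R modulo the n-th power of J is that power itself, so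
  \<open>s n = Jp n\<close> says that the n-th component vanishes.\<close>

lemma filtered_completion_adic:
  "filtered_completion R (adic_completion R J) (to_completion R J) Jp
     (\<lambda>n. {s \<in> carrier (adic_completion R J). s n = Jp n})"
proof -
  let ?H = "adic_completion R J" and ?Q = "\<lambda>n. R Quot Jp n"
  interpret H: cring ?H by (rule adic_completion_cring)
  have zero: "\<zero>\<^bsub>?Q n\<^esub> = Jp n" for n by (simp add: FactRing_def)
  have compat: "s n = Jp n <+>\<^bsub>R\<^esub> s (Suc n)" if "s \<in> carrier ?H" for s n
    using sys.proj_compat that by (simp add: adic_completion_def)
  have closed: "s n \<in> carrier (?Q n)" if "s \<in> carrier ?H" for s n
    using sys.proj_closed that by (simp add: adic_completion_def)
  have minus: "(s \<ominus>\<^bsub>?H\<^esub> t) n = Jp n \<longleftrightarrow> s n = t n" if "s \<in> carrier ?H" "t \<in> carrier ?H" for s t n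
    using that sys.proj_minus [of s t n] closed ring.r_right_minus_eq [OF cring.axioms(1) [OF quot_cring], of "s n" n "t n"]
    by (simp add: adic_completion_def zero)
  show ?thesis
  proof (intro filtered_completion.intro filtered_completion_axioms.intro)
    show "ring_hom_cring R ?H (to_completion R J)"
      by unfold_locales (rule to_completion_hom)
    show "ideal (Jp n) R" for n by (rule Jp_ideal)
    show "ideal {s \<in> carrier ?H. s n = Jp n} ?H" for n
      using ring_hom_ring.ideal_vimage [OF ring_hom_ringI2 [OF H.ring_axioms cring.axioms(1) [OF quot_cring]],
          of "\<lambda>s. s n" n "{\<zero>\<^bsub>?Q n\<^esub>}"] sys.proj_hom ring.zeroideal [OF cring.axioms(1) [OF quot_cring]]
      by (simp add: adic_completion_def zero)
    show "{s \<in> carrier ?H. s (Suc n) = Jp (Suc n)} \<subseteq> {s \<in> carrier ?H. s n = Jp n}" for n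
    proof clarify
      fix s assume s: "s \<in> carrier ?H" "s (Suc n) = Jp (Suc n)"
      have "s n = Jp n <+>\<^bsub>R\<^esub> (Jp (Suc n) +> \<zero>)"
        using compat [OF s(1), of n] s(2) ideal.coset_eq_self_iff [OF Jp_ideal zero_closed, of "Suc n"]
          additive_subgroup.zero_closed [OF ideal.axioms(1) [OF Jp_ideal]] by simp
      also have "\<dots> = Jp n"
        using ideal.coset_eq_self_iff [OF Jp_ideal zero_closed, of n]
          additive_subgroup.zero_closed [OF ideal.axioms(1) [OF Jp_ideal]] by (simp add: transition)
      finally show "s n = Jp n" .
    qed
    show "to_completion R J a \<in> {s \<in> carrier ?H. s n = Jp n} \<longleftrightarrow> a \<in> Jp n" if "a \<in> carrier R" for a n
      using that to_completion_closed ideal.coset_eq_self_iff [OF Jp_ideal that]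
      by (simp add: to_completion_def)
    show "\<exists>a\<in>carrier R. to_completion R J a \<ominus>\<^bsub>?H\<^esub> s \<in> {s \<in> carrier ?H. s n = Jp n}"
      if s: "s \<in> carrier ?H" for s n
    proof -
      obtain a where a: "a \<in> carrier R" "s n = Jp n +> a" using closed [OF s, of n] by (auto simp: quot_carrier)
      then have "(to_completion R J a \<ominus>\<^bsub>?H\<^esub> s) n = Jp n"
        using minus [OF to_completion_closed [OF a(1)] s] by (simp add: to_completion_def)
      then show ?thesis using a s to_completion_closed by (intro bexI [of _ a]) auto
    qed
    show "s = \<zero>\<^bsub>?H\<^esub>" if "s \<in> carrier ?H" "\<And>n. s \<in> {s \<in> carrier ?H. s n = Jp n}" for s
      using that by (auto simp: adic_completion_def inverse_limit_simps zero)
    show "\<exists>l\<in>carrier ?H. \<forall>k. t k \<ominus>\<^bsub>?H\<^esub> l \<in> {s \<in> carrier ?H. s k = Jp k}"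
      if t: "\<And>k. t k \<in> carrier ?H" "\<And>k. t (Suc k) \<ominus>\<^bsub>?H\<^esub> t k \<in> {s \<in> carrier ?H. s k = Jp k}" for t
    proof -
      have step: "t (Suc k) k = t k k" for k using t(2) [of k] minus [OF t(1) t(1)] by simp
      \<comment> \<open>Component k no longer changes from index k on, so the diagonal is a
        compatible family and is the limit.\<close>
      have "Jp k <+>\<^bsub>R\<^esub> t (Suc k) (Suc k) = t k k" for k
        using compat [OF t(1), of "Suc k" k] step [of k] by simp
      then have l: "(\<lambda>k. t k k) \<in> carrier ?H"
        using closed [OF t(1)] unfolding adic_completion_def inverse_limit_simps by blast
      then show ?thesis using minus [OF t(1) l] t(1) by (intro bexI [of _ "\<lambda>k. t k k"]) auto
    qed
  qed
qed

end

text \<open>The two inclusions make L and the powers of J cofinal. The isomorphism is built from T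
  to the adic completion, since its well-definedness uses only the index-preserving inclusion; the
  other one enters for bijectivity.\<close>

lemma adic_completion_iso:
  assumes fc: "filtered_completion S T u L G" and J: "ideal J S"
    and LJ: "\<And>n. L n \<subseteq> ideal_pow S J n" and JL: "\<And>n. \<exists>N. ideal_pow S J N \<subseteq> L n"
  shows "\<exists>\<Theta>\<in>ring_iso (adic_completion S J) T. \<forall>s\<in>carrier S. \<Theta> (to_completion S J s) = u s"
proof -
  interpret filtered_completion S T u L G by fact
  interpret adic S J by (intro adic.intro adic_axioms.intro R.is_cring J)
  let ?H = "adic_completion S J"
  have Gmono: "G n \<subseteq> G m" if "m \<le> n" for m n
    using lift_Suc_antimono_le [of G] G_Suc that by blast
  note Gadd = additive_subgroup.a_closed [OF ideal.axioms(1) [OF G_ideal]]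
  note Gminus = ideal.a_minus_closed [OF G_ideal]
  \<comment> \<open>Component n is the coset of any element of S approximating t up to G n. Two such
    elements differ by an element of L n, hence of the n-th power of J.\<close>
  define \<Psi> where "\<Psi> t n = Jp n +>\<^bsub>S\<^esub> (SOME a. a \<in> carrier S \<and> u a \<ominus>\<^bsub>T\<^esub> t \<in> G n)" for t n
  have \<Psi>_eq: "\<Psi> t n = Jp n +>\<^bsub>S\<^esub> a" if t: "t \<in> carrier T" and a: "a \<in> carrier S" "u a \<ominus>\<^bsub>T\<^esub> t \<in> G n" for t n a
  proof -
    define b where "b = (SOME a. a \<in> carrier S \<and> u a \<ominus>\<^bsub>T\<^esub> t \<in> G n)"
    have b: "b \<in> carrier S" "u b \<ominus>\<^bsub>T\<^esub> t \<in> G n"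
      using someI [of "\<lambda>a. a \<in> carrier S \<and> u a \<ominus>\<^bsub>T\<^esub> t \<in> G n" a] a by (auto simp: b_def)
    have "u (b \<ominus>\<^bsub>S\<^esub> a) = u b \<ominus>\<^bsub>T\<^esub> u a"
      using a b by (simp add: ring_hom_a_minus [OF homh] R.ring_axioms S.ring_axioms)
    also have "\<dots> = (u b \<ominus>\<^bsub>T\<^esub> t) \<ominus>\<^bsub>T\<^esub> (u a \<ominus>\<^bsub>T\<^esub> t)"
    proof -
      have "u a \<in> carrier T" "u b \<in> carrier T" using a b by auto
      then show ?thesis using t by algebra
    qed
    finally have "u (b \<ominus>\<^bsub>S\<^esub> a) \<in> G n" using Gminus a b by simp
    then have "b \<ominus>\<^bsub>S\<^esub> a \<in> Jp n" using hom_in_iff [of "b \<ominus>\<^bsub>S\<^esub> a"] a b LJ by auto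
    then show ?thesis
      unfolding \<Psi>_def b_def [symmetric] using ideal.coset_eq_iff [OF Jp_ideal b(1) a(1)] by simp
  qed
  have \<Psi>_closed: "\<Psi> t \<in> carrier ?H" if t: "t \<in> carrier T" for t
  proof -
    have "Jp n <+>\<^bsub>S\<^esub> \<Psi> t (Suc n) = \<Psi> t n \<and> \<Psi> t n \<in> carrier (S Quot Jp n)" for n
    proof -
      obtain a where a: "a \<in> carrier S" "u a \<ominus>\<^bsub>T\<^esub> t \<in> G (Suc n)" using dense [OF t] by blast
      then have "u a \<ominus>\<^bsub>T\<^esub> t \<in> G n" using G_Suc by blast
      then show ?thesis
        using a \<Psi>_eq [OF t a(1)] by (auto simp: transition quot_carrier)
    qed
    then show ?thesis by (simp add: adic_completion_def inverse_limit_simps)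
  qed
  have \<Psi>_u: "\<Psi> (u s) = to_completion S J s" if "s \<in> carrier S" for s
  proof
    fix n
    have us: "u s \<in> carrier T" using that by simp
    then have "u s \<ominus>\<^bsub>T\<^esub> u s = \<zero>\<^bsub>T\<^esub>" by simp
    then have "u s \<ominus>\<^bsub>T\<^esub> u s \<in> G n"
      using additive_subgroup.zero_closed [OF ideal.axioms(1) [OF G_ideal]] by simp
    then show "\<Psi> (u s) n = to_completion S J s n"
      using \<Psi>_eq [OF us that] by (simp add: to_completion_def)
  qed
  have hom: "\<Psi> \<in> ring_hom T ?H"
  proof (rule ring_hom_memI)
    fix t t' assume t: "t \<in> carrier T" "t' \<in> carrier T"
    have "\<Psi> (t \<otimes>\<^bsub>T\<^esub> t') n = \<Psi> t n \<otimes>\<^bsub>S Quot Jp n\<^esub> \<Psi> t' n \<and> \<Psi> (t \<oplus>\<^bsub>T\<^esub> t') n = \<Psi> t n \<oplus>\<^bsub>S Quot Jp n\<^esub> \<Psi> t' n" for n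
    proof -
      obtain a where a: "a \<in> carrier S" "u a \<ominus>\<^bsub>T\<^esub> t \<in> G n" using dense [OF t(1)] by blast
      obtain b where b: "b \<in> carrier S" "u b \<ominus>\<^bsub>T\<^esub> t' \<in> G n" using dense [OF t(2)] by blast
      have uc: "u a \<in> carrier T" "u b \<in> carrier T" using a b by auto
      have "u (a \<oplus>\<^bsub>S\<^esub> b) \<ominus>\<^bsub>T\<^esub> (t \<oplus>\<^bsub>T\<^esub> t') = (u a \<ominus>\<^bsub>T\<^esub> t) \<oplus>\<^bsub>T\<^esub> (u b \<ominus>\<^bsub>T\<^esub> t')"
        using uc t unfolding hom_add [OF a(1) b(1)] by algebra
      then have 1: "u (a \<oplus>\<^bsub>S\<^esub> b) \<ominus>\<^bsub>T\<^esub> (t \<oplus>\<^bsub>T\<^esub> t') \<in> G n" using Gadd a b by simp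
      have "u (a \<otimes>\<^bsub>S\<^esub> b) \<ominus>\<^bsub>T\<^esub> (t \<otimes>\<^bsub>T\<^esub> t') = u a \<otimes>\<^bsub>T\<^esub> (u b \<ominus>\<^bsub>T\<^esub> t') \<oplus>\<^bsub>T\<^esub> t' \<otimes>\<^bsub>T\<^esub> (u a \<ominus>\<^bsub>T\<^esub> t)"
        using uc t unfolding hom_mult [OF a(1) b(1)] by algebra
      moreover have "u a \<otimes>\<^bsub>T\<^esub> (u b \<ominus>\<^bsub>T\<^esub> t') \<in> G n" "t' \<otimes>\<^bsub>T\<^esub> (u a \<ominus>\<^bsub>T\<^esub> t) \<in> G n"
        using ideal.I_l_closed [OF G_ideal] a b uc t by auto
      ultimately have 2: "u (a \<otimes>\<^bsub>S\<^esub> b) \<ominus>\<^bsub>T\<^esub> (t \<otimes>\<^bsub>T\<^esub> t') \<in> G n" using Gadd by simp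
      show ?thesis
        using \<Psi>_eq [OF S.m_closed [OF t] R.m_closed [OF a(1) b(1)] 2] \<Psi>_eq [OF S.a_closed [OF t] R.a_closed [OF a(1) b(1)] 1]
          \<Psi>_eq [OF t(1) a] \<Psi>_eq [OF t(2) b] ring_hom_mult [OF coset_hom a(1) b(1), of n] ring_hom_add [OF coset_hom a(1) b(1), of n]
        by simp
    qed
    then show "\<Psi> (t \<otimes>\<^bsub>T\<^esub> t') = \<Psi> t \<otimes>\<^bsub>?H\<^esub> \<Psi> t'" "\<Psi> (t \<oplus>\<^bsub>T\<^esub> t') = \<Psi> t \<oplus>\<^bsub>?H\<^esub> \<Psi> t'"
      by (auto simp: adic_completion_def inverse_limit_simps)
  qed (use \<Psi>_closed \<Psi>_u [of "\<one>\<^bsub>S\<^esub>"] in \<open>auto simp: ring_hom_one [OF to_completion_hom]\<close>)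
  have JL': "\<exists>N\<ge>n. Jp N \<subseteq> L n" for n
    using JL [of n] Jp_antimono by (meson max.cobounded1 max.cobounded2 subset_trans)
  have inj: "inj_on \<Psi> (carrier T)"
  proof (rule inj_onI)
    fix t t' assume t: "t \<in> carrier T" "t' \<in> carrier T" and eq: "\<Psi> t = \<Psi> t'"
    \<comment> \<open>Approximants up to the finer index N have equal cosets, so they differ by an
      element of L n; the comparison then takes place in G n.\<close>
    have "t \<ominus>\<^bsub>T\<^esub> t' \<in> G n" for n
    proof -
      obtain N where N: "n \<le> N" "Jp N \<subseteq> L n" using JL' by blast
      obtain a where a: "a \<in> carrier S" "u a \<ominus>\<^bsub>T\<^esub> t \<in> G N" using dense [OF t(1)] by blast
      obtain b where b: "b \<in> carrier S" "u b \<ominus>\<^bsub>T\<^esub> t' \<in> G N" using dense [OF t(2)] by blast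
      have uc: "u a \<in> carrier T" "u b \<in> carrier T" using a b by auto
      have "Jp N +>\<^bsub>S\<^esub> a = Jp N +>\<^bsub>S\<^esub> b" using \<Psi>_eq [OF t(1) a] \<Psi>_eq [OF t(2) b] eq by simp
      then have "a \<ominus>\<^bsub>S\<^esub> b \<in> L n" using ideal.coset_eq_iff [OF Jp_ideal a(1) b(1)] N by auto
      then have "u (a \<ominus>\<^bsub>S\<^esub> b) \<in> G n" using hom_in_iff [OF R.minus_closed [OF a(1) b(1)]] by blast
      then have 1: "u a \<ominus>\<^bsub>T\<^esub> u b \<in> G n"
        using ring_hom_a_minus [OF homh R.ring_axioms S.ring_axioms a(1) b(1)] by simp
      have 2: "u a \<ominus>\<^bsub>T\<^esub> t \<in> G n" "u b \<ominus>\<^bsub>T\<^esub> t' \<in> G n" using Gmono [OF N(1)] a b by auto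
      have "t \<ominus>\<^bsub>T\<^esub> t' = ((u a \<ominus>\<^bsub>T\<^esub> u b) \<oplus>\<^bsub>T\<^esub> (u b \<ominus>\<^bsub>T\<^esub> t')) \<ominus>\<^bsub>T\<^esub> (u a \<ominus>\<^bsub>T\<^esub> t)"
        using uc t by algebra
      then show ?thesis using Gminus [OF Gadd [OF 1 2(2)] 2(1)] by simp
    qed
    then have "t \<ominus>\<^bsub>T\<^esub> t' = \<zero>\<^bsub>T\<^esub>" using separated t by blast
    then show "t = t'" using t by simp
  qed
  have surj: "C \<in> \<Psi> ` carrier T" if C: "C \<in> carrier ?H" for C
  proof -
    have Cc: "C n \<in> carrier (S Quot Jp n)" "Jp n <+>\<^bsub>S\<^esub> C (Suc n) = C n" for n
      using C by (auto simp: adic_completion_def inverse_limit_simps)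
    have "\<forall>n. \<exists>a. a \<in> carrier S \<and> C n = Jp n +>\<^bsub>S\<^esub> a" using Cc(1) by (auto simp: quot_carrier)
    then obtain s where s: "\<And>n. s n \<in> carrier S" "\<And>n. C n = Jp n +>\<^bsub>S\<^esub> s n" by metis
    have "C m = Jp m +>\<^bsub>S\<^esub> a" if "C (m + k) = Jp (m + k) +>\<^bsub>S\<^esub> a" "a \<in> carrier S" for m k a
      using that
    proof (induction k)
      case (Suc k)
      then have "C (m + k) = Jp (m + k) +>\<^bsub>S\<^esub> a" using Cc(2) [of "m + k"] by (simp add: transition)
      then show ?case using Suc by simp
    qed simp
    then have rep: "C m = Jp m +>\<^bsub>S\<^esub> s n" if "m \<le> n" for m n
      using s that by (metis le_add_diff_inverse)
    obtain f where f: "\<And>n. n \<le> f n" "\<And>n. Jp (f n) \<subseteq> L n" using JL' by metis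
    \<comment> \<open>Partial sums turn the exponents f into a monotone choice that still dominates
      f; monotonicity makes consecutive representatives comparable.\<close>
    define N where "N k = (\<Sum>i\<le>k. f i)" for k
    have fN: "f k \<le> N k" for k by (simp add: N_def member_le_sum)
    have NL: "Jp (N k) \<subseteq> L k" for k using Jp_antimono [OF fN] f(2) by blast
    have Nk: "k \<le> N k" for k using f(1) fN le_trans by blast
    have "u (s (N (Suc k))) \<ominus>\<^bsub>T\<^esub> u (s (N k)) \<in> G k" for k
    proof -
      have "N k \<le> N (Suc k)" by (simp add: N_def)
      then have "s (N (Suc k)) \<ominus>\<^bsub>S\<^esub> s (N k) \<in> Jp (N k)"
        using rep [of "N k" "N (Suc k)"] s(2) [of "N k"]
          ideal.coset_eq_iff [OF Jp_ideal [of "N k"] s(1) [of "N (Suc k)"] s(1) [of "N k"]] by simp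
      then have "u (s (N (Suc k)) \<ominus>\<^bsub>S\<^esub> s (N k)) \<in> G k"
        using NL hom_in_iff s by blast
      then show ?thesis using ring_hom_a_minus [OF homh R.ring_axioms S.ring_axioms s(1) s(1)] by simp
    qed
    then obtain l where l: "l \<in> carrier T" "\<And>k. u (s (N k)) \<ominus>\<^bsub>T\<^esub> l \<in> G k"
      using complete [of "\<lambda>k. u (s (N k))"] s by auto
    have "\<Psi> l k = C k" for k
      using \<Psi>_eq [OF l(1) s(1) l(2)] rep [OF Nk] by simp
    then show ?thesis using l by blast
  qed
  have iso: "\<Psi> \<in> ring_iso T ?H"
    using hom inj surj \<Psi>_closed by (auto simp: ring_iso_def bij_betw_def)
  show ?thesis
  proof
    show "inv_into (carrier T) \<Psi> \<in> ring_iso ?H T" by (rule ring_iso_set_sym [OF S.ring_axioms iso])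
    show "\<forall>s\<in>carrier S. inv_into (carrier T) \<Psi> (to_completion S J s) = u s"
      using inj by (auto simp: \<Psi>_u [symmetric])
  qed
qed

section \<open>Transport of ideals, completions and the Noetherian property\<close>

lemma ideal_image_iso:
  assumes R: "cring R" and S: "cring S" and k: "k \<in> ring_iso R S" and I: "ideal I R"
  shows "ideal (k ` I) S"
proof -
  interpret R: cring R by fact
  interpret S: cring S by fact
  interpret I: ideal I R by fact
  interpret k: ring_hom_cring R S k by unfold_locales (use k in \<open>simp add: ring_iso_def\<close>)
  show ?thesis
  proof (rule S.cring_idealI)
    show "\<zero>\<^bsub>S\<^esub> \<in> k ` I" using I.zero_closed k.hom_zero by (metis image_eqI)
    show "s \<oplus>\<^bsub>S\<^esub> t \<in> k ` I" if st: "s \<in> k ` I" "t \<in> k ` I" for s t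
    proof -
      obtain a b where "a \<in> I" "b \<in> I" "s = k a" "t = k b" using st by blast
      then have "s \<oplus>\<^bsub>S\<^esub> t = k (a \<oplus>\<^bsub>R\<^esub> b)" "a \<oplus>\<^bsub>R\<^esub> b \<in> I" by (simp_all add: I.a_closed)
      then show ?thesis by blast
    qed
    show "r \<otimes>\<^bsub>S\<^esub> t \<in> k ` I" if rt: "r \<in> carrier S" "t \<in> k ` I" for r t
    proof -
      obtain b where b: "b \<in> I" "t = k b" using rt by blast
      obtain a where a: "a \<in> carrier R" "r = k a"
        using ring_iso_memE(5) [OF k] rt(1) by (auto simp: bij_betw_def)
      have "r \<otimes>\<^bsub>S\<^esub> t = k (a \<otimes>\<^bsub>R\<^esub> b)" "a \<otimes>\<^bsub>R\<^esub> b \<in> I" using a b by (simp_all add: I.I_l_closed)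
      then show ?thesis by blast
    qed
  qed auto
qed

text \<open>Stage 0 of a tower is a copy of the ring under \<open>Base\<close>; this carries the
  completion of R over to it.\<close>

lemma filtered_completion_iso:
  assumes fc: "filtered_completion A B u F G" and k: "k \<in> ring_iso A A'" and A': "cring A'"
    and l: "l \<in> ring_iso B B'" and B': "cring B'" and u': "\<And>a. a \<in> carrier A \<Longrightarrow> u' (k a) = l (u a)"
  shows "filtered_completion A' B' u' (\<lambda>n. k ` F n) (\<lambda>n. l ` G n)"
proof -
  interpret filtered_completion A B u F G by fact
  interpret A': cring A' by fact
  interpret B': cring B' by fact
  interpret k: ring_hom_cring A A' k by unfold_locales (use k in \<open>simp add: ring_iso_def\<close>)
  interpret l: ring_hom_cring B B' l by unfold_locales (use l in \<open>simp add: ring_iso_def\<close>)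
  have ks: "\<exists>a\<in>carrier A. a' = k a" if "a' \<in> carrier A'" for a'
    using ring_iso_memE(5) [OF k] that by (auto simp: bij_betw_def)
  have ls: "\<exists>b\<in>carrier B. b' = l b" if "b' \<in> carrier B'" for b'
    using ring_iso_memE(5) [OF l] that by (auto simp: bij_betw_def)
  have ki: "k a = k b \<longleftrightarrow> a = b" if "a \<in> carrier A" "b \<in> carrier A" for a b
    using ring_iso_memE(5) [OF k] that by (auto simp: bij_betw_def inj_on_def)
  have li: "l a = l b \<longleftrightarrow> a = b" if "a \<in> carrier B" "b \<in> carrier B" for a b
    using ring_iso_memE(5) [OF l] that by (auto simp: bij_betw_def inj_on_def)
  have kF: "k a \<in> k ` F n \<longleftrightarrow> a \<in> F n" if "a \<in> carrier A" for a n
    using ki that ideal.Icarr [OF F_ideal] by blast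
  have lG: "l b \<in> l ` G n \<longleftrightarrow> b \<in> G n" if "b \<in> carrier B" for b n
    using li that ideal.Icarr [OF G_ideal] by blast
  have lm: "l b \<ominus>\<^bsub>B'\<^esub> l b' = l (b \<ominus>\<^bsub>B\<^esub> b')" if "b \<in> carrier B" "b' \<in> carrier B" for b b'
    using that by (simp add: ring_hom_a_minus [OF l.homh S.ring_axioms B'.ring_axioms])
  show ?thesis
  proof (intro filtered_completion.intro filtered_completion_axioms.intro)
    have "u' \<in> ring_hom A' B'"
    proof (rule ring_hom_memI)
      fix a' assume "a' \<in> carrier A'"
      then obtain a where a: "a \<in> carrier A" "a' = k a" using ks by blast
      then show "u' a' \<in> carrier B'" by (simp add: u')
      fix b' assume "b' \<in> carrier A'"
      then obtain b where b: "b \<in> carrier A" "b' = k b" using ks by blast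
      show "u' (a' \<otimes>\<^bsub>A'\<^esub> b') = u' a' \<otimes>\<^bsub>B'\<^esub> u' b'" "u' (a' \<oplus>\<^bsub>A'\<^esub> b') = u' a' \<oplus>\<^bsub>B'\<^esub> u' b'"
        using a b u' [of "a \<otimes>\<^bsub>A\<^esub> b"] u' [of "a \<oplus>\<^bsub>A\<^esub> b"] by (simp_all add: u')
    qed (use u' [of "\<one>\<^bsub>A\<^esub>"] in simp)
    then show "ring_hom_cring A' B' u'" by unfold_locales
    show "ideal (k ` F n) A'" for n by (rule ideal_image_iso [OF R.is_cring A' k F_ideal])
    show "ideal (l ` G n) B'" for n by (rule ideal_image_iso [OF S.is_cring B' l G_ideal])
    show "l ` G (Suc n) \<subseteq> l ` G n" for n using G_Suc by blast
    show "u' a' \<in> l ` G n \<longleftrightarrow> a' \<in> k ` F n" if a': "a' \<in> carrier A'" for a' n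
    proof -
      obtain a where "a \<in> carrier A" "a' = k a" using ks a' by blast
      then show ?thesis by (simp add: u' kF lG hom_in_iff)
    qed
    show "\<exists>a'\<in>carrier A'. u' a' \<ominus>\<^bsub>B'\<^esub> b' \<in> l ` G n" if b': "b' \<in> carrier B'" for b' n
    proof -
      obtain b where b: "b \<in> carrier B" "b' = l b" using ls b' by blast
      obtain a where a: "a \<in> carrier A" "u a \<ominus>\<^bsub>B\<^esub> b \<in> G n" using dense b by blast
      have "u' (k a) \<ominus>\<^bsub>B'\<^esub> b' = l (u a \<ominus>\<^bsub>B\<^esub> b)"
        unfolding u' [OF a(1)] b(2) by (rule lm) (use a b in auto)
      then have "u' (k a) \<ominus>\<^bsub>B'\<^esub> b' \<in> l ` G n" using a(2) by blast
      then show ?thesis using k.hom_closed [OF a(1)] by blast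
    qed
    show "b' = \<zero>\<^bsub>B'\<^esub>" if b': "b' \<in> carrier B'" "\<And>n. b' \<in> l ` G n" for b'
    proof -
      obtain b where b: "b \<in> carrier B" "b' = l b" using ls b'(1) by blast
      then have "b = \<zero>\<^bsub>B\<^esub>" using separated b'(2) lG by blast
      then show ?thesis using b by simp
    qed
    show "\<exists>m\<in>carrier B'. \<forall>i. t i \<ominus>\<^bsub>B'\<^esub> m \<in> l ` G i"
      if t: "\<And>i. t i \<in> carrier B'" "\<And>i. t (Suc i) \<ominus>\<^bsub>B'\<^esub> t i \<in> l ` G i" for t
    proof -
      have "\<forall>i. \<exists>b. b \<in> carrier B \<and> t i = l b" using ls [OF t(1)] by blast
      then obtain s where s: "\<And>i. s i \<in> carrier B" "\<And>i. t i = l (s i)" by metis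
      have "s (Suc i) \<ominus>\<^bsub>B\<^esub> s i \<in> G i" for i
        using t(2) [of i] lG [OF S.minus_closed [OF s(1) s(1)]] unfolding s(2) lm [OF s(1) s(1)] by blast
      then obtain m where m: "m \<in> carrier B" "\<And>i. s i \<ominus>\<^bsub>B\<^esub> m \<in> G i" using complete [of s] s by blast
      have "t i \<ominus>\<^bsub>B'\<^esub> l m = l (s i \<ominus>\<^bsub>B\<^esub> m)" for i
        unfolding s(2) by (rule lm [OF s(1) m(1)])
      then have "t i \<ominus>\<^bsub>B'\<^esub> l m \<in> l ` G i" for i using m(2) by simp
      then show ?thesis using l.hom_closed [OF m(1)] by blast
    qed
  qed
qed

lemma noetherian_ring_iso:
  assumes R: "cring R" and S: "cring S" and k: "k \<in> ring_iso R S" and noeth: "noetherian_ring R"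
  shows "noetherian_ring S"
proof -
  interpret R: cring R by fact
  interpret S: cring S by fact
  let ?k = "inv_into (carrier R) k"
  have k': "?k \<in> ring_iso S R" by (rule ring_iso_set_sym [OF R.ring_axioms k])
  have kk: "k (?k s) = s" if "s \<in> carrier S" for s
    using ring_iso_memE(5) [OF k] that by (simp add: bij_betw_inv_into_right)
  have kkI: "k ` ?k ` I = I" if "I \<subseteq> carrier S" for I
  proof -
    have "(\<lambda>s. k (?k s)) ` I = (\<lambda>s. s) ` I" using that by (intro image_cong refl kk) blast
    then show ?thesis by (simp add: image_image)
  qed
  show ?thesis
  proof (rule S.noetherian_ringI)
    fix I assume I: "ideal I S"
    then obtain G where G: "G \<subseteq> carrier R" "finite G" "?k ` I = genideal R G"
      using noetherian_ring.finetely_gen [OF noeth ideal_image_iso [OF S R k' I]] by blast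
    have "I \<subseteq> carrier S" using ideal.Icarr [OF I] by blast
    then have Ieq: "I = k ` (?k ` I)" by (simp only: kkI)
    have kG: "k ` G \<subseteq> carrier S" using G ring_iso_memE(1) [OF k] by blast
    have "G \<subseteq> ?k ` genideal S (k ` G)"
    proof
      fix g assume g: "g \<in> G"
      then have "?k (k g) = g" using G ring_iso_memE(5) [OF k] by (auto simp: bij_betw_def inv_into_f_f)
      then show "g \<in> ?k ` genideal S (k ` G)" using S.genideal_self [OF kG] g by force
    qed
    then have "?k ` I \<subseteq> ?k ` genideal S (k ` G)"
      using R.genideal_minimal [OF ideal_image_iso [OF S R k' S.genideal_ideal [OF kG]]] G(3) by simp
    then have "k ` ?k ` I \<subseteq> k ` ?k ` genideal S (k ` G)" by blast
    moreover have "k ` ?k ` genideal S (k ` G) = genideal S (k ` G)"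
      using ideal.Icarr [OF S.genideal_ideal [OF kG]] by (intro kkI) blast
    ultimately have "I \<subseteq> genideal S (k ` G)" using Ieq by simp
    moreover have "G \<subseteq> ?k ` I" using R.genideal_self [OF G(1)] G(3) by simp
    then have "k ` G \<subseteq> I" using Ieq by (metis image_mono)
    then have "genideal S (k ` G) \<subseteq> I" by (rule S.genideal_minimal [OF I])
    ultimately show "\<exists>H\<subseteq>carrier S. finite H \<and> I = genideal S H" using kG G(2) by blast
  qed
qed

section \<open>The tower of a ring of characteristic \<open>p\<close>\<close>

lemma (in cring) nat_pow_in_ideal:
  assumes "ideal I R" "r \<in> I" "0 < (k::nat)"
  shows "r [^] k \<in> I"
proof -
  obtain q where "k = Suc q" using assms(3) gr0_conv_Suc by blast
  then show ?thesis
    using assms ideal.I_l_closed [OF assms(1,2)] ideal.Icarr [OF assms(1,2)] by simp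
qed

text \<open>The chosen element lies in its coset, and a coset of \<open>RI\<close> is determined by
  any of its elements.\<close>

lemma (in root_adjunction) inj_on_coset_pick: "inj_on (\<lambda>C. SOME f. f \<in> C) (carrier RR)"
proof (rule inj_onI)
  fix C D assume C: "C \<in> carrier RR" and D: "D \<in> carrier RR" and eq: "(SOME f. f \<in> C) = (SOME f. f \<in> D)"
  obtain f where f: "f \<in> carrier MP" "C = RI +>\<^bsub>MP\<^esub> f"
    using C by (auto simp: root_ring_def quot_carrier)
  obtain g where g: "g \<in> carrier MP" "D = RI +>\<^bsub>MP\<^esub> g"
    using D by (auto simp: root_ring_def quot_carrier)
  have "(SOME f. f \<in> C) \<in> C" "(SOME f. f \<in> D) \<in> D"
    using RI.a_rcos_self f g by (metis someI_ex)+
  then have "C = RI +>\<^bsub>MP\<^esub> (SOME f. f \<in> C)" "D = RI +>\<^bsub>MP\<^esub> (SOME f. f \<in> D)"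
    using f g RI.a_repr_independence' by metis+
  then show "C = D" using eq by simp
qed

lemma inj_on_coset_code: "root_adjunction A p y \<Longrightarrow> inj_on coset_code (carrier (root_ring p A y))"
  using root_adjunction.inj_on_coset_pick [of A p y] by (auto simp: inj_on_def coset_code_def)

lemma tower_ring_Suc: "tower_ring p R x (Suc i) = image_ring coset_code (root_ring p (tower_ring p R x i) (tower_gens p R x i))"
  by (simp add: Let_def)

lemma length_tower_gens: "length (tower_gens p R x i) = length x"
  by (induction i) (simp_all add: Let_def)

lemma tower_gens_Suc: "j < length x \<Longrightarrow> tower_gens p R x (Suc i) ! j
    = coset_code (root_class p (tower_ring p R x i) (tower_gens p R x i) (ring.indexed_var (tower_ring p R x i) j))"
  using length_tower_gens [of p R x i] by (simp add: Let_def)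

declare tower.simps [simp del]

lemma Base_iso: "Base \<in> ring_iso R (tower_ring p R x 0)"
  by (simp add: tower.simps inj_imp_image_ring_iso inj_on_def)

lemma base_elem_Base: "s \<in> carrier (tower_ring p R x 0) \<Longrightarrow> Base (base_elem s) = s"
  by (auto simp: tower.simps image_ring_carrier)

locale gabber_tower = cring R for R (structure) +
  fixes p :: nat and x
  assumes prime_p: "Factorial_Ring.prime p" and char_p: "[p] \<cdot> \<one> = \<zero>" and x_closed: "set x \<subseteq> carrier R"
begin

abbreviation "n \<equiv> length x"
abbreviation "TA i \<equiv> tower_ring p R x i"
abbreviation "TX i \<equiv> tower_gens p R x i"
abbreviation "TI i \<equiv> tower_incl p R x i"
abbreviation "TP i \<equiv> tower_phi p R x i"
abbreviation "E \<equiv> red_mon p n"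

definition "te i a = mon_val (TA i) n (\<lambda>j. TX i ! j) (count a)"

lemma p_pos: "0 < p" using prime_p by (rule prime_gt_0_nat)

text \<open>The three facts are carried together: commutativity and closedness of the generators
  allow the next adjunction of roots, and the characteristic makes Frobenius a homomorphism at every
  stage.\<close>

lemma tower_invariant: "cring (TA i) \<and> [p] \<cdot>\<^bsub>TA i\<^esub> \<one>\<^bsub>TA i\<^esub> = \<zero>\<^bsub>TA i\<^esub> \<and> set (TX i) \<subseteq> carrier (TA i)"
proof (induction i)
  case 0
  have c: "cring (TA 0)"
    using ring_iso_cring [OF is_cring Base_iso] by (simp add: tower.simps image_ring_zero)
  have B: "Base \<in> ring_hom R (TA 0)" using Base_iso [of R p x] by (simp add: ring_iso_def)
  have "[p] \<cdot>\<^bsub>TA 0\<^esub> \<one>\<^bsub>TA 0\<^esub> = Base ([p] \<cdot> \<one>)"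
    using ring_hom_add_pow [OF ring_axioms cring.axioms(1) [OF c] B one_closed] ring_hom_one [OF B] by simp
  then have "[p] \<cdot>\<^bsub>TA 0\<^esub> \<one>\<^bsub>TA 0\<^esub> = \<zero>\<^bsub>TA 0\<^esub>"
    by (simp add: char_p tower.simps image_ring_zero)
  then show ?case using c x_closed by (auto simp: tower.simps image_ring_carrier)
next
  case (Suc i)
  then interpret A: cring "TA i" by blast
  interpret A: root_adjunction "TA i" p "TX i"
    by unfold_locales (use Suc p_pos in auto)
  note inj = inj_on_coset_code [OF A.root_adjunction_axioms]
  have c: "cring (TA (Suc i))" unfolding tower_ring_Suc by (rule A.image_root_ring_cring [OF inj])
  have k: "coset_code \<in> ring_hom A.RR (TA (Suc i))"
    using A.image_root_ring_iso [OF inj] by (simp add: ring_iso_def tower_ring_Suc)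
  have h: "(\<lambda>r. coset_code (A.incl r)) \<in> ring_hom (TA i) (TA (Suc i))"
    using ring_hom_trans [OF A.incl_hom k] by (simp add: comp_def)
  then interpret H: ring_hom_cring "TA i" "TA (Suc i)" "\<lambda>r. coset_code (A.incl r)"
    by (simp add: ring_hom_cring_def ring_hom_cring_axioms_def c A.is_cring)
  have "[p] \<cdot>\<^bsub>TA (Suc i)\<^esub> \<one>\<^bsub>TA (Suc i)\<^esub> = coset_code (A.incl ([p] \<cdot>\<^bsub>TA i\<^esub> \<one>\<^bsub>TA i\<^esub>))"
    using ring_hom_add_pow [OF A.ring_axioms cring.axioms(1) [OF c] h A.one_closed] H.hom_one by simp
  then have "[p] \<cdot>\<^bsub>TA (Suc i)\<^esub> \<one>\<^bsub>TA (Suc i)\<^esub> = \<zero>\<^bsub>TA (Suc i)\<^esub>"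
    using Suc H.hom_zero by simp
  moreover have "TX (Suc i) ! j \<in> carrier (TA (Suc i))" if "j < n" for j
    using A.image_root_closed [OF inj, of j] that
    by (simp add: tower_ring_Suc tower_gens_Suc A.adj_root_def length_tower_gens)
  then have "set (TX (Suc i)) \<subseteq> carrier (TA (Suc i))"
    using length_tower_gens [of p R x "Suc i"] by (auto simp: in_set_conv_nth)
  ultimately show ?case using c by blast
qed

lemma TA_cring: "cring (TA i)" and TA_char: "[p] \<cdot>\<^bsub>TA i\<^esub> \<one>\<^bsub>TA i\<^esub> = \<zero>\<^bsub>TA i\<^esub>"
  using tower_invariant by blast+

sublocale TA: cring "TA i" for i by (rule TA_cring)

lemma TX_closed: "j < n \<Longrightarrow> TX i ! j \<in> carrier (TA i)"
  using tower_invariant length_tower_gens [of p R x i] nth_mem by (metis subsetD)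

lemma TX_funcset: "(\<lambda>j. TX i ! j) \<in> {..<n} \<rightarrow> carrier (TA i)"
  using TX_closed by auto

lemma root_adj: "root_adjunction (TA i) p (TX i)"
  using tower_invariant [of i] p_pos by (simp add: root_adjunction_def root_adjunction_axioms_def)

lemma TI_eq: "TI i = (\<lambda>r. coset_code (root_adjunction.incl (TA i) p (TX i) r))"
  by (simp add: fun_eq_iff tower_incl_def root_adjunction.incl_def [OF root_adj])

lemma TX_Suc_eq: "j < n \<Longrightarrow> TX (Suc i) ! j = coset_code (root_adjunction.adj_root (TA i) p (TX i) j)"
  by (simp add: tower_gens_Suc root_adjunction.adj_root_def [OF root_adj])

lemma te_closed: "te i a \<in> carrier (TA i)"
  unfolding te_def by (rule cring.mon_val_closed [OF TA_cring TX_funcset])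

lemma free_ext_tower: "free_ext (TA i) (TA (Suc i)) (TI i) E (te (Suc i))"
proof -
  interpret A: root_adjunction "TA i" p "TX i" by (rule root_adj)
  note inj = inj_on_coset_code [OF root_adj]
  have "te (Suc i) a = mon_val (TA (Suc i)) n (\<lambda>j. coset_code (A.adj_root j)) (count a)" for a
    unfolding te_def
  proof (rule mon_val_cong [OF TA_cring])
    show "(\<lambda>j. coset_code (A.adj_root j)) \<in> {..<n} \<rightarrow> carrier (TA (Suc i))"
      using TX_closed [of _ "Suc i"] by (auto simp: TX_Suc_eq)
  qed (rule TX_Suc_eq)
  then have "te (Suc i) = (\<lambda>a. mon_val (TA (Suc i)) n (\<lambda>j. coset_code (A.adj_root j)) (count a))" by blast
  then show ?thesis
    using A.free_ext_image_root_ring [OF inj] by (simp add: tower_ring_Suc TI_eq length_tower_gens)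
qed

sublocale FE: free_ext "TA i" "TA (Suc i)" "TI i" E "te (Suc i)" for i
  by (rule free_ext_tower)

lemma TX_pow: "j < n \<Longrightarrow> TX (Suc i) ! j [^]\<^bsub>TA (Suc i)\<^esub> p = TI i (TX i ! j)"
  using root_adjunction.image_root_pow [OF root_adj inj_on_coset_code [OF root_adj], of j i]
  by (simp add: TX_Suc_eq tower_ring_Suc TI_eq length_tower_gens)

lemma tower_universal:
  assumes "cring D" "\<sigma> \<in> ring_hom (TA i) D" "\<And>j. j < n \<Longrightarrow> z j \<in> carrier D"
    "\<And>j. j < n \<Longrightarrow> z j [^]\<^bsub>D\<^esub> p = \<sigma> (TX i ! j)"
  shows "\<exists>h\<in>ring_hom (TA (Suc i)) D. (\<forall>r\<in>carrier (TA i). h (TI i r) = \<sigma> r) \<and> (\<forall>j<n. h (TX (Suc i) ! j) = z j)"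
  using root_adjunction.image_root_ring_universal [OF root_adj inj_on_coset_code [OF root_adj], of D \<sigma> i z] assms
  by (simp add: TX_Suc_eq tower_ring_Suc TI_eq length_tower_gens)

lemma frobenius_hom: "(\<lambda>r. r [^]\<^bsub>TA i\<^esub> p) \<in> ring_hom (TA i) (TA i)"
proof -
  show ?thesis
    by (rule ring_hom_memI) (auto simp: TA.nat_pow_distrib TA.frobenius_add [OF prime_p TA_char])
qed

text \<open>Existence comes from the universal property, applied to Frobenius on the stage below:
  each generator there is a p-th root of its own Frobenius image.\<close>

lemma tower_phi_spec:
  "TP i \<in> ring_hom (TA (Suc i)) (TA i) \<and> (\<forall>r\<in>carrier (TA i). TP i (TI i r) = r [^]\<^bsub>TA i\<^esub> p)
    \<and> (\<forall>j<n. TP i (TX (Suc i) ! j) = TX i ! j)"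
proof -
  have "\<exists>h. h \<in> ring_hom (TA (Suc i)) (TA i) \<and> (\<forall>r\<in>carrier (TA i). h (TI i r) = r [^]\<^bsub>TA i\<^esub> p)
    \<and> (\<forall>j<n. h (TX (Suc i) ! j) = TX i ! j)"
    using tower_universal [OF TA_cring frobenius_hom, of "\<lambda>j. TX i ! j" i] TX_closed by blast
  from someI_ex [OF this] show ?thesis unfolding tower_phi_def by blast
qed

lemma TP_hom: "TP i \<in> ring_hom (TA (Suc i)) (TA i)"
  and TP_TI: "r \<in> carrier (TA i) \<Longrightarrow> TP i (TI i r) = r [^]\<^bsub>TA i\<^esub> p"
  and TP_TX: "j < n \<Longrightarrow> TP i (TX (Suc i) ! j) = TX i ! j"
  using tower_phi_spec by blast+

sublocale TP: ring_hom_cring "TA (Suc i)" "TA i" "TP i" for i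
  by (simp add: ring_hom_cring_def ring_hom_cring_axioms_def TA_cring TP_hom)

lemma TP_te: "TP i (te (Suc i) a) = te i a"
  unfolding te_def TP.hom_mon_val [OF TX_funcset]
  by (rule mon_val_cong [OF TA_cring TX_funcset]) (rule TP_TX)

lemma TI_te: "TI i (te i a) = te (Suc i) a [^]\<^bsub>TA (Suc i)\<^esub> p"
proof -
  have "TI i (te i a) = mon_val (TA (Suc i)) n (\<lambda>j. TI i (TX i ! j)) (count a)"
    unfolding te_def by (rule FE.hom_mon_val [OF TX_funcset])
  also have "\<dots> = mon_val (TA (Suc i)) n (\<lambda>j. TX (Suc i) ! j [^]\<^bsub>TA (Suc i)\<^esub> p) (count a)"
    by (rule mon_val_cong [OF TA_cring]) (auto simp: TX_closed TX_pow)
  also have "\<dots> = te (Suc i) a [^]\<^bsub>TA (Suc i)\<^esub> p"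
    unfolding te_def by (rule TA.mon_val_pow [OF TX_funcset, symmetric])
  finally show ?thesis .
qed

lemma TP_lincomb:
  assumes c: "c \<in> E \<rightarrow> carrier (TA i)"
  shows "TP i (FE.lincomb i c) = (\<Oplus>\<^bsub>TA i\<^esub>a\<in>E. c a [^]\<^bsub>TA i\<^esub> p \<otimes>\<^bsub>TA i\<^esub> te i a)"
proof -
  have cc: "c a \<in> carrier (TA i)" if "a \<in> E" for a using c that by auto
  have "TP i (FE.lincomb i c) = (\<Oplus>\<^bsub>TA i\<^esub>a\<in>E. (TP i \<circ> (\<lambda>a. TI i (c a) \<otimes>\<^bsub>TA (Suc i)\<^esub> te (Suc i) a)) a)"
    unfolding FE.lincomb_def by (rule TP.hom_finsum) (auto simp: te_closed cc)
  also have "\<dots> = (\<Oplus>\<^bsub>TA i\<^esub>a\<in>E. c a [^]\<^bsub>TA i\<^esub> p \<otimes>\<^bsub>TA i\<^esub> te i a)"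
    by (rule TA.finsum_cong') (auto simp: te_closed cc TP_TI TP_te)
  finally show ?thesis .
qed

text \<open>Both sides are additive, the p-th power because of the characteristic, so it suffices to
  compare single terms, where \<open>TI_te\<close> applies.\<close>

lemma TI_TP:
  assumes b: "b \<in> carrier (TA (Suc i))"
  shows "TI i (TP i b) = b [^]\<^bsub>TA (Suc i)\<^esub> p"
proof -
  define c where "c = FE.coord i b"
  have c: "c \<in> E \<rightarrow> carrier (TA i)" unfolding c_def by (rule FE.coord_funcset [OF b])
  then have cc: "c a \<in> carrier (TA i)" if "a \<in> E" for a using that by auto
  have bc: "b = FE.lincomb i c" unfolding c_def by (rule FE.lincomb_coord [OF b, symmetric])
  have "TI i (TP i b) = TI i (\<Oplus>\<^bsub>TA i\<^esub>a\<in>E. c a [^]\<^bsub>TA i\<^esub> p \<otimes>\<^bsub>TA i\<^esub> te i a)"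
    by (simp only: bc TP_lincomb [OF c])
  also have "\<dots> = (\<Oplus>\<^bsub>TA (Suc i)\<^esub>a\<in>E. (TI i \<circ> (\<lambda>a. c a [^]\<^bsub>TA i\<^esub> p \<otimes>\<^bsub>TA i\<^esub> te i a)) a)"
    by (rule FE.hom_finsum) (auto simp: cc te_closed)
  also have "\<dots> = (\<Oplus>\<^bsub>TA (Suc i)\<^esub>a\<in>E. (TI i (c a) \<otimes>\<^bsub>TA (Suc i)\<^esub> te (Suc i) a) [^]\<^bsub>TA (Suc i)\<^esub> p)"
    by (rule TA.finsum_cong')
      (auto simp: cc te_closed TI_te TA.nat_pow_distrib ring_hom_nat_pow [OF FE.homh TA.ring_axioms TA.ring_axioms])
  also have "\<dots> = b [^]\<^bsub>TA (Suc i)\<^esub> p"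
    unfolding bc FE.lincomb_def
    by (rule TA.frobenius_finsum [OF prime_p TA_char finite_red_mon, symmetric]) (auto simp: cc te_closed)
  finally show ?thesis .
qed

text \<open>The ideal generated by F m in stage i, obtained by extending one stage at a
  time.\<close>

primrec fil :: "(nat \<Rightarrow> 'a tower_elem set) \<Rightarrow> nat \<Rightarrow> nat \<Rightarrow> 'a tower_elem set" where
  "fil F 0 m = F m"
| "fil F (Suc i) m = FE.ext_ideal i (fil F i m)"

context
  fixes F :: "nat \<Rightarrow> 'a tower_elem set"
  assumes F_ideal: "\<And>m. ideal (F m) (TA 0)"
begin

lemma ideal_fil: "ideal (fil F i m) (TA i)"
  by (induction i) (simp_all add: F_ideal FE.ideal_ext_ideal)

text \<open>The map raises the coefficients to their p-th powers, which stay in the ideal containing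
  the coefficients.\<close>

lemma TP_fil: assumes b: "b \<in> fil F (Suc i) m" shows "TP i b \<in> fil F i m"
proof -
  interpret I: ideal "fil F i m" "TA i" by (rule ideal_fil)
  have c: "FE.coord i b a \<in> fil F i m" if "a \<in> E" for a
    using b that by (auto simp: FE.ext_ideal_def)
  have bcarr: "b \<in> carrier (TA (Suc i))" using b by (simp add: FE.ext_ideal_def)
  have "FE.coord i b a [^]\<^bsub>TA i\<^esub> p \<in> fil F i m" if "a \<in> E" for a
    by (rule TA.nat_pow_in_ideal [OF ideal_fil c [OF that] p_pos])
  then have "(\<Oplus>\<^bsub>TA i\<^esub>a\<in>E. FE.coord i b a [^]\<^bsub>TA i\<^esub> p \<otimes>\<^bsub>TA i\<^esub> te i a) \<in> fil F i m"
    using te_closed by (intro I.finsum_in_ideal) (auto intro!: I.I_r_closed)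
  then show ?thesis
    using TP_lincomb [OF FE.coord_funcset [OF bcarr]] FE.lincomb_coord [OF bcarr] by simp
qed

lemma TI_fil: "r \<in> fil F i m \<Longrightarrow> TI i r \<in> fil F (Suc i) m"
  by (simp add: FE.hom_in_ext_ideal [OF ideal_fil])

end

section \<open>Gabber's ring as a limit, and the expansion of its elements\<close>

lemma tower_system: "inverse_system (\<lambda>i. TA i) (\<lambda>i. TP i)"
  by (rule inverse_system.intro) (rule TA_cring, rule TP_hom)

abbreviation "GS \<equiv> gabber p R x"

lemma GS_eq: "GS = inverse_limit (\<lambda>i. TA i) (\<lambda>i. TP i)"
  by (simp add: gabber_def)

sublocale GS: inverse_system "\<lambda>i. TA i" "\<lambda>i. TP i" by (rule tower_system)

sublocale GS: cring GS unfolding GS_eq by (rule GS.cring_inverse_limit)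

lemma GS_carrier: "s \<in> carrier GS \<longleftrightarrow> (\<forall>i. s i \<in> carrier (TA i) \<and> TP i (s (Suc i)) = s i)"
  by (simp add: GS_eq inverse_limit_simps)

lemma GS_proj: "(\<lambda>s. s i) \<in> ring_hom GS (TA i)"
  using GS.proj_hom by (simp add: GS_eq)

lemma gabber_decomposition:
  assumes s: "s \<in> carrier GS"
  shows "\<And>a. a \<in> E \<Longrightarrow> (\<lambda>i. FE.coord i (s (Suc i)) a) \<in> carrier GS"
    and "s = (\<Oplus>\<^bsub>GS\<^esub>a\<in>E. (\<lambda>i. FE.coord i (s (Suc i)) a) [^]\<^bsub>GS\<^esub> p \<otimes>\<^bsub>GS\<^esub> (\<lambda>i. te i a))"
proof -
  let ?c = "\<lambda>a i. FE.coord i (s (Suc i)) a"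
  have sc: "s i \<in> carrier (TA i)" and sP: "TP i (s (Suc i)) = s i" for i using s by (auto simp: GS_carrier)
  have cc: "?c a i \<in> carrier (TA i)" if "a \<in> E" for a i using that by (intro FE.coord_closed sc)
  have s_eq: "s i = (\<Oplus>\<^bsub>TA i\<^esub>a\<in>E. ?c a i [^]\<^bsub>TA i\<^esub> p \<otimes>\<^bsub>TA i\<^esub> te i a)" for i
    using TP_lincomb [OF FE.coord_funcset [OF sc], of i] FE.lincomb_coord [OF sc, of i] sP by simp
  have compat: "TP i (?c a (Suc i)) = ?c a i" if a: "a \<in> E" for a i
  proof -
    have Pc: "(\<lambda>a. TP i (?c a (Suc i))) \<in> E \<rightarrow> carrier (TA i)" using cc by auto
    \<comment> \<open>The p-th power of a coefficient is the included image of that coefficient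
      under the transition map. So the expansion of \<open>s (Suc i)\<close> by p-th powers is also
      its basis expansion, and uniqueness of coordinates gives compatibility.\<close>
    have "s (Suc i) = FE.lincomb i (\<lambda>a. TP i (?c a (Suc i)))"
      unfolding FE.lincomb_def by (subst s_eq, rule TA.finsum_cong') (auto simp: TI_TP cc te_closed)
    then show ?thesis using FE.coord_lincomb [OF Pc a] by simp
  qed
  show c: "?c a \<in> carrier GS" if "a \<in> E" for a using that cc compat by (simp add: GS_carrier)
  have te: "(\<lambda>i. te i a) \<in> carrier GS" for a by (simp add: GS_carrier te_closed TP_te)
  show "s = (\<Oplus>\<^bsub>GS\<^esub>a\<in>E. ?c a [^]\<^bsub>GS\<^esub> p \<otimes>\<^bsub>GS\<^esub> (\<lambda>i. te i a))"
  proof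
    fix i
    interpret P: ring_hom_cring GS "TA i" "\<lambda>s. s i" by unfold_locales (rule GS_proj)
    have "(\<Oplus>\<^bsub>GS\<^esub>a\<in>E. ?c a [^]\<^bsub>GS\<^esub> p \<otimes>\<^bsub>GS\<^esub> (\<lambda>i. te i a)) i
        = (\<Oplus>\<^bsub>TA i\<^esub>a\<in>E. ((\<lambda>s. s i) \<circ> (\<lambda>a. ?c a [^]\<^bsub>GS\<^esub> p \<otimes>\<^bsub>GS\<^esub> (\<lambda>i. te i a))) a)"
      by (rule P.hom_finsum) (auto simp: c te)
    also have "\<dots> = (\<Oplus>\<^bsub>TA i\<^esub>a\<in>E. ?c a i [^]\<^bsub>TA i\<^esub> p \<otimes>\<^bsub>TA i\<^esub> te i a)"
    proof (rule TA.finsum_cong')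
      show "(\<lambda>a. ?c a i [^]\<^bsub>TA i\<^esub> p \<otimes>\<^bsub>TA i\<^esub> te i a) \<in> E \<rightarrow> carrier (TA i)"
        by (intro Pi_I TA.m_closed TA.nat_pow_closed cc te_closed)
      fix a assume a: "a \<in> E"
      have "(?c a [^]\<^bsub>GS\<^esub> p \<otimes>\<^bsub>GS\<^esub> (\<lambda>i. te i a)) i = (?c a [^]\<^bsub>GS\<^esub> p) i \<otimes>\<^bsub>TA i\<^esub> te i a"
        by (rule ring_hom_mult [OF GS_proj [of i] GS.nat_pow_closed [OF c [OF a], of p] te [of a]])
      also have "(?c a [^]\<^bsub>GS\<^esub> p) i = ?c a i [^]\<^bsub>TA i\<^esub> p"
        by (rule ring_hom_nat_pow [OF GS_proj [of i] GS.ring_axioms TA.ring_axioms c [OF a], of p])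
      finally show "((\<lambda>s. s i) \<circ> (\<lambda>a. ?c a [^]\<^bsub>GS\<^esub> p \<otimes>\<^bsub>GS\<^esub> (\<lambda>i. te i a))) a = ?c a i [^]\<^bsub>TA i\<^esub> p \<otimes>\<^bsub>TA i\<^esub> te i a"
        unfolding comp_apply .
    qed (rule refl)
    finally have eq: "(\<Oplus>\<^bsub>GS\<^esub>a\<in>E. ?c a [^]\<^bsub>GS\<^esub> p \<otimes>\<^bsub>GS\<^esub> (\<lambda>i. te i a)) i
        = (\<Oplus>\<^bsub>TA i\<^esub>a\<in>E. ?c a i [^]\<^bsub>TA i\<^esub> p \<otimes>\<^bsub>TA i\<^esub> te i a)" .
    show "s i = (\<Oplus>\<^bsub>GS\<^esub>a\<in>E. ?c a [^]\<^bsub>GS\<^esub> p \<otimes>\<^bsub>GS\<^esub> (\<lambda>i. te i a)) i"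
      by (rule trans [OF s_eq eq [symmetric]])
  qed
qed

end

section \<open>Completion of the tower\<close>

lemma (in cring) nat_pow_in_ideal_of_square:
  assumes "ideal I R" "r \<in> carrier R" "r \<otimes> r \<in> I" "2 \<le> (k::nat)"
  shows "r [^] k \<in> I"
proof -
  obtain q where "k = Suc (Suc q)" using assms(4) by (metis Suc_le_D numeral_2_eq_2 Suc_le_mono)
  then show ?thesis
    using assms(2) ideal.I_l_closed [OF assms(1,3)] by (simp add: m_assoc)
qed

locale gabber_ideal = gabber_tower R p x for R (structure) and p x +
  fixes J assumes J: "ideal J R"
begin

definition "F0 m = Base ` ideal_pow R J m"
definition "J' = {s \<in> carrier GS. gabber_proj s \<in> J}"

lemma F0_ideal: "ideal (F0 m) (TA 0)"
  unfolding F0_def by (rule ideal_image_iso [OF is_cring TA_cring Base_iso ideal_ideal_pow [OF J]])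

lemma gabber_proj_in_iff:
  assumes "s \<in> carrier GS"
  shows "gabber_proj s \<in> J \<longleftrightarrow> s 0 \<in> F0 (Suc 0)"
proof -
  have "s 0 = Base (gabber_proj s)"
    using assms base_elem_Base [of "s 0" p R x] by (simp add: GS_carrier gabber_proj_def)
  then show ?thesis by (auto simp: F0_def ideal_pow_1 [OF J])
qed

lemma J'_eq: "J' = {s \<in> carrier GS. s 0 \<in> F0 (Suc 0)}"
  using gabber_proj_in_iff by (auto simp: J'_def)

lemma J'_ideal: "ideal J' GS"
  unfolding J'_eq
  by (rule ring_hom_ring.ideal_vimage [OF ring_hom_ringI2 [OF GS.ring_axioms _ GS_proj] F0_ideal])
    (rule cring.axioms(1) [OF TA_cring])

text \<open>The coordinates of component i + 1 are component i of the coefficients in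
  \<open>gabber_decomposition\<close>, so the induction hypothesis applies to these coefficients.
  Stage 0 only reveals membership in \<open>J'\<close>, which is why the bound starts at exponent
  1.\<close>

lemma fil_subset_ideal_pow:
  assumes "s \<in> carrier GS" "s i \<in> fil F0 i m"
  shows "s \<in> ideal_pow GS J' (min m (Suc i))"
  using assms
proof (induction i arbitrary: s)
  case 0
  show ?case
  proof (cases m)
    case 0
    then show ?thesis using \<open>s \<in> carrier GS\<close> by (simp add: GS.ideal_pow_simps)
  next
    case (Suc k)
    have "ideal_pow R J m \<subseteq> ideal_pow R J (Suc 0)" by (rule ideal_pow_antimono [OF J]) (simp add: Suc)
    then have "s 0 \<in> F0 (Suc 0)" using 0 by (auto simp: F0_def)
    then have "s \<in> J'" using 0 by (simp add: J'_eq)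
    then show ?thesis using Suc by (simp add: GS.ideal_pow_1 [OF J'_ideal])
  qed
next
  case (Suc i)
  let ?c = "\<lambda>a i. FE.coord i (s (Suc i)) a"
  let ?I = "ideal_pow GS J' (min m (Suc (Suc i)))"
  interpret I: ideal ?I GS by (rule GS.ideal_ideal_pow [OF J'_ideal])
  have te: "(\<lambda>i. te i a) \<in> carrier GS" for a by (simp add: GS_carrier te_closed TP_te)
  have "?c a [^]\<^bsub>GS\<^esub> p \<in> ?I" if a: "a \<in> E" for a
  proof -
    have c: "?c a \<in> carrier GS" by (rule gabber_decomposition(1) [OF Suc.prems(1) a])
    have "?c a i \<in> fil F0 i m" using Suc.prems(2) a by (simp add: FE.ext_ideal_def)
    then have cI: "?c a \<in> ideal_pow GS J' (min m (Suc i))" using Suc.IH [OF c] by simp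
    \<comment> \<open>If m is at most i + 1, the exponent is already m and any positive power will
      do. Otherwise it must rise by one: as p is at least 2, the p-th power is a multiple of the
      square, one factor of which lies in the power of \<open>J'\<close> already reached and the
      other in \<open>J'\<close>.\<close>
    show ?thesis
    proof (cases "m \<le> Suc i")
      case True
      then show ?thesis using GS.nat_pow_in_ideal [OF I.is_ideal _ p_pos] cI by (simp add: min_def)
    next
      case False
      have mins: "min m (Suc i) = Suc i" "min m (Suc (Suc i)) = Suc (Suc i)" using False by auto
      have "?c a \<in> ideal_pow GS J' (Suc 0)"
        using cI GS.ideal_pow_antimono [OF J'_ideal, of "Suc 0" "Suc i"] mins by auto
      then have "?c a \<in> J'" by (simp add: GS.ideal_pow_1 [OF J'_ideal])
      then have cc: "?c a \<otimes>\<^bsub>GS\<^esub> ?c a \<in> ?I"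
        using cI unfolding mins GS.ideal_pow_simps(2) by (intro ideal_prod.prod) (auto simp: GS.ideal_pow_simps(2))
      show ?thesis by (rule GS.nat_pow_in_ideal_of_square [OF I.is_ideal c cc prime_ge_2_nat [OF prime_p]])
    qed
  qed
  then have "(\<Oplus>\<^bsub>GS\<^esub>a\<in>E. ?c a [^]\<^bsub>GS\<^esub> p \<otimes>\<^bsub>GS\<^esub> (\<lambda>i. te i a)) \<in> ?I"
    by (intro I.finsum_in_ideal Pi_I I.I_r_closed te)
  then show ?case by (subst gabber_decomposition(2) [OF Suc.prems(1)])
qed

section \<open>Powers of the preimage ideal inside the filtration\<close>

lemma noetherian_tower: "noetherian_ring R \<Longrightarrow> noetherian_ring (TA i)"
  by (induction i) (auto intro: noetherian_ring_iso [OF is_cring TA_cring Base_iso] FE.noetherian_ext)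

text \<open>The preimage of J in stage i under the composed transition maps. It contains the
  projection of \<open>J'\<close> and is visibly an ideal, without appeal to surjectivity of
  projections.\<close>

primrec J_pre :: "nat \<Rightarrow> 'a tower_elem set" where
  "J_pre 0 = F0 (Suc 0)"
| "J_pre (Suc i) = {r \<in> carrier (TA (Suc i)). TP i r \<in> J_pre i}"

lemma J_pre_ideal: "ideal (J_pre i) (TA i)"
proof (induction i)
  case (Suc i)
  then show ?case using TP.ring.ideal_vimage [OF Suc] by simp
qed (simp add: F0_ideal)

lemma J_pre_proj: "s \<in> J' \<Longrightarrow> s i \<in> J_pre i"
  by (induction i) (auto simp: J'_eq GS_carrier)

text \<open>An element \<open>r\<close> of \<open>R\<^sub>i\<^sub>+\<^sub>1\<close> satisfies \<open>r\<^sup>p = \<iota> (\<phi> r)\<close>, so that its powers are controlled by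
  those of \<open>\<phi> r\<close>.\<close>

lemma J_pre_radical: "r \<in> J_pre i \<Longrightarrow> \<exists>q::nat. r [^]\<^bsub>TA i\<^esub> q \<in> fil F0 i m"
proof (induction i arbitrary: r)
  case 0
  then obtain a where a: "a \<in> J" "r = Base a" by (auto simp: F0_def ideal_pow_1 [OF J])
  have ac: "a \<in> carrier R" using a ideal.Icarr [OF J] by blast
  \<comment> \<open>At stage 0 the exponent is m; every further stage multiplies it by p.\<close>
  have "r [^]\<^bsub>TA 0\<^esub> m = Base (a [^] m)"
    using ring_hom_nat_pow [of Base R "TA 0" a m] Base_iso [of R p x] ac a
    by (simp add: ring_iso_def ring_axioms cring.axioms(1) [OF TA_cring])
  moreover have "a [^] m \<in> ideal_pow R J m"
    by (rule nat_pow_in_ideal_pow [OF _ a(1)]) (use ideal.Icarr [OF J] in blast)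
  ultimately show ?case by (auto simp: F0_def)
next
  case (Suc i)
  have r: "r \<in> carrier (TA (Suc i))" "TP i r \<in> J_pre i" using Suc.prems by auto
  obtain q :: nat where q: "TP i r [^]\<^bsub>TA i\<^esub> q \<in> fil F0 i m" using Suc.IH [OF r(2)] by blast
  have "TI i (TP i r [^]\<^bsub>TA i\<^esub> q) = r [^]\<^bsub>TA (Suc i)\<^esub> (p * q)"
    using r(1) ring_hom_nat_pow [OF FE.homh TA.ring_axioms TA.ring_axioms TP.hom_closed [OF r(1)], of q]
    by (simp add: TI_TP TA.nat_pow_pow)
  then show ?case using TI_fil [OF F0_ideal q] by metis
qed

text \<open>The powers of \<open>J'\<close> are projected to stage i, which is known to be
  Noetherian, so that \<open>J_pre_radical\<close> yields a uniform exponent there.\<close>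

lemma ideal_pow_subset_fil:
  assumes "noetherian_ring R"
  shows "\<exists>N. \<forall>s\<in>ideal_pow GS J' N. s i \<in> fil F0 i m"
proof -
  obtain N where N: "ideal_pow (TA i) (J_pre i) N \<subseteq> fil F0 i m"
    using ideal_pow_subset_of_radical [OF TA_cring noetherian_tower [OF assms] J_pre_ideal
        ideal_fil [of F0 i m, OF F0_ideal] J_pre_radical] by blast
  have "(\<lambda>s. s i) ` ideal_pow GS J' N \<subseteq> ideal_pow (TA i) (J_pre i) N"
    by (rule ring_hom_ideal_pow [OF GS.is_cring TA_cring GS_proj J'_ideal]) (use J_pre_proj in auto)
  then show ?thesis using N by blast
qed

end

section \<open>Surjectivity of the transition maps\<close>

lemma (in gabber_tower) tower_phi_surj:
  assumes gen: "p_generating p R x" and r: "r \<in> carrier (TA i)"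
  shows "\<exists>s\<in>carrier (TA (Suc i)). TP i s = r"
  using r
proof (induction i arbitrary: r)
  case 0
  have B: "Base \<in> ring_hom R (TA 0)" using Base_iso [of R p x] by (simp add: ring_iso_def)
  interpret B: ring_hom_cring R "TA 0" Base
    by (simp add: ring_hom_cring_def ring_hom_cring_axioms_def is_cring TA_cring B)
  let ?P = "TP 0 ` carrier (TA (Suc 0))"
  \<comment> \<open>The image is a subring. It contains the p-th powers, coming from included
    elements, and the x j, coming from the adjoined roots; these generate R.\<close>
  have img: "Base h \<in> ?P" if "h \<in> generate_ring R ((\<lambda>r. r [^] p) ` carrier R \<union> set x)" for h
    using that
  proof induction
    case one
    have "TP 0 \<one>\<^bsub>TA (Suc 0)\<^esub> = Base \<one>" by simp
    then show ?case by (metis TA.one_closed image_eqI)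
  next
    case (incl h)
    then consider a where "a \<in> carrier R" "h = a [^] p" | j where "j < n" "h = x ! j"
      by (auto simp: in_set_conv_nth)
    then show ?case
    proof cases
      case 1
      then have "TP 0 (TI 0 (Base a)) = Base h"
        by (simp add: TP_TI ring_hom_nat_pow [OF B ring_axioms TA.ring_axioms])
      moreover have "TI 0 (Base a) \<in> carrier (TA (Suc 0))" using 1 by simp
      ultimately show ?thesis by (metis image_eqI)
    next
      case 2
      then have "TP 0 (TX (Suc 0) ! j) = Base h" by (simp only: TP_TX) (simp add: tower.simps)
      then show ?thesis using TX_closed [OF 2(1), of "Suc 0"] by (metis image_eqI)
    qed
  next
    case (a_inv h)
    then obtain s where s: "s \<in> carrier (TA (Suc 0))" "Base h = TP 0 s" by blast
    have "h \<in> carrier R" using a_inv.hyps gen unfolding p_generating_def by blast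
    then have "TP 0 (\<ominus>\<^bsub>TA (Suc 0)\<^esub> s) = Base (\<ominus> h)" using s by simp
    then show ?case using s by (metis TA.a_inv_closed image_eqI)
  next
    case (eng_add h1 h2)
    then obtain s t where st: "s \<in> carrier (TA (Suc 0))" "Base h1 = TP 0 s" "t \<in> carrier (TA (Suc 0))" "Base h2 = TP 0 t"
      by blast
    have "h1 \<in> carrier R" "h2 \<in> carrier R" using eng_add.hyps gen unfolding p_generating_def by blast+
    then have "TP 0 (s \<oplus>\<^bsub>TA (Suc 0)\<^esub> t) = Base (h1 \<oplus> h2)" using st by simp
    then show ?case using st by (metis TA.a_closed image_eqI)
  next
    case (eng_mult h1 h2)
    then obtain s t where st: "s \<in> carrier (TA (Suc 0))" "Base h1 = TP 0 s" "t \<in> carrier (TA (Suc 0))" "Base h2 = TP 0 t"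
      by blast
    have "h1 \<in> carrier R" "h2 \<in> carrier R" using eng_mult.hyps gen unfolding p_generating_def by blast+
    then have "TP 0 (s \<otimes>\<^bsub>TA (Suc 0)\<^esub> t) = Base (h1 \<otimes> h2)" using st by simp
    then show ?case using st by (metis TA.m_closed image_eqI)
  qed
  obtain a where a: "a \<in> carrier R" "r = Base a"
    using 0 by (auto simp: tower.simps image_ring_carrier)
  have "r \<in> ?P" unfolding a(2) by (rule img) (use a(1) gen in \<open>simp add: p_generating_def\<close>)
  then show ?case by blast
next
  case (Suc i)
  \<comment> \<open>Preimages d a of the coordinates of r are taken one stage below. Used as
    coefficients one stage up they enter as p-th powers, and the p-th power of \<open>d a\<close> is
    the included coordinate, so the combination maps to r.\<close>
  have "\<forall>a\<in>E. \<exists>d\<in>carrier (TA (Suc i)). TP i d = FE.coord i r a"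
    using Suc.IH FE.coord_closed [OF Suc.prems] by blast
  then obtain d where d: "\<And>a. a \<in> E \<Longrightarrow> d a \<in> carrier (TA (Suc i))" "\<And>a. a \<in> E \<Longrightarrow> TP i (d a) = FE.coord i r a"
    by metis
  then have df: "d \<in> E \<rightarrow> carrier (TA (Suc i))" by auto
  have "TP (Suc i) (FE.lincomb (Suc i) d)
      = (\<Oplus>\<^bsub>TA (Suc i)\<^esub>a\<in>E. d a [^]\<^bsub>TA (Suc i)\<^esub> p \<otimes>\<^bsub>TA (Suc i)\<^esub> te (Suc i) a)"
    by (rule TP_lincomb [OF df])
  also have "\<dots> = FE.lincomb i (FE.coord i r)"
    unfolding FE.lincomb_def
    by (rule TA.finsum_cong')
      (use d FE.coord_closed [OF Suc.prems] in \<open>auto simp: te_closed TI_TP [symmetric]\<close>)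
  finally show ?case using FE.lincomb_closed [OF df] FE.lincomb_coord [OF Suc.prems] by auto
qed

section \<open>Functoriality of the tower and its completion\<close>

locale gabber_tower_map = S: gabber_tower R p x + T: gabber_tower Q p z
  for R :: "('a, 'b) ring_scheme" and Q :: "('c, 'd) ring_scheme" and p x z +
  fixes h assumes h_hom: "h \<in> ring_hom R Q" and z_eq: "z = map h x"
begin

text \<open>The choice is meaningful once \<open>tmap i\<close> is known to be a homomorphism
  respecting generators; this is then passed on by the universal property in
  \<open>tmap_Suc\<close>.\<close>

primrec tmap :: "nat \<Rightarrow> 'a tower_elem \<Rightarrow> 'c tower_elem" where
  "tmap 0 = (\<lambda>s. Base (h (base_elem s)))"
| "tmap (Suc i) = (SOME g. g \<in> ring_hom (S.TA (Suc i)) (T.TA (Suc i))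
     \<and> (\<forall>r\<in>carrier (S.TA i). g (S.TI i r) = T.TI i (tmap i r))
     \<and> (\<forall>j<length x. g (S.TX (Suc i) ! j) = T.TX (Suc i) ! j))"

lemma len_z: "length z = length x" by (simp add: z_eq)

lemma tmap_0: "tmap 0 \<in> ring_hom (S.TA 0) (T.TA 0) \<and> (\<forall>j<length x. tmap 0 (S.TX 0 ! j) = T.TX 0 ! j)"
proof
  let ?b = "inv_into (carrier R) Base"
  have b: "?b \<in> ring_hom (S.TA 0) R"
    using ring_iso_set_sym [OF S.ring_axioms Base_iso [of R p x]] by (simp add: ring_iso_def)
  have B: "Base \<in> ring_hom Q (T.TA 0)" using Base_iso [of Q p z] by (simp add: ring_iso_def)
  have comp: "Base \<circ> (h \<circ> ?b) \<in> ring_hom (S.TA 0) (T.TA 0)"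
    by (rule ring_hom_trans [OF ring_hom_trans [OF b h_hom] B])
  have "?b s = base_elem s" if "s \<in> carrier (S.TA 0)" for s
    using that by (auto simp: tower.simps image_ring_carrier inj_on_def)
  then show "tmap 0 \<in> ring_hom (S.TA 0) (T.TA 0)"
    by (intro ring.ring_hom_restrict [OF cring.axioms(1) [OF S.TA_cring] comp]) simp
  show "\<forall>j<length x. tmap 0 (S.TX 0 ! j) = T.TX 0 ! j"
  proof (intro allI impI)
    fix j assume j: "j < length x"
    then have "z ! j = h (x ! j)" by (simp add: z_eq)
    then show "tmap 0 (S.TX 0 ! j) = T.TX 0 ! j" using j by (simp add: tower.simps len_z)
  qed
qed

lemma tmap_Suc:
  assumes "tmap i \<in> ring_hom (S.TA i) (T.TA i)" "\<forall>j<length x. tmap i (S.TX i ! j) = T.TX i ! j"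
  shows "tmap (Suc i) \<in> ring_hom (S.TA (Suc i)) (T.TA (Suc i))
     \<and> (\<forall>r\<in>carrier (S.TA i). tmap (Suc i) (S.TI i r) = T.TI i (tmap i r))
     \<and> (\<forall>j<length x. tmap (Suc i) (S.TX (Suc i) ! j) = T.TX (Suc i) ! j)"
proof -
  have "\<exists>g\<in>ring_hom (S.TA (Suc i)) (T.TA (Suc i)).
    (\<forall>r\<in>carrier (S.TA i). g (S.TI i r) = (T.TI i \<circ> tmap i) r)
     \<and> (\<forall>j<length x. g (S.TX (Suc i) ! j) = T.TX (Suc i) ! j)"
    by (rule S.tower_universal [OF T.TA_cring ring_hom_trans [OF assms(1) T.FE.homh]])
      (use assms(2) T.TX_closed T.TX_pow len_z in auto)
  then have "\<exists>g. g \<in> ring_hom (S.TA (Suc i)) (T.TA (Suc i))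
     \<and> (\<forall>r\<in>carrier (S.TA i). g (S.TI i r) = T.TI i (tmap i r))
     \<and> (\<forall>j<length x. g (S.TX (Suc i) ! j) = T.TX (Suc i) ! j)" by auto
  from someI_ex [OF this] show ?thesis by simp
qed

declare tmap.simps [simp del]

lemma tmap_invariant: "tmap i \<in> ring_hom (S.TA i) (T.TA i) \<and> (\<forall>j<length x. tmap i (S.TX i ! j) = T.TX i ! j)"
  by (induction i) (use tmap_0 tmap_Suc in blast)+

lemma tmap_hom: "tmap i \<in> ring_hom (S.TA i) (T.TA i)"
  and tmap_TX: "j < length x \<Longrightarrow> tmap i (S.TX i ! j) = T.TX i ! j"
  and tmap_TI: "r \<in> carrier (S.TA i) \<Longrightarrow> tmap (Suc i) (S.TI i r) = T.TI i (tmap i r)"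
  using tmap_invariant tmap_Suc by blast+

sublocale tmap: ring_hom_cring "S.TA i" "T.TA i" "tmap i" for i
  by (simp add: ring_hom_cring_def ring_hom_cring_axioms_def S.TA_cring T.TA_cring tmap_hom)

lemma tmap_te: "tmap i (S.te i a) = T.te i a"
  unfolding S.te_def T.te_def tmap.hom_mon_val [OF S.TX_funcset] len_z
  by (rule mon_val_cong [OF T.TA_cring]) (use T.TX_funcset len_z tmap_TX in auto)

text \<open>Along the basis both composites become the same sum of p-th powers of mapped
  coefficients times monomials.\<close>

lemma tmap_TP:
  assumes b: "b \<in> carrier (S.TA (Suc i))"
  shows "tmap i (S.TP i b) = T.TP i (tmap (Suc i) b)"
proof -
  define c where "c = S.FE.coord i b"
  have c: "c \<in> S.E \<rightarrow> carrier (S.TA i)" unfolding c_def by (rule S.FE.coord_funcset [OF b])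
  then have cc: "c a \<in> carrier (S.TA i)" if "a \<in> S.E" for a using that by auto
  have bc: "b = S.FE.lincomb i c" unfolding c_def by (rule S.FE.lincomb_coord [OF b, symmetric])
  have uc: "(\<lambda>a. tmap i (c a)) \<in> T.E \<rightarrow> carrier (T.TA i)" using cc by (auto simp: len_z)
  have "tmap i (S.TP i b) = (\<Oplus>\<^bsub>T.TA i\<^esub>a\<in>S.E. (tmap i \<circ> (\<lambda>a. c a [^]\<^bsub>S.TA i\<^esub> p \<otimes>\<^bsub>S.TA i\<^esub> S.te i a)) a)"
    unfolding bc S.TP_lincomb [OF c] by (rule tmap.hom_finsum) (auto simp: cc S.te_closed)
  also have "\<dots> = (\<Oplus>\<^bsub>T.TA i\<^esub>a\<in>T.E. tmap i (c a) [^]\<^bsub>T.TA i\<^esub> p \<otimes>\<^bsub>T.TA i\<^esub> T.te i a)"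
    by (rule T.TA.finsum_cong')
      (auto simp: len_z cc S.te_closed T.te_closed tmap_te ring_hom_nat_pow [OF tmap_hom S.TA.ring_axioms T.TA.ring_axioms])
  also have "\<dots> = T.TP i (T.FE.lincomb i (\<lambda>a. tmap i (c a)))" by (rule T.TP_lincomb [OF uc, symmetric])
  also have "T.FE.lincomb i (\<lambda>a. tmap i (c a))
      = (\<Oplus>\<^bsub>T.TA (Suc i)\<^esub>a\<in>S.E. (tmap (Suc i) \<circ> (\<lambda>a. S.TI i (c a) \<otimes>\<^bsub>S.TA (Suc i)\<^esub> S.te (Suc i) a)) a)"
    unfolding T.FE.lincomb_def
    by (rule T.TA.finsum_cong') (auto simp: len_z cc S.te_closed tmap_TI tmap_te)
  also have "\<dots> = tmap (Suc i) b"
    unfolding bc S.FE.lincomb_def by (rule tmap.hom_finsum [symmetric]) (auto simp: cc S.te_closed)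
  finally show ?thesis .
qed

lemma filtered_completion_tower:
  assumes "filtered_completion (S.TA 0) (T.TA 0) (tmap 0) F G"
  shows "filtered_completion (S.TA i) (T.TA i) (tmap i) (S.fil F i) (T.fil G i)"
proof (induction i)
  case 0
  then show ?case using assms by (simp add: S.fil.simps(1) [abs_def] T.fil.simps(1) [abs_def])
next
  case (Suc i)
  \<comment> \<open>Reduced monomials depend only on the number of generators, so both towers share
    the index set of their bases.\<close>
  have "free_ext (T.TA i) (T.TA (Suc i)) (T.TI i) S.E (T.te (Suc i))"
    using T.free_ext_tower [of i] by (simp add: len_z)
  from filtered_completion_free_ext [OF Suc S.free_ext_tower this tmap_hom tmap_TI tmap_te]
  show ?case by (simp add: S.fil.simps(2) [abs_def] T.fil.simps(2) [abs_def] len_z)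
qed

lemma filtered_completion_gabber:
  assumes fc: "filtered_completion (S.TA 0) (T.TA 0) (tmap 0) F G" and gen: "p_generating p R x"
  shows "filtered_completion S.GS T.GS (\<lambda>s i. tmap i (s i))
    (\<lambda>m. {s \<in> carrier S.GS. s m \<in> S.fil F m m}) (\<lambda>m. {t \<in> carrier T.GS. t m \<in> T.fil G m m})"
  unfolding S.GS_eq T.GS_eq
proof (rule filtered_completion_inverse_limit [OF filtered_completion_tower [OF fc]])
  show "T.TP i b \<in> T.fil G i m" if "b \<in> T.fil G (Suc i) m" for i m b
    using T.TP_fil that filtered_completion.G_ideal [OF fc] by blast
qed (use S.TP_hom T.TP_hom tmap_TP S.tower_phi_surj [OF gen] in blast)+

end

theorem corollary3p2p4:
  fixes R :: "('a, 'b) ring_scheme" and p :: nat and x :: "'a list" and J :: "'a set"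
  defines "S \<equiv> gabber p R x"
  defines "J' \<equiv> {s \<in> carrier S. gabber_proj s \<in> J}"
  defines "Rhat \<equiv> adic_completion R J"
  defines "xhat \<equiv> map (to_completion R J) x"
  assumes "Factorial_Ring.prime p"
    and "cring R"
    and "[p] \<cdot>\<^bsub>R\<^esub> \<one>\<^bsub>R\<^esub> = \<zero>\<^bsub>R\<^esub>"
    and "noetherian_ring R"
    and "F_finite p R"
    and "p_generating p R x"
    and "ideal J R"
  shows "(\<exists>\<Theta> \<in> ring_iso (adic_completion S J') (gabber p Rhat xhat).
            \<forall>s\<in>carrier S.
              gabber_proj (\<Theta> (to_completion S J' s)) = to_completion R J (gabber_proj s))
         \<and> adic_completion S J' \<simeq> gabber p Rhat xhat"
proof -
  interpret adic R J using assms(6,11) by (simp add: adic_def adic_axioms_def)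
  have "set x \<subseteq> carrier R" using assms(10) by (simp add: p_generating_def)
  then interpret T1: gabber_ideal R p x J
    using assms(5,7) J_ideal is_cring
    by (simp add: gabber_ideal_def gabber_ideal_axioms_def gabber_tower_def gabber_tower_axioms_def)
  interpret H: cring Rhat unfolding Rhat_def by (rule adic_completion_cring)
  have h: "to_completion R J \<in> ring_hom R Rhat" unfolding Rhat_def by (rule to_completion_hom)
  have "[p] \<cdot>\<^bsub>Rhat\<^esub> \<one>\<^bsub>Rhat\<^esub> = to_completion R J ([p] \<cdot>\<^bsub>R\<^esub> \<one>\<^bsub>R\<^esub>)"
    using ring_hom_add_pow [OF ring_axioms H.ring_axioms h one_closed] ring_hom_one [OF h] by simp
  also have "\<dots> = \<zero>\<^bsub>Rhat\<^esub>"
    using ring_hom_cring.hom_zero [of R Rhat "to_completion R J"] h assms(7)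
    by (simp add: ring_hom_cring_def ring_hom_cring_axioms_def is_cring H.is_cring)
  finally have char: "[p] \<cdot>\<^bsub>Rhat\<^esub> \<one>\<^bsub>Rhat\<^esub> = \<zero>\<^bsub>Rhat\<^esub>" .
  have "set xhat \<subseteq> carrier Rhat"
    using \<open>set x \<subseteq> carrier R\<close> ring_hom_closed [OF h] by (auto simp: xhat_def)
  then interpret M: gabber_tower_map R Rhat p x xhat "to_completion R J"
    using assms(5) char h T1.gabber_tower_axioms H.is_cring
    by (simp add: gabber_tower_map_def gabber_tower_map_axioms_def gabber_tower_def gabber_tower_axioms_def xhat_def)
  \<comment> \<open>The kernels of the projections of the completion to R modulo powers of J, copied
    to stage 0 of its tower.\<close>
  let ?G = "\<lambda>n. Base ` {s \<in> carrier Rhat. s n = Jp n}"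
  let ?u = "\<lambda>s i. M.tmap i (s i)"
  have "filtered_completion (tower_ring p R x 0) (tower_ring p Rhat xhat 0) (M.tmap 0) T1.F0 ?G"
    unfolding T1.F0_def [abs_def]
    by (rule filtered_completion_iso [OF filtered_completion_adic [folded Rhat_def] Base_iso T1.TA_cring Base_iso M.T.TA_cring])
      (simp add: M.tmap.simps)
  note fc = M.filtered_completion_gabber [OF this assms(10)]
  have J'_eq: "J' = T1.J'" by (simp add: J'_def T1.J'_def S_def)
  have "\<exists>\<Theta>\<in>ring_iso (adic_completion S J') (gabber p Rhat xhat). \<forall>s\<in>carrier S. \<Theta> (to_completion S J' s) = ?u s"
    unfolding J'_eq unfolding S_def
  proof (rule adic_completion_iso [OF fc T1.J'_ideal])
    \<comment> \<open>With stage and index both equal to m, the minimum of m and m + 1 is m, so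
      nothing is lost.\<close>
    show "{s \<in> carrier T1.GS. s m \<in> T1.fil T1.F0 m m} \<subseteq> ideal_pow T1.GS T1.J' m" for m
      using T1.fil_subset_ideal_pow [of _ m m] by (auto simp: min_def)
    show "\<exists>N. ideal_pow T1.GS T1.J' N \<subseteq> {s \<in> carrier T1.GS. s m \<in> T1.fil T1.F0 m m}" for m
      using T1.ideal_pow_subset_fil [OF assms(8), of m m]
        ideal.Icarr [OF T1.GS.ideal_ideal_pow [OF T1.J'_ideal]] by blast
  qed
  then obtain \<Theta> where \<Theta>: "\<Theta> \<in> ring_iso (adic_completion S J') (gabber p Rhat xhat)"
    "\<And>s. s \<in> carrier S \<Longrightarrow> \<Theta> (to_completion S J' s) = ?u s" by blast
  \<comment> \<open>Only component 0 matters for the square, and there \<open>tmap 0\<close> is the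
    completion map of R up to \<open>Base\<close>.\<close>
  then have "gabber_proj (\<Theta> (to_completion S J' s)) = to_completion R J (gabber_proj s)"
    if "s \<in> carrier S" for s
    using that by (simp add: gabber_proj_def M.tmap.simps)
  then show ?thesis using \<Theta>(1) by (auto simp: is_ring_iso_def)
qed

end
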